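(* For any orderon $U$ and any $\varepsilon>0$, there exist $\ell=\ell(U,\varepsilon)\in\mathbb{N}$ and an $(\ell,\ell)$-strip layered orderon $U'\in\overline{\mathcal{H}_U}$ such that $d_1(U,U')\le\varepsilon$.
   Context: An orderon is a (Lebesgue) measurable function $W:([0,1]^2)^2\to[0,1]$ with $W(u,v)=W(v,u)$ for all $u,v\in[0,1]^2$. $d_1(W,U)=\int|W-U|$ is the $L^1$-distance. Let $\pi_1(y,b)=y$. Simple ordered graphs are loopless graphs on vertex sets $[k]$ with the natural order (isomorphism means equality). For a simple ordered graph $F=([k],E)$, $$t(F,W)=k!\int_{v\in([0,1]^2)^k,\ \pi_1(v_1)\le\cdots\le\pi_1(v_k)}\ \prod_{i<j,\ ij\in E}W(v_i,v_j)\prod_{i<j,\ ij\notin E}(1-W(v_i,v_j))\,dv .$$ $\mathcal{H}_U$ is the property consisting of exactly those simple ordered graphs $F$ with $t(F,U)>0$. The closure $\overline{\mathcal{P}}$ of a property $\mathcal{P}$ of ordered graphs is the set of all orderons $W$ for which there is a sequence $G_n\in\mathcal{P}$ with $|V(G_n)|\to\infty$ and $d_\triangle(W_{G_n},W)\to 0$. Here, for an ordered graph $G$ on $[n]$ viewed as a symmetric function $G:[n]^2\to\{0,1\}$, $W_G((x,a),(y,b))=G(Q_n(x),Q_n(y))$ with $Q_n(x)=\lceil nx\rceil$ for $x>0$ and $Q_n(0)=1$; and $d_\triangle(W,V)=\inf_f\left(\mathrm{Shift}(f)+\|W-V^f\|_\square\right)$ over bijections $f$ of $[0,1]^2$ such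 that $f$ and $f^{-1}$ are Lebesgue measure preserving, where $V^f(u,v)=V(f(u),f(v))$, $\mathrm{Shift}(f)=\sup_{(x,a)}|x-\pi_1(f(x,a))|$, and $\|\cdot\|_\square$ is the cut-norm $\|X\|_\square=\sup_{S,T\subseteq[0,1]^2}|\int_{S\times T}X|$ over measurable $S,T$. An $(\ell,k)$-strip layered orderon is an orderon $W$ that is a step function with the following steps (values on null sets such as step boundaries and the set where the first coordinates coincide are irrelevant). For strips $j\ne j'$ in $[\ell]$ and layers $i,i'\in[k]$, $W$ is constant on $\left([\tfrac{j-1}{\ell},\tfrac{j}{\ell}]\times[\tfrac{i-1}{k},\tfrac{i}{k}]\right)\times\left([\tfrac{j'-1}{\ell},\tfrac{j'}{\ell}]\times[\tfrac{i'-1}{k},\tfrac{i'}{k}]\right)$. For $j\in[\ell]$ and $i,i'\in[k]$, $W$ is constant on each of the two subsets of $\left([\tfrac{j-1}{\ell},\tfrac{j}{\ell}]\times[\tfrac{i-1}{k},\tfrac{i}{k}]\right)\times\left([\tfrac{j-1}{\ell},\tfrac{j}{\ell}]\times[\tfrac{i'-1}{k},\tfrac{i'}{k}]\right)$ consisting of the points $((x,a),(y,b))$ with $x<y$ and with $y<x$, respectively. *)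

theory Defs
  imports "HOL-Analysis.Analysis"
begin

type_synonym point = "real \<times> real"

definition unit_square :: "point set" where
  "unit_square = {0..1} \<times> {0..1}"

text \<open>
  Orderons are total functions in HOL; everything below depends only on their values
  on \<open>unit_square \<times> unit_square\<close>.
\<close>

definition orderon :: "(point \<times> point \<Rightarrow> real) \<Rightarrow> bool" where
  "orderon W \<longleftrightarrow>
     W \<in> borel_measurable (lebesgue_on (unit_square \<times> unit_square)) \<and>
     (\<forall>u\<in>unit_square. \<forall>v\<in>unit_square. 0 \<le> W (u, v) \<and> W (u, v) \<le> 1 \<and> W (u, v) = W (v, u))"

definition d1 :: "(point \<times> point \<Rightarrow> real) \<Rightarrow> (point \<times> point \<Rightarrow> real) \<Rightarrow> real" where
  "d1 W U = (LINT p:unit_square \<times> unit_square|lebesgue. \<bar>W p - U p\<bar>)"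

text \<open>
  A pair \<open>(k, E)\<close> is the graph on \<open>{1..k}\<close>, with the natural order, whose edges are the
  two-element sets in \<open>E\<close>. A property of ordered graphs is a set of such pairs: an
  isomorphism of ordered graphs on initial segments is an equality, so no closure under
  isomorphism is needed.
\<close>

type_synonym ordered_graph = "nat \<times> nat set set"

definition is_ordered_graph :: "ordered_graph \<Rightarrow> bool" where
  "is_ordered_graph G \<longleftrightarrow>
     snd G \<subseteq> {{i, j} |i j. i \<in> {1..fst G} \<and> j \<in> {1..fst G} \<and> i \<noteq> j}"

definition pairs_below :: "nat \<Rightarrow> (nat \<times> nat) set" where
  "pairs_below k = {(i, j). i \<in> {1..k} \<and> j \<in> {1..k} \<and> i < j}"

text \<open>
  The completed product measure is Lebesgue measure on the space of \<open>k\<close>-tuples of points.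
  The completion matters: an orderon is only Lebesgue measurable, so the integrand need not
  be measurable for the product of the Borel measures.
\<close>

definition ordered_density :: "ordered_graph \<Rightarrow> (point \<times> point \<Rightarrow> real) \<Rightarrow> real" where
  "ordered_density F W = (let k = fst F; E = snd F in
     fact k *
     (LINT v:{v \<in> {1..k} \<rightarrow>\<^sub>E unit_square.
                \<forall>i\<in>{1..k}. \<forall>j\<in>{1..k}. i \<le> j \<longrightarrow> fst (v i) \<le> fst (v j)}
        |completion (Pi\<^sub>M {1..k} (\<lambda>_. lborel)).
        (\<Prod>(i, j)\<in>{(i, j) \<in> pairs_below k. {i, j} \<in> E}. W (v i, v j)) *
        (\<Prod>(i, j)\<in>{(i, j) \<in> pairs_below k. {i, j} \<notin> E}. 1 - W (v i, v j))))"

definition positive_density_property :: "(point \<times> point \<Rightarrow> real) \<Rightarrow> ordered_graph set" where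
  "positive_density_property U = {F. is_ordered_graph F \<and> ordered_density F U > 0}"

definition cell_index :: "nat \<Rightarrow> real \<Rightarrow> nat" where
  "cell_index n x = (if x = 0 then 1 else nat \<lceil>real n * x\<rceil>)"

definition graph_orderon :: "ordered_graph \<Rightarrow> point \<times> point \<Rightarrow> real" where
  "graph_orderon G = (\<lambda>((x, a), (y, b)).
     of_bool ({cell_index (fst G) x, cell_index (fst G) y} \<in> snd G))"

text \<open>
  The suprema and the infimum below are taken in \<open>real\<close>. For orderons they range over
  nonempty bounded sets, so the conventions for unbounded or empty sets play no role.
\<close>

definition cut_norm :: "(point \<times> point \<Rightarrow> real) \<Rightarrow> real" where
  "cut_norm X = Sup {\<bar>LINT p:S \<times> T|lebesgue. X p\<bar> |S T.
     S \<in> sets lebesgue \<and> S \<subseteq> unit_square \<and> T \<in> sets lebesgue \<and> T \<subseteq> unit_square}"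

definition shift :: "(point \<Rightarrow> point) \<Rightarrow> real" where
  "shift f = (SUP p\<in>unit_square. \<bar>fst p - fst (f p)\<bar>)"

definition measure_preserving_on_square :: "(point \<Rightarrow> point) \<Rightarrow> bool" where
  "measure_preserving_on_square f \<longleftrightarrow>
     f \<in> lebesgue_on unit_square \<rightarrow>\<^sub>M lebesgue_on unit_square \<and>
     distr (lebesgue_on unit_square) (lebesgue_on unit_square) f = lebesgue_on unit_square"

definition square_automorphisms :: "(point \<Rightarrow> point) set" where
  "square_automorphisms = {f. bij_betw f unit_square unit_square \<and>
     measure_preserving_on_square f \<and>
     measure_preserving_on_square (inv_into unit_square f)}"

definition d_triangle :: "(point \<times> point \<Rightarrow> real) \<Rightarrow> (point \<times> point \<Rightarrow> real) \<Rightarrow> real" where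
  "d_triangle W V =
     (INF f\<in>square_automorphisms. shift f + cut_norm (\<lambda>(u, v). W (u, v) - V (f u, f v)))"

definition property_closure :: "ordered_graph set \<Rightarrow> (point \<times> point \<Rightarrow> real) set" where
  "property_closure P = {W. orderon W \<and>
     (\<exists>G :: nat \<Rightarrow> ordered_graph. (\<forall>n. G n \<in> P) \<and>
        filterlim (\<lambda>n. fst (G n)) at_top sequentially \<and>
        (\<lambda>n. d_triangle (graph_orderon (G n)) W) \<longlonglongrightarrow> 0)}"

definition strip_layer_box :: "nat \<Rightarrow> nat \<Rightarrow> nat \<Rightarrow> nat \<Rightarrow> point set" where
  "strip_layer_box l k j i =
     {(real j - 1) / real l .. real j / real l} \<times> {(real i - 1) / real k .. real i / real k}"

definition ae_constant_on :: "(point \<times> point \<Rightarrow> real) \<Rightarrow> (point \<times> point) set \<Rightarrow> bool" where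
  "ae_constant_on W S \<longleftrightarrow> (\<exists>c. AE p in lebesgue. p \<in> S \<longrightarrow> W p = c)"

text \<open>
  Constancy is required up to null sets: the closed boxes overlap in their boundaries, so
  pointwise constancy would force the values on adjacent steps to agree. Positivity of the
  parameters is needed, as for \<open>l = 0\<close> or \<open>k = 0\<close> there would be no steps at all.
\<close>

definition strip_layered :: "nat \<Rightarrow> nat \<Rightarrow> (point \<times> point \<Rightarrow> real) \<Rightarrow> bool" where
  "strip_layered l k W \<longleftrightarrow> orderon W \<and> 0 < l \<and> 0 < k \<and>
     (\<forall>j\<in>{1..l}. \<forall>j'\<in>{1..l}. \<forall>i\<in>{1..k}. \<forall>i'\<in>{1..k}. j \<noteq> j' \<longrightarrow>
        ae_constant_on W (strip_layer_box l k j i \<times> strip_layer_box l k j' i')) \<and>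
     (\<forall>j\<in>{1..l}. \<forall>i\<in>{1..k}. \<forall>i'\<in>{1..k}.
        ae_constant_on W
          {((x, a), (y, b)). (x, a) \<in> strip_layer_box l k j i \<and>
             (y, b) \<in> strip_layer_box l k j i' \<and> x < y} \<and>
        ae_constant_on W
          {((x, a), (y, b)). (x, a) \<in> strip_layer_box l k j i \<and>
             (y, b) \<in> strip_layer_box l k j i' \<and> y < x})"

end

theory Submission
  imports Defs "HOL-Probability.Infinite_Product_Measure" "HOL-Library.Ramsey"
begin

text \<open>
  The graphs in \<open>\<H>\<^sub>U\<close> are easy to exhibit. Let \<open>P\<close> be a tuple of points with increasing
  abscissae such that \<open>U\<close> is approximately continuous at every pair of its points. Then every graph
  whose edges are pairs with \<open>U \<noteq> 0\<close> and whose non-edges are pairs with \<open>U \<noteq> 1\<close> has positive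
  density, because most tuples close to \<open>P\<close> contribute to it (\<open>ordered_density_pos\<close>). In
  particular the values of \<open>U\<close> at the pairs of \<open>P\<close> can be rounded to such a graph with
  small error on all cuts, by a derandomised Chernoff bound (\<open>graph_rounding\<close>). So it is
  enough to find point configurations for which the matrix of these values has the block
  structure of a strip layered orderon.

  Choose an abscissa \<open>x j\<close> in each strip and an ordinate \<open>a j i\<close> in each layer of each strip
  such that all pairs from different strips are density points. For a suitable random choice and a
  fine grid, the values of \<open>U\<close> at these pairs define a layered function that is close to \<open>U\<close> in
  \<open>L\<^sup>1\<close>, whatever its values on pairs in a common strip are, as these have small total measure
  (\<open>exists_layered_approx\<close>). Next, choose many points near each \<open>(x j, a j i)\<close> such that the
  layers of a strip are interleaved from left to right. At pairs from different strips the values of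
  \<open>U\<close> are then almost constant by approximate continuity. At pairs from a common strip nothing is
  known, but Ramsey's theorem selects blocks of points for which the values depend, up to a small
  error, only on the strip, the two layers and the order (\<open>homogeneous_points\<close>).

  The rounded graph is close to the layered orderon with these constants: the vertical slices of
  the \<open>l\<close> vertices of a block are carried to the \<open>l\<close> layers of a narrow column by a measure
  preserving bijection of small shift (\<open>interleave_automorphism\<close>, \<open>graph_near_layered\<close>). When the
  number of blocks grows, the finitely many constants converge along a subsequence, and the
  limit is the orderon wanted (\<open>layered_in_closure\<close>). As \<open>U\<close> may be changed on a null set, it is
  replaced by a Borel version at the outset (\<open>borel_orderon_version\<close>).
\<close>

section \<open>Random tuples of points\<close>

lemma emeasure_lborel_Times:
  fixes A :: "'a::euclidean_space set" and B :: "'b::euclidean_space set"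
  assumes "A \<in> sets borel" "B \<in> sets borel"
  shows "emeasure lborel (A \<times> B) = emeasure lborel A * emeasure lborel B"
  using assms by (subst lborel_prod[symmetric], subst lborel.emeasure_pair_measure_Times) auto

lemma measure_lborel_Times:
  fixes A :: "'a::euclidean_space set" and B :: "'b::euclidean_space set"
  assumes "A \<in> sets borel" "B \<in> sets borel"
  shows "measure lborel (A \<times> B) = measure lborel A * measure lborel B"
  using assms by (simp add: measure_def emeasure_lborel_Times enn2real_mult)

text \<open>
  Every event about a random tuple that matters below concerns two of its entries, so
  two-dimensional marginals are enough.
\<close>
lemma distr_PiM_pair:
  fixes M :: "'i \<Rightarrow> 'a measure"
  assumes "\<And>i. prob_space (M i)" "finite I" "i \<in> I" "j \<in> I" "i \<noteq> j"
  shows "distr (PiM I M) (M i \<Otimes>\<^sub>M M j) (\<lambda>v. (v i, v j)) = M i \<Otimes>\<^sub>M M j"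
proof (rule pair_measure_eqI[symmetric])
  interpret product_prob_space M I
    by (rule product_prob_spaceI) (rule assms(1))
  show "sigma_finite_measure (M i)" "sigma_finite_measure (M j)"
    by unfold_locales
  show "sets (M i \<Otimes>\<^sub>M M j) = sets (distr (PiM I M) (M i \<Otimes>\<^sub>M M j) (\<lambda>v. (v i, v j)))"
    by simp
  fix A B assume AB: "A \<in> sets (M i)" "B \<in> sets (M j)"
  let ?X = "\<lambda>k. if k = i then A else if k = j then B else space (M k)"
  have "emeasure (distr (PiM I M) (M i \<Otimes>\<^sub>M M j) (\<lambda>v. (v i, v j))) (A \<times> B)
      = emeasure (PiM I M) ((\<lambda>v. (v i, v j)) -` (A \<times> B) \<inter> space (PiM I M))"
    using assms AB by (subst emeasure_distr) auto
  also have "(\<lambda>v. (v i, v j)) -` (A \<times> B) \<inter> space (PiM I M) = PiE I ?X"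
  proof (intro set_eqI iffI)
    fix v assume "v \<in> (\<lambda>v. (v i, v j)) -` (A \<times> B) \<inter> space (PiM I M)"
    then show "v \<in> PiE I ?X" by (auto simp: space_PiM PiE_iff)
  next
    fix v assume v: "v \<in> PiE I ?X"
    have "v k \<in> space (M k)" if "k \<in> I" for k
      using PiE_mem[OF v that] sets.sets_into_space[OF AB(1)] sets.sets_into_space[OF AB(2)]
      by (auto split: if_splits)
    moreover have "v i \<in> A" "v j \<in> B"
      using PiE_mem[OF v assms(3)] PiE_mem[OF v assms(4)] assms(5) by auto
    ultimately show "v \<in> (\<lambda>v. (v i, v j)) -` (A \<times> B) \<inter> space (PiM I M)"
      using v by (auto simp: space_PiM PiE_iff)
  qed
  also have "emeasure (PiM I M) (PiE I ?X) = (\<Prod>k\<in>I. emeasure (M k) (?X k))"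
    using AB assms by (intro emeasure_PiM) auto
  also have "\<dots> = emeasure (M i) (?X i) * (\<Prod>k\<in>I-{i}. emeasure (M k) (?X k))"
    using assms by (subst prod.remove[of I i]) auto
  also have "(\<Prod>k\<in>I-{i}. emeasure (M k) (?X k)) = emeasure (M j) (?X j) * (\<Prod>k\<in>I-{i}-{j}. emeasure (M k) (?X k))"
    using assms by (subst prod.remove[of "I-{i}" j]) auto
  also have "(\<Prod>k\<in>I-{i}-{j}. emeasure (M k) (?X k)) = 1"
    using M.emeasure_space_1 by (intro prod.neutral) auto
  finally show "emeasure (M i) A * emeasure (M j) B
      = emeasure (distr (PiM I M) (M i \<Otimes>\<^sub>M M j) (\<lambda>v. (v i, v j))) (A \<times> B)"
    using assms by simp
qed

definition uniform_on :: "'a::euclidean_space set \<Rightarrow> 'a measure" where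
  "uniform_on C = uniform_measure lborel C"

definition has_uniform :: "'a::euclidean_space set \<Rightarrow> bool" where
  "has_uniform C \<longleftrightarrow> C \<in> sets borel \<and> emeasure lborel C \<noteq> 0 \<and> emeasure lborel C \<noteq> \<infinity>"

lemma sets_uniform_on [measurable_cong, simp]: "sets (uniform_on C) = sets borel"
  by (simp add: uniform_on_def)

lemma prob_space_uniform_on: "has_uniform C \<Longrightarrow> prob_space (uniform_on C)"
  unfolding uniform_on_def has_uniform_def by (intro prob_space_uniform_measure) auto

lemma AE_uniform_on:
  assumes "has_uniform C"
  shows "(AE x in uniform_on C. P x) \<longleftrightarrow> (AE x in lborel. x \<in> C \<longrightarrow> P x)"
  unfolding uniform_on_def
  using assms by (intro AE_uniform_measure) (auto simp: has_uniform_def top.not_eq_extremum)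

lemma has_uniform_Times:
  assumes "has_uniform C" "has_uniform D"
  shows "has_uniform (C \<times> D)"
proof -
  have "emeasure lborel (C \<times> D) = emeasure lborel C * emeasure lborel D"
    using assms by (intro emeasure_lborel_Times) (auto simp: has_uniform_def)
  then show ?thesis
    using assms by (auto simp: has_uniform_def ennreal_mult_eq_top_iff borel_Times)
qed

lemma uniform_on_pair:
  assumes "has_uniform C" "has_uniform D"
  shows "uniform_on C \<Otimes>\<^sub>M uniform_on D = uniform_on (C \<times> D)"
proof (rule pair_measure_eqI)
  show "sigma_finite_measure (uniform_on C)" "sigma_finite_measure (uniform_on D)"
    using assms prob_space_uniform_on prob_space_imp_sigma_finite by blast+
  show "sets (uniform_on C \<Otimes>\<^sub>M uniform_on D) = sets (uniform_on (C \<times> D))"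
    by (metis borel_prod sets_pair_measure_cong sets_uniform_on)
  fix A B assume AB: "A \<in> sets (uniform_on C)" "B \<in> sets (uniform_on D)"
  have C: "C \<in> sets borel" "D \<in> sets borel" using assms by (auto simp: has_uniform_def)
  have "(C \<times> D) \<inter> (A \<times> B) = (C \<inter> A) \<times> (D \<inter> B)" by auto
  then have "emeasure (uniform_on (C \<times> D)) (A \<times> B) = emeasure lborel ((C \<inter> A) \<times> (D \<inter> B)) / emeasure lborel (C \<times> D)"
    using AB C unfolding uniform_on_def by (subst emeasure_uniform_measure) (auto simp: borel_Times)
  also have "\<dots> = (emeasure lborel (C \<inter> A) * emeasure lborel (D \<inter> B)) / (emeasure lborel C * emeasure lborel D)"
    using AB C by (simp add: emeasure_lborel_Times)
  also have "\<dots> = (emeasure lborel (C \<inter> A) / emeasure lborel C) * (emeasure lborel (D \<inter> B) / emeasure lborel D)"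
    using assms by (simp add: divide_ennreal_def ennreal_inverse_mult has_uniform_def top.not_eq_extremum mult_ac)
  also have "\<dots> = emeasure (uniform_on C) A * emeasure (uniform_on D) B"
    using AB C by (simp add: uniform_on_def)
  finally show "emeasure (uniform_on C) A * emeasure (uniform_on D) B = emeasure (uniform_on (C \<times> D)) (A \<times> B)"
    by simp
qed

text \<open>
  The product of the uniform distributions has a density with respect to the product of the
  Lebesgue measures, and this density is positive exactly on the box. This moves null sets
  between the random tuples of the proof and the integral that defines ordered densities.
\<close>
lemma AE_PiM_uniform_on:
  fixes C :: "'i \<Rightarrow> 'a::euclidean_space set"
  assumes "finite I" "\<And>i. has_uniform (C i)"
  shows "(AE v in PiM I (\<lambda>i. uniform_on (C i)). P v) \<longleftrightarrow>
         (AE v in PiM I (\<lambda>_. lborel). v \<in> PiE I C \<longrightarrow> P v)"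
proof -
  define f where "f = (\<lambda>i x. indicator (C i) x / emeasure lborel (C i) :: ennreal)"
  have C[measurable]: "C i \<in> sets borel" for i using assms by (auto simp: has_uniform_def)
  have f[measurable]: "f i \<in> borel_measurable lborel" for i unfolding f_def by simp
  have u: "uniform_on (C i) = density lborel (f i)" for i
    by (simp add: uniform_on_def uniform_measure_def f_def)
  interpret P: product_prob_space "\<lambda>i. uniform_on (C i)" I
    by (rule product_prob_spaceI) (intro prob_space_uniform_on assms)
  interpret L: product_sigma_finite "\<lambda>i::'i. lborel :: 'a measure" by standard
  have dens: "density (PiM I (\<lambda>_. lborel)) (\<lambda>v. \<Prod>i\<in>I. f i (v i)) = PiM I (\<lambda>i. uniform_on (C i))"
  proof (rule P.PiM_eqI)
    show "finite I" by fact
    show "sets (density (PiM I (\<lambda>_. lborel)) (\<lambda>v. \<Prod>i\<in>I. f i (v i))) = sets (PiM I (\<lambda>i. uniform_on (C i)))"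
      by (auto intro!: sets_PiM_cong)
    fix A assume A: "\<And>i. i \<in> I \<Longrightarrow> A i \<in> sets (uniform_on (C i))"
    then have A'[measurable]: "\<And>i. i \<in> I \<Longrightarrow> A i \<in> sets borel" by simp
    have "emeasure (density (PiM I (\<lambda>_. lborel)) (\<lambda>v. \<Prod>i\<in>I. f i (v i))) (PiE I A)
      = (\<integral>\<^sup>+v. (\<Prod>i\<in>I. f i (v i)) * indicator (PiE I A) v \<partial>PiM I (\<lambda>_. lborel))"
      using assms(1) by (intro emeasure_density) (auto intro!: sets_PiM_I_finite)
    also have "\<dots> = (\<integral>\<^sup>+v. (\<Prod>i\<in>I. f i (v i) * indicator (A i) (v i)) \<partial>PiM I (\<lambda>_. lborel))"
    proof (intro nn_integral_cong)
      fix v assume "v \<in> space (PiM I (\<lambda>_. lborel :: 'a measure))"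
      then have "v \<in> extensional I" by (auto simp: space_PiM PiE_def)
      then have "indicator (PiE I A) v = (\<Prod>i\<in>I. indicator (A i) (v i) :: ennreal)"
        using assms(1) by (cases "v \<in> PiE I A") (auto simp: indicator_def PiE_def Pi_def intro!: prod.neutral[symmetric])
      then show "(\<Prod>i\<in>I. f i (v i)) * indicator (PiE I A) v = (\<Prod>i\<in>I. f i (v i) * indicator (A i) (v i))"
        by (simp add: prod.distrib)
    qed
    also have "\<dots> = (\<Prod>i\<in>I. \<integral>\<^sup>+x. f i x * indicator (A i) x \<partial>lborel)"
      using assms(1) A' by (intro L.product_nn_integral_prod) auto
    also have "\<dots> = (\<Prod>i\<in>I. emeasure (uniform_on (C i)) (A i))"
      using A' by (intro prod.cong refl) (simp add: u emeasure_density)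
    finally show "emeasure (density (PiM I (\<lambda>_. lborel)) (\<lambda>v. \<Prod>i\<in>I. f i (v i))) (PiE I A)
      = (\<Prod>i\<in>I. emeasure (uniform_on (C i)) (A i))" .
  qed
  have "(AE v in PiM I (\<lambda>i. uniform_on (C i)). P v) \<longleftrightarrow>
     (AE v in density (PiM I (\<lambda>_. lborel)) (\<lambda>v. \<Prod>i\<in>I. f i (v i)). P v)"
    unfolding dens ..
  also have "\<dots> \<longleftrightarrow> (AE v in PiM I (\<lambda>_. lborel). 0 < (\<Prod>i\<in>I. f i (v i)) \<longrightarrow> P v)"
    by (intro AE_density) measurable
  also have "\<dots> \<longleftrightarrow> (AE v in PiM I (\<lambda>_. lborel). v \<in> PiE I C \<longrightarrow> P v)"
  proof (intro AE_cong imp_cong refl)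
    fix v assume "v \<in> space (PiM I (\<lambda>_. lborel :: 'a measure))"
    then have "v \<in> extensional I" by (auto simp: space_PiM PiE_def)
    moreover have "f i (v i) = 0 \<longleftrightarrow> v i \<notin> C i" for i
      using assms(2)[of i] by (auto simp: f_def has_uniform_def ennreal_divide_eq_0_iff indicator_def)
    ultimately show "(0 < (\<Prod>i\<in>I. f i (v i))) = (v \<in> PiE I C)"
      using assms(1) by (auto simp: PiE_def zero_less_iff_neq_zero)
  qed
  finally show ?thesis .
qed

lemma AE_PiM_pair:
  fixes C :: "'i \<Rightarrow> 'a::euclidean_space set"
  assumes "finite I" "\<And>i. has_uniform (C i)" "i \<in> I" "j \<in> I" "i \<noteq> j"
    and "AE p in lborel. p \<in> C i \<times> C j \<longrightarrow> P p"
  shows "AE v in PiM I (\<lambda>i. uniform_on (C i)). P (v i, v j)"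
proof -
  let ?M = "\<lambda>i. uniform_on (C i)"
  have "AE p in ?M i \<Otimes>\<^sub>M ?M j. P p"
    unfolding uniform_on_pair[OF assms(2) assms(2)] AE_uniform_on[OF has_uniform_Times[OF assms(2) assms(2)]]
    by (rule assms(6))
  then have "AE p in distr (PiM I ?M) (?M i \<Otimes>\<^sub>M ?M j) (\<lambda>v. (v i, v j)). P p"
    using assms by (subst distr_PiM_pair) (auto intro: prob_space_uniform_on)
  then show ?thesis
    using assms by (intro AE_distrD[of "\<lambda>v. (v i, v j)"]) auto
qed

text \<open>
  A union bound: each of the at most \<open>card I ^ 2\<close> bad events has probability at most \<open>\<eta>\<close>.
\<close>
lemma not_AE_bad_pair:
  fixes C :: "'i \<Rightarrow> 'a::euclidean_space set"
  assumes I: "finite I" and C: "\<And>i. has_uniform (C i)"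
    and B: "\<And>i j. i \<in> I \<Longrightarrow> j \<in> I \<Longrightarrow> i \<noteq> j \<Longrightarrow> B i j \<in> sets borel"
    and small: "\<And>i j. i \<in> I \<Longrightarrow> j \<in> I \<Longrightarrow> i \<noteq> j \<Longrightarrow>
      measure lborel ((C i \<times> C j) \<inter> B i j) \<le> \<eta> * measure lborel (C i \<times> C j)"
    and eta: "\<eta> * real (card I) ^ 2 < 1" "0 \<le> \<eta>"
  shows "\<not> (AE v in PiM I (\<lambda>i. uniform_on (C i)). \<exists>i\<in>I. \<exists>j\<in>I. i \<noteq> j \<and> (v i, v j) \<in> B i j)"
proof
  let ?M = "\<lambda>i. uniform_on (C i)"
  interpret P: product_prob_space ?M I
    by (rule product_prob_spaceI) (intro prob_space_uniform_on assms)
  let ?D = "{(i, j). i \<in> I \<and> j \<in> I \<and> i \<noteq> j}"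
  have fD: "finite ?D" by (rule finite_subset[of _ "I \<times> I"]) (use I in auto)
  define E where "E = (\<lambda>(i, j). {v \<in> space (PiM I ?M). (v i, v j) \<in> B i j})"
  have Em: "E d \<in> sets (PiM I ?M)" and Eb: "P.prob (E d) \<le> \<eta>" if d: "d \<in> ?D" for d
  proof -
    obtain i j where [simp]: "d = (i, j)" and ij: "i \<in> I" "j \<in> I" "i \<noteq> j" using d by auto
    have Bm: "B i j \<in> sets (?M i \<Otimes>\<^sub>M ?M j)"
      using B[OF ij] by (subst uniform_on_pair[OF C C]) simp
    have pm: "(\<lambda>v. (v i, v j)) \<in> PiM I ?M \<rightarrow>\<^sub>M ?M i \<Otimes>\<^sub>M ?M j"
      using ij by (intro measurable_Pair measurable_component_singleton)
    have Ed: "E d = (\<lambda>v. (v i, v j)) -` B i j \<inter> space (PiM I ?M)"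
      by (auto simp: E_def)
    show "E d \<in> sets (PiM I ?M)" unfolding Ed by (rule measurable_sets[OF pm Bm])
    have Cs: "has_uniform (C i \<times> C j)" by (intro has_uniform_Times C)
    have "emeasure (PiM I ?M) (E d) = emeasure (distr (PiM I ?M) (?M i \<Otimes>\<^sub>M ?M j) (\<lambda>v. (v i, v j))) (B i j)"
      unfolding Ed by (rule emeasure_distr[OF pm Bm, symmetric])
    also have "\<dots> = emeasure (uniform_on (C i \<times> C j)) (B i j)"
      using distr_PiM_pair[where M = ?M, OF prob_space_uniform_on[OF C] I ij] by (simp only: uniform_on_pair[OF C C])
    finally have "P.prob (E d) = measure (uniform_on (C i \<times> C j)) (B i j)"
      by (simp add: measure_def)
    also have "\<dots> = measure lborel ((C i \<times> C j) \<inter> B i j) / measure lborel (C i \<times> C j)"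
      using Cs B[OF ij] unfolding uniform_on_def
      by (intro measure_uniform_measure) (auto simp: has_uniform_def)
    also have "\<dots> \<le> \<eta>"
      using small[OF ij] eta(2) by (simp add: field_split_simps)
    finally show "P.prob (E d) \<le> \<eta>" .
  qed
  assume "AE v in PiM I ?M. \<exists>i\<in>I. \<exists>j\<in>I. i \<noteq> j \<and> (v i, v j) \<in> B i j"
  then have "AE v in PiM I ?M. v \<in> (\<Union>d\<in>?D. E d)"
    using AE_space by eventually_elim (auto simp: E_def)
  moreover have "(\<Union>d\<in>?D. E d) \<in> sets (PiM I ?M)"
    using Em fD by (intro sets.finite_UN)
  ultimately have "P.prob (\<Union>d\<in>?D. E d) = 1"
    by (simp only: P.prob_eq_1)
  moreover have "P.prob (\<Union>d\<in>?D. E d) \<le> (\<Sum>d\<in>?D. P.prob (E d))"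
    using Em fD by (intro P.finite_measure_subadditive_finite) blast+
  moreover have "(\<Sum>d\<in>?D. P.prob (E d)) \<le> (\<Sum>d\<in>?D. \<eta>)"
    by (intro sum_mono Eb)
  moreover have "(\<Sum>d\<in>?D. \<eta>) \<le> \<eta> * real (card I) ^ 2"
  proof -
    have "card ?D \<le> card (I \<times> I)" using I by (intro card_mono) auto
    then have "real (card ?D) \<le> real (card I) ^ 2"
      by (simp add: power2_eq_square card_cartesian_product flip: of_nat_mult)
    then show ?thesis using eta(2) by (simp add: mult.commute mult_left_mono)
  qed
  ultimately show False using eta(1) by linarith
qed

section \<open>Density points\<close>

text \<open>
  Approximate continuity at \<open>p\<close>, tested on cubes with lowest corner \<open>p\<close>, which are the cubes
  of the differentiation theorem \<open>integrable_ccontinuous_explicit\<close>. A cube of this kind in a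
  product space is a product of two such cubes.
\<close>
definition density_point :: "('a::euclidean_space \<Rightarrow> real) \<Rightarrow> 'a \<Rightarrow> bool" where
  "density_point g p \<longleftrightarrow> (\<forall>\<delta>>0. \<forall>\<eta>>0. \<exists>d>0. \<forall>h. 0 < h \<and> h < d \<longrightarrow>
     measure lborel {q \<in> cbox p (p + h *\<^sub>R One). \<delta> \<le> \<bar>g q - g p\<bar>} \<le> \<eta> * h ^ DIM('a))"

lemma set_integrable_bounded_cbox:
  fixes g :: "'a::euclidean_space \<Rightarrow> real"
  assumes "g \<in> borel_measurable borel" "\<And>x. \<bar>g x\<bar> \<le> B"
  shows "set_integrable lborel (cbox a b) g"
  unfolding set_integrable_def
proof (rule Bochner_Integration.integrable_bound)
  show "integrable lborel (\<lambda>x. B * indicator (cbox a b) x :: real)" 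
    by (intro integrable_mult_right integrable_real_indicator) (auto simp: emeasure_lborel_cbox_eq)
  show "AE x in lborel. norm (indicator (cbox a b) x *\<^sub>R g x) \<le> norm (B * indicator (cbox a b) x)"
    using order_trans[OF assms(2) abs_ge_self] by (intro AE_I2) (auto simp: indicator_def)
qed (use assms(1) in measurable)

lemma measure_cube: "0 \<le> h \<Longrightarrow> measure lborel (cbox p (p + h *\<^sub>R One)) = h ^ DIM('a)" for p :: "'a::euclidean_space"
  by (subst content_cbox) (auto simp: inner_add_left)

text \<open>
  Lebesgue differentiation of \<open>g\<close> and of its square shows that the mean of
  \<open>(g q - g p)\<^sup>2\<close> over a small cube at \<open>p\<close> tends to \<open>g\<^sup>2 p - 2 g p * g p + (g p)\<^sup>2 = 0\<close>;
  Markov's inequality then bounds the measure of the set where \<open>g\<close> is far from \<open>g p\<close>.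
\<close>
lemma AE_density_point:
  fixes g :: "'a::euclidean_space \<Rightarrow> real"
  assumes g: "g \<in> borel_measurable borel" and g01: "\<And>x. 0 \<le> g x \<and> g x \<le> 1"
  shows "AE p in lborel. density_point g p"
proof -
  let ?D = "DIM('a)"
  let ?Q = "\<lambda>h p::'a. cbox p (p + h *\<^sub>R One)"
  have b: "\<bar>g x\<bar> \<le> 1" "\<bar>(g x)\<^sup>2\<bar> \<le> 1" for x
    using g01[of x] by (auto intro: power_le_one)
  have int1: "set_integrable lborel (cbox a b) g" for a b
    by (intro set_integrable_bounded_cbox[of _ 1] g b)
  have int2: "set_integrable lborel (cbox a b) (\<lambda>x. (g x)\<^sup>2)" for a b
    by (intro set_integrable_bounded_cbox[of _ 1] b borel_measurable_power g)
  obtain N1 where N1: "negligible N1" "\<And>x e. x \<notin> N1 \<Longrightarrow> 0 < e \<Longrightarrow> \<exists>d>0. \<forall>h. 0 < h \<and> h < d \<longrightarrow>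
       norm (integral (?Q h x) g /\<^sub>R h ^ ?D - g x) < e"
    using integrable_ccontinuous_explicit[of g] set_borel_integral_eq_integral(1)[OF int1] by blast
  obtain N2 where N2: "negligible N2" "\<And>x e. x \<notin> N2 \<Longrightarrow> 0 < e \<Longrightarrow> \<exists>d>0. \<forall>h. 0 < h \<and> h < d \<longrightarrow>
       norm (integral (?Q h x) (\<lambda>x. (g x)\<^sup>2) /\<^sub>R h ^ ?D - (g x)\<^sup>2) < e"
    using integrable_ccontinuous_explicit[of "\<lambda>x. (g x)\<^sup>2"] set_borel_integral_eq_integral(1)[OF int2] by blast
  have dp: "density_point g p" if p: "p \<notin> N1 \<union> N2" for p
    unfolding density_point_def
  proof (intro allI impI)
    fix \<delta> \<eta> :: real assume "\<delta> > 0" "\<eta> > 0"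
    define e where "e = \<delta>\<^sup>2 * \<eta> / 3"
    have e: "e > 0" using \<open>\<delta> > 0\<close> \<open>\<eta> > 0\<close> by (simp add: e_def)
    obtain d1 where d1: "d1 > 0" "\<And>h. 0 < h \<Longrightarrow> h < d1 \<Longrightarrow> norm (integral (?Q h p) g /\<^sub>R h ^ ?D - g p) < e"
      using N1(2)[of p e] p e by auto
    obtain d2 where d2: "d2 > 0" "\<And>h. 0 < h \<Longrightarrow> h < d2 \<Longrightarrow> norm (integral (?Q h p) (\<lambda>x. (g x)\<^sup>2) /\<^sub>R h ^ ?D - (g p)\<^sup>2) < e"
      using N2(2)[of p e] p e by auto
    show "\<exists>d>0. \<forall>h. 0 < h \<and> h < d \<longrightarrow> measure lborel {q \<in> ?Q h p. \<delta> \<le> \<bar>g q - g p\<bar>} \<le> \<eta> * h ^ ?D"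
    proof (intro exI[of _ "min d1 d2"] conjI allI impI)
      show "0 < min d1 d2" using d1 d2 by simp
      fix h assume h: "0 < h \<and> h < min d1 d2"
      define c where "c = g p"
      have c: "0 \<le> c" "c \<le> 1" using g01 by (auto simp: c_def)
      define A where "A = {q \<in> ?Q h p. \<delta> \<le> \<bar>g q - g p\<bar>}"
      have A: "A \<in> sets lborel" unfolding A_def using g by measurable
      have Afin: "emeasure lborel A < \<infinity>"
        by (rule order.strict_trans1[OF emeasure_mono[of A "?Q h p"]]) (auto simp: A_def emeasure_lborel_cbox_eq top.not_eq_extremum)
      define I1 where "I1 = (LINT x:?Q h p|lborel. g x)"
      define I2 where "I2 = (LINT x:?Q h p|lborel. (g x)\<^sup>2)"
      have I1: "\<bar>I1 / h ^ ?D - c\<bar> < e"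
        using d1(2)[of h] h set_borel_integral_eq_integral(2)[OF int1, of p "p + h *\<^sub>R One"]
        by (simp add: I1_def c_def divide_inverse mult.commute)
      have I2: "\<bar>I2 / h ^ ?D - c\<^sup>2\<bar> < e"
        using d2(2)[of h] h set_borel_integral_eq_integral(2)[OF int2, of p "p + h *\<^sub>R One"]
        by (simp add: I2_def c_def divide_inverse mult.commute)
      have int0: "set_integrable lborel (?Q h p) (\<lambda>x. k)" for k :: real
        by (intro set_integrable_bounded_cbox[of _ "\<bar>k\<bar>"]) auto
      have m1: "(LINT x:?Q h p|lborel. (1::real)) = h ^ ?D"
        using h measure_cube[of h p] by (simp add: set_lebesgue_integral_def)
      then have m2: "(LINT x:?Q h p|lborel. k) = k * h ^ ?D" for k :: real
        using set_integral_mult_right[of lborel "?Q h p" k "\<lambda>_. 1"] by (simp add: mult.commute)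
      have "\<delta>\<^sup>2 * measure lborel A = (LINT x|lborel. \<delta>\<^sup>2 * indicator A x)"
        using A Afin by simp
      also have "\<dots> \<le> (LINT x:?Q h p|lborel. (g x - c)\<^sup>2)"
        unfolding set_lebesgue_integral_def
      proof (rule integral_mono)
        show "integrable lborel (\<lambda>x. \<delta>\<^sup>2 * indicator A x :: real)"
          using A Afin by (intro integrable_mult_right integrable_real_indicator) auto
        have "\<bar>(g x - c)\<^sup>2\<bar> \<le> 1" for x
          using g01[of x] c abs_square_le_1[of "g x - c"] by (auto simp: abs_le_iff)
        then have "set_integrable lborel (?Q h p) (\<lambda>x. (g x - c)\<^sup>2)"
          using g by (intro set_integrable_bounded_cbox[of _ 1]) auto
        then show "integrable lborel (\<lambda>x. indicator (?Q h p) x *\<^sub>R (g x - c)\<^sup>2)"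
          by (simp add: set_integrable_def)
        show "\<delta>\<^sup>2 * indicator A x \<le> indicator (?Q h p) x *\<^sub>R (g x - c)\<^sup>2" for x
          using \<open>\<delta> > 0\<close> by (auto simp: A_def c_def indicator_def intro: power2_le_iff_abs_le[THEN iffD2])
             (metis abs_le_square_iff abs_of_pos power2_abs)
      qed
      also have "(LINT x:?Q h p|lborel. (g x - c)\<^sup>2) = (LINT x:?Q h p|lborel. (g x)\<^sup>2 + ((-2 * c) * g x + c\<^sup>2 * 1))"
        by (simp add: power2_diff algebra_simps)
      also have "\<dots> = I2 + ((-2 * c) * I1 + c\<^sup>2 * h ^ ?D)"
        using int1 int2 int0 m2 by (subst set_integral_add set_integral_mult_right; simp add: set_integrable_mult_right I1_def I2_def)+
      also have "\<dots> = h ^ ?D * ((I2 / h ^ ?D - c\<^sup>2) + (-2 * c) * (I1 / h ^ ?D - c))"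
        using h by (simp add: field_simps power2_eq_square)
      also have "\<dots> \<le> h ^ ?D * (e + 2 * e)"
      proof (rule mult_left_mono)
        have "(-2 * c) * (I1 / h ^ ?D - c) \<le> \<bar>-2 * c\<bar> * \<bar>I1 / h ^ ?D - c\<bar>"
          by (metis abs_ge_self abs_mult)
        also have "\<dots> \<le> 2 * e" using c I1 by (intro mult_mono) auto
        finally show "(I2 / h ^ ?D - c\<^sup>2) + (-2 * c) * (I1 / h ^ ?D - c) \<le> e + 2 * e"
          using I2 by linarith
      qed (use h in auto)
      also have "\<dots> = \<delta>\<^sup>2 * (\<eta> * h ^ ?D)" by (simp add: e_def)
      finally show "measure lborel {q \<in> ?Q h p. \<delta> \<le> \<bar>g q - g p\<bar>} \<le> \<eta> * h ^ ?D"
        using \<open>\<delta> > 0\<close> by (simp add: A_def)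
    qed
  qed
  have "negligible (N1 \<union> N2)" using N1 N2 by simp
  then have "AE p in lebesgue. p \<notin> N1 \<union> N2"
    by (intro AE_not_in) (simp add: negligible_iff_null_sets)
  then have "AE p in lborel. p \<notin> N1 \<union> N2" by (simp add: AE_completion_iff)
  then show ?thesis by eventually_elim (rule dp)
qed

section \<open>Rounding a weighted graph\<close>

lemma exp_le_quadratic:
  fixes y :: real
  assumes "\<bar>y\<bar> \<le> 1"
  shows "exp y \<le> 1 + y + y\<^sup>2"
proof (cases "0 \<le> y")
  case True
  then show ?thesis using assms exp_bound[of y] by auto
next
  case False
  define z where "z = - y"
  have z: "0 \<le> z" "z \<le> 1" using False assms by (auto simp: z_def)
  have "1 \<le> (1 - z + z\<^sup>2) * (1 + z)"
    using z by (simp add: algebra_simps power2_eq_square)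
  also have "\<dots> \<le> (1 - z + z\<^sup>2) * exp z"
    using z exp_ge_add_one_self[of z] by (intro mult_left_mono) (auto simp: power2_eq_square)
  finally have "exp (- z) \<le> 1 - z + z\<^sup>2"
    by (simp add: exp_minus field_simps)
  then show ?thesis by (simp add: z_def)
qed

text \<open>
  The moment generating function of a centred Bernoulli variable with mean \<open>w\<close>. The linear
  terms cancel, which leaves a quadratic bound.
\<close>
lemma bernoulli_exp_le:
  fixes a w :: real
  assumes "\<bar>a\<bar> \<le> 1" "0 \<le> w" "w \<le> 1"
  shows "w * exp (a * (1 - w)) + (1 - w) * exp (a * (0 - w)) \<le> 1 + a\<^sup>2"
proof -
  have "\<bar>a * (1 - w)\<bar> \<le> 1" "\<bar>a * (0 - w)\<bar> \<le> 1"
    using assms by (auto simp: abs_mult intro!: mult_le_one)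
  note * = this[THEN exp_le_quadratic]
  have "w * exp (a * (1 - w)) + (1 - w) * exp (a * (0 - w))
      \<le> w * (1 + a * (1 - w) + (a * (1 - w))\<^sup>2) + (1 - w) * (1 + a * (0 - w) + (a * (0 - w))\<^sup>2)"
    using assms * by (intro add_mono mult_left_mono) auto
  also have "\<dots> = 1 + a\<^sup>2 * (w * (1 - w))"
    by (simp add: power2_eq_square algebra_simps)
  also have "\<dots> \<le> 1 + a\<^sup>2 * 1"
    using assms by (intro add_left_mono mult_left_mono mult_le_one) auto
  finally show ?thesis by simp
qed

text \<open>
  Rounding by the method of conditional expectations. If every \<open>e\<close> were put into \<open>X\<close>
  independently with probability \<open>w e\<close>, the expectation of the left-hand side would be at most
  the right-hand side by the bound for a single Bernoulli variable. So the elements can be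
  decided one after the other, each time with a value of positive probability that does not
  increase the conditional expectation; values of probability zero are never taken, which
  gives the two side conditions on \<open>X\<close>. The weights \<open>c\<close> carry the factors of the elements
  that are already decided.
\<close>
lemma rounding_weighted:
  fixes w :: "'e \<Rightarrow> real" and a :: "'s \<Rightarrow> 'e \<Rightarrow> real" and c :: "'s \<Rightarrow> real"
  assumes "finite E" "finite A"
    and "\<And>e. e \<in> E \<Longrightarrow> 0 \<le> w e \<and> w e \<le> 1"
    and "\<And>s e. s \<in> A \<Longrightarrow> e \<in> E \<Longrightarrow> \<bar>a s e\<bar> \<le> 1"
    and "\<And>s. s \<in> A \<Longrightarrow> 0 \<le> c s"
  shows "\<exists>X\<subseteq>E. (\<forall>e\<in>X. w e \<noteq> 0) \<and> (\<forall>e\<in>E - X. w e \<noteq> 1) \<and>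
      (\<Sum>s\<in>A. c s * exp (\<Sum>e\<in>E. a s e * (of_bool (e \<in> X) - w e))) \<le> (\<Sum>s\<in>A. c s * (\<Prod>e\<in>E. 1 + (a s e)\<^sup>2))"
  using assms(1,3-5)
proof (induction E arbitrary: c rule: finite_induct)
  case empty
  then show ?case by simp
next
  case (insert e E)
  define d where "d = (\<lambda>s. c s * (\<Prod>e\<in>E. 1 + (a s e)\<^sup>2))"
  define \<Phi> where "\<Phi> = (\<lambda>x::real. \<Sum>s\<in>A. d s * exp (a s e * (x - w e)))"
  define R where "R = (\<Sum>s\<in>A. d s * (1 + (a s e)\<^sup>2))"
  have d: "0 \<le> d s" if "s \<in> A" for s
    using insert.prems that by (auto simp: d_def intro!: mult_nonneg_nonneg prod_nonneg add_nonneg_nonneg)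
  have we: "0 \<le> w e" "w e \<le> 1" using insert.prems by auto
  have avg: "w e * \<Phi> 1 + (1 - w e) * \<Phi> 0 \<le> R"
  proof -
    have "w e * \<Phi> 1 + (1 - w e) * \<Phi> 0
        = (\<Sum>s\<in>A. d s * (w e * exp (a s e * (1 - w e)) + (1 - w e) * exp (a s e * (0 - w e))))"
      unfolding \<Phi>_def sum_distrib_left sum.distrib[symmetric]
      by (intro sum.cong refl) (simp add: algebra_simps)
    also have "\<dots> \<le> R"
      unfolding R_def using d we insert.prems(2)
      by (intro sum_mono mult_left_mono bernoulli_exp_le) auto
    finally show ?thesis .
  qed
  \<comment> \<open>a value of positive probability that does not exceed the average\<close>
  obtain b :: bool where b: "b \<longrightarrow> w e \<noteq> 0" "\<not> b \<longrightarrow> w e \<noteq> 1" "\<Phi> (of_bool b) \<le> R"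
  proof (cases "w e = 0 \<or> w e \<noteq> 1 \<and> \<Phi> 0 \<le> R")
    case True
    then show ?thesis using avg that[of False] by auto
  next
    case False
    have "\<Phi> 1 \<le> R"
    proof (cases "w e = 1")
      case True then show ?thesis using avg by simp
    next
      case wn: False
      then have "\<Phi> 0 > R" "w e > 0" "w e < 1" using False we by auto
      then have "(1 - w e) * \<Phi> 0 > (1 - w e) * R" by simp
      then have "w e * \<Phi> 1 < w e * R" using avg by (simp add: algebra_simps)
      then show ?thesis using \<open>w e > 0\<close> by simp
    qed
    then show ?thesis using False that[of True] by auto
  qed
  define c' where "c' = (\<lambda>s. c s * exp (a s e * (of_bool b - w e)))"
  obtain X where X: "X \<subseteq> E" "\<forall>e\<in>X. w e \<noteq> 0" "\<forall>e\<in>E - X. w e \<noteq> 1"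
      "(\<Sum>s\<in>A. c' s * exp (\<Sum>e\<in>E. a s e * (of_bool (e \<in> X) - w e))) \<le> (\<Sum>s\<in>A. c' s * (\<Prod>e\<in>E. 1 + (a s e)\<^sup>2))"
    using insert.IH[of c'] insert.prems by (force simp: c'_def)
  define Y where "Y = (if b then insert e X else X)"
  have sumY: "(\<Sum>f\<in>insert e E. a s f * (of_bool (f \<in> Y) - w f))
      = a s e * (of_bool b - w e) + (\<Sum>f\<in>E. a s f * (of_bool (f \<in> X) - w f))" for s
  proof -
    have "(\<Sum>f\<in>E. a s f * (of_bool (f \<in> Y) - w f)) = (\<Sum>f\<in>E. a s f * (of_bool (f \<in> X) - w f))"
      using insert.hyps by (intro sum.cong) (auto simp: Y_def)
    moreover have "e \<in> Y \<longleftrightarrow> b" using insert.hyps X(1) by (auto simp: Y_def)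
    ultimately show ?thesis using insert.hyps by simp
  qed
  have "(\<Sum>s\<in>A. c s * exp (\<Sum>f\<in>insert e E. a s f * (of_bool (f \<in> Y) - w f)))
      = (\<Sum>s\<in>A. c' s * exp (\<Sum>e\<in>E. a s e * (of_bool (e \<in> X) - w e)))"
    unfolding sumY by (simp add: c'_def exp_add mult.assoc)
  also have "\<dots> \<le> \<Phi> (of_bool b)"
    using X(4) by (simp add: \<Phi>_def c'_def d_def mult_ac)
  also have "\<dots> \<le> R" by fact
  also have "R = (\<Sum>s\<in>A. c s * (\<Prod>e\<in>insert e E. 1 + (a s e)\<^sup>2))"
    using insert.hyps by (simp add: R_def d_def mult_ac)
  finally show ?case
    using X b insert.hyps by (intro exI[of _ Y]) (auto simp: Y_def)
qed


lemma sum_le_subset_sum: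
  fixes y s :: "'a \<Rightarrow> real"
  assumes "finite I" "\<And>p. p \<in> I \<Longrightarrow> 0 \<le> s p \<and> s p \<le> 1"
  shows "\<exists>S\<subseteq>I. (\<Sum>p\<in>I. s p * y p) \<le> (\<Sum>p\<in>S. y p)"
proof (intro exI conjI)
  let ?S = "{p \<in> I. 0 \<le> y p}"
  show "?S \<subseteq> I" by auto
  have "(\<Sum>p\<in>I. s p * y p) \<le> (\<Sum>p\<in>I. if 0 \<le> y p then y p else 0)"
    using assms(2) by (intro sum_mono) (auto simp: mult_left_le_one_le mult_nonneg_nonpos)
  also have "\<dots> = (\<Sum>p\<in>?S. y p)"
    using assms(1) by (simp add: sum.If_cases Int_def)
  finally show "(\<Sum>p\<in>I. s p * y p) \<le> (\<Sum>p\<in>?S. y p)" .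
qed

lemma fractional_cut_le_one_sided:
  fixes Z :: "'a \<Rightarrow> 'b \<Rightarrow> real"
  assumes "finite I" "finite J"
    and "\<And>S T. S \<subseteq> I \<Longrightarrow> T \<subseteq> J \<Longrightarrow> (\<Sum>p\<in>S. \<Sum>q\<in>T. Z p q) \<le> B"
    and "\<And>p. p \<in> I \<Longrightarrow> 0 \<le> s p \<and> s p \<le> 1" "\<And>q. q \<in> J \<Longrightarrow> 0 \<le> t q \<and> t q \<le> 1"
  shows "(\<Sum>p\<in>I. \<Sum>q\<in>J. s p * t q * Z p q) \<le> B"
proof -
  obtain S where S: "S \<subseteq> I" "(\<Sum>p\<in>I. s p * (\<Sum>q\<in>J. t q * Z p q)) \<le> (\<Sum>p\<in>S. \<Sum>q\<in>J. t q * Z p q)"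
    using sum_le_subset_sum[of I s "\<lambda>p. \<Sum>q\<in>J. t q * Z p q"] assms by auto
  obtain T where T: "T \<subseteq> J" "(\<Sum>q\<in>J. t q * (\<Sum>p\<in>S. Z p q)) \<le> (\<Sum>q\<in>T. \<Sum>p\<in>S. Z p q)"
    using sum_le_subset_sum[of J t "\<lambda>q. \<Sum>p\<in>S. Z p q"] assms by auto
  have "(\<Sum>p\<in>I. \<Sum>q\<in>J. s p * t q * Z p q) = (\<Sum>p\<in>I. s p * (\<Sum>q\<in>J. t q * Z p q))"
    by (simp add: sum_distrib_left mult.assoc)
  also have "\<dots> \<le> (\<Sum>p\<in>S. \<Sum>q\<in>J. t q * Z p q)" by (rule S)
  also have "\<dots> = (\<Sum>q\<in>J. t q * (\<Sum>p\<in>S. Z p q))"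
    by (subst sum.swap) (simp add: sum_distrib_left)
  also have "\<dots> \<le> (\<Sum>q\<in>T. \<Sum>p\<in>S. Z p q)" by (rule T)
  also have "\<dots> = (\<Sum>p\<in>S. \<Sum>q\<in>T. Z p q)" by (rule sum.swap)
  also have "\<dots> \<le> B" using S T assms(3) by blast
  finally show ?thesis .
qed

text \<open>
  A bilinear form on a cube attains its extreme values at the vertices.
\<close>
lemma fractional_cut_le:
  fixes Z :: "'a \<Rightarrow> 'b \<Rightarrow> real"
  assumes "finite I" "finite J"
    and cut: "\<And>S T. S \<subseteq> I \<Longrightarrow> T \<subseteq> J \<Longrightarrow> \<bar>\<Sum>p\<in>S. \<Sum>q\<in>T. Z p q\<bar> \<le> B"
    and "\<And>p. p \<in> I \<Longrightarrow> 0 \<le> s p \<and> s p \<le> 1" "\<And>q. q \<in> J \<Longrightarrow> 0 \<le> t q \<and> t q \<le> 1"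
  shows "\<bar>\<Sum>p\<in>I. \<Sum>q\<in>J. s p * t q * Z p q\<bar> \<le> B"
proof -
  have "(\<Sum>p\<in>I. \<Sum>q\<in>J. s p * t q * Z p q) \<le> B"
    using cut assms by (intro fractional_cut_le_one_sided) (force simp: abs_le_iff)+
  moreover have "(\<Sum>p\<in>I. \<Sum>q\<in>J. s p * t q * (- Z p q)) \<le> B"
    using cut assms by (intro fractional_cut_le_one_sided) (force simp: abs_le_iff sum_negf)+
  ultimately show ?thesis by (simp add: sum_negf abs_le_iff)
qed

text \<open>
  The cuts \<open>(S, T)\<close> and their negatives are the \<open>2 * 4 ^ N\<close> test functions of
  the weighted rounding lemma. After scaling by \<open>\<mu> = 1 / (2 * sqrt N)\<close>, the squares of the
  coefficients add up to at most \<open>N\<close>, so each exponential sum is at most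
  \<open>2 * 4 ^ N * exp N \<le> exp (4 * N)\<close>, and each cut is off by at most \<open>4 * N / \<mu>\<close>.
\<close>
lemma graph_rounding:
  fixes w :: "nat \<Rightarrow> nat \<Rightarrow> real"
  assumes N: "1 \<le> N"
    and w01: "\<And>p q. p < q \<Longrightarrow> q < N \<Longrightarrow> 0 \<le> w p q \<and> w p q \<le> 1"
    and sym: "\<And>p q. w p q = w q p"
  shows "\<exists>X \<subseteq> {(p, q). p < q \<and> q < N}. (\<forall>(p, q)\<in>X. w p q \<noteq> 0) \<and>
     (\<forall>p q. p < q \<longrightarrow> q < N \<longrightarrow> (p, q) \<notin> X \<longrightarrow> w p q \<noteq> 1) \<and>
     (\<forall>S T. S \<subseteq> {..<N} \<longrightarrow> T \<subseteq> {..<N} \<longrightarrow>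
       \<bar>\<Sum>p\<in>S. \<Sum>q\<in>T. if p = q then 0 else of_bool ((p, q) \<in> X \<or> (q, p) \<in> X) - w p q\<bar> \<le> 8 * real N * sqrt N)"
proof -
  define \<mu> where "\<mu> = 1 / (2 * sqrt N)"
  have lam: "\<mu> > 0" "2 * \<mu> \<le> 1" "4 * \<mu>\<^sup>2 = 1 / N"
    using N by (auto simp: \<mu>_def power_divide field_simps)
  define E where "E = {(p, q). p < q \<and> q < (N::nat)}"
  have E_sub: "E \<subseteq> {..<N} \<times> {..<N}" by (auto simp: E_def)
  then have finE: "finite E" by (rule finite_subset) auto
  have cardE: "real (card E) \<le> real N * real N"
    using card_mono[OF _ E_sub] by (simp add: card_cartesian_product flip: of_nat_mult)
  define A where "A = {-1, 1::real} \<times> Pow {..<N} \<times> Pow {..<N}"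
  have finA: "finite A" by (simp add: A_def)
  have cardA: "real (card A) = 2 * 4 ^ N"
    by (simp add: A_def card_cartesian_product card_Pow flip: power_mult_distrib)
  \<comment> \<open>a pair inside \<open>S \<inter> T\<close> is counted in both orders\<close>
  define k where "k = (\<lambda>(S, T) (p::nat, q::nat). of_bool (p \<in> S \<and> q \<in> T) + of_bool (q \<in> S \<and> p \<in> T) :: real)"
  define a where "a = (\<lambda>(\<sigma>, ST) e. \<sigma> * \<mu> * k ST e)"
  have k: "0 \<le> k ST e" "k ST e \<le> 2" for ST :: "nat set \<times> nat set" and e by (auto simp: k_def split: prod.splits)
  have abs_a: "\<bar>a s e\<bar> \<le> 2 * \<mu>" if "s \<in> A" for s e
  proof -
    have "\<bar>a s e\<bar> = \<mu> * k (snd s) e"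
      using that lam k(1)[of "snd s" e] by (auto simp: a_def A_def abs_mult)
    also have "\<dots> \<le> \<mu> * 2" using lam k by (intro mult_left_mono) auto
    finally show ?thesis by simp
  qed
  have "\<exists>X\<subseteq>E. (\<forall>e\<in>X. w (fst e) (snd e) \<noteq> 0) \<and> (\<forall>e\<in>E - X. w (fst e) (snd e) \<noteq> 1) \<and>
      (\<Sum>s\<in>A. 1 * exp (\<Sum>e\<in>E. a s e * (of_bool (e \<in> X) - w (fst e) (snd e)))) \<le> (\<Sum>s\<in>A. 1 * (\<Prod>e\<in>E. 1 + (a s e)\<^sup>2))"
    using finE finA w01 order_trans[OF abs_a lam(2)]
    by (intro rounding_weighted) (auto simp: E_def)
  then obtain X where X0: "X \<subseteq> E" "\<forall>e\<in>X. w (fst e) (snd e) \<noteq> 0" "\<forall>e\<in>E - X. w (fst e) (snd e) \<noteq> 1"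
    and le0: "(\<Sum>s\<in>A. 1 * exp (\<Sum>e\<in>E. a s e * (of_bool (e \<in> X) - w (fst e) (snd e)))) \<le> (\<Sum>s\<in>A. 1 * (\<Prod>e\<in>E. 1 + (a s e)\<^sup>2))"
    by (elim exE conjE)
  have X: "X \<subseteq> E" "\<And>p q. (p, q) \<in> X \<Longrightarrow> w p q \<noteq> 0" "\<And>p q. (p, q) \<in> E - X \<Longrightarrow> w p q \<noteq> 1"
    using X0 by force+
  have le: "(\<Sum>s\<in>A. exp (\<Sum>(p, q)\<in>E. a s (p, q) * (of_bool ((p, q) \<in> X) - w p q))) \<le> (\<Sum>s\<in>A. \<Prod>e\<in>E. 1 + (a s e)\<^sup>2)"
    using le0 by (simp add: case_prod_unfold)
  have "(\<Sum>s\<in>A. \<Prod>e\<in>E. 1 + (a s e)\<^sup>2) \<le> (\<Sum>s\<in>A. exp (real N))"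
  proof (rule sum_mono)
    fix s assume s: "s \<in> A"
    have "(\<Prod>e\<in>E. 1 + (a s e)\<^sup>2) \<le> (\<Prod>e\<in>E. exp (1 / N))"
    proof (intro prod_mono conjI)
      fix e
      have "(a s e)\<^sup>2 \<le> (2 * \<mu>)\<^sup>2" using abs_a[OF s, of e] lam by (intro power2_le_iff_abs_le[THEN iffD2]) auto
      also have "\<dots> = 1 / N" using lam by (simp add: power_mult_distrib)
      finally show "1 + (a s e)\<^sup>2 \<le> exp (1 / N)" using exp_ge_add_one_self[of "1/N"] by linarith
    qed (auto intro: add_nonneg_nonneg)
    also have "\<dots> = exp (card E / N)" by (simp flip: exp_of_nat_mult)
    also have "\<dots> \<le> exp (real N)" using cardE N by (simp add: field_simps)
    finally show "(\<Prod>e\<in>E. 1 + (a s e)\<^sup>2) \<le> exp (real N)" .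
  qed
  also have "\<dots> = 2 * 4 ^ N * exp (real N)" by (simp add: cardA)
  also have "\<dots> \<le> exp 1 * exp 2 ^ N * exp (real N)"
  proof (intro mult_right_mono mult_mono power_mono)
    show "2 \<le> exp (1::real)" using exp_ge_add_one_self[of "1::real"] by simp
    then have "2 * 2 \<le> exp (1::real) * exp 1" by (intro mult_mono) auto
    then show "4 \<le> exp (2::real)" by (simp flip: exp_add)
  qed auto
  also have "\<dots> = exp (1 + 3 * real N)" by (simp add: exp_add exp_of_nat_mult[symmetric] mult_ac flip: exp_add)
  also have "\<dots> \<le> exp (4 * real N)" using N by simp
  finally have tot: "(\<Sum>s\<in>A. exp (\<Sum>(p, q)\<in>E. a s (p, q) * (of_bool ((p, q) \<in> X) - w p q))) \<le> exp (4 * real N)"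
    using le by linarith
  define Z where "Z = (\<lambda>p q. if p = q then 0 else of_bool ((p, q) \<in> X \<or> (q, p) \<in> X) - w p q)"
  have bnd: "\<bar>\<Sum>p\<in>S. \<Sum>q\<in>T. Z p q\<bar> \<le> 8 * real N * sqrt N" if ST: "S \<subseteq> {..<N}" "T \<subseteq> {..<N}" for S T
  proof -
    have eq: "(\<Sum>p\<in>S. \<Sum>q\<in>T. Z p q) = (\<Sum>(p, q)\<in>E. k (S, T) (p, q) * (of_bool ((p, q) \<in> X) - w p q))"
    proof -
      let ?g = "\<lambda>p q. of_bool (p \<in> S \<and> q \<in> T) * Z p q"
      have "(\<Sum>p\<in>S. \<Sum>q\<in>T. Z p q) = (\<Sum>(p, q)\<in>S \<times> T. Z p q)"
        by (rule sum.cartesian_product)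
      also have "\<dots> = (\<Sum>(p, q)\<in>{..<N} \<times> {..<N}. ?g p q)"
        using ST by (intro sum.mono_neutral_cong_left) auto
      also have "\<dots> = (\<Sum>(p, q)\<in>E \<union> prod.swap ` E. ?g p q)"
        by (intro sum.mono_neutral_right) (auto simp: E_def Z_def image_iff not_less intro: le_neq_trans)
      also have "\<dots> = (\<Sum>(p, q)\<in>E. ?g p q) + (\<Sum>(p, q)\<in>prod.swap ` E. ?g p q)"
        using finE by (intro sum.union_disjoint) (auto simp: E_def)
      also have "(\<Sum>(p, q)\<in>prod.swap ` E. ?g p q) = (\<Sum>(p, q)\<in>E. ?g q p)"
        by (subst sum.reindex) (auto simp: case_prod_unfold)
      also have "(\<Sum>(p, q)\<in>E. ?g p q) + (\<Sum>(p, q)\<in>E. ?g q p) = (\<Sum>(p, q)\<in>E. k (S, T) (p, q) * (of_bool ((p, q) \<in> X) - w p q))"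
        unfolding sum.distrib[symmetric] 
        using X(1) by (intro sum.cong refl) (auto simp: E_def Z_def k_def sym algebra_simps)
      finally show ?thesis .
    qed
    have "\<sigma> * (\<Sum>p\<in>S. \<Sum>q\<in>T. Z p q) \<le> 8 * real N * sqrt N" if sg: "\<sigma> \<in> {-1, 1}" for \<sigma> :: real
    proof -
      have inA: "(\<sigma>, S, T) \<in> A" using sg ST by (auto simp: A_def)
      have "exp (\<mu> * (\<sigma> * (\<Sum>p\<in>S. \<Sum>q\<in>T. Z p q)))
          = exp (\<Sum>(p, q)\<in>E. a (\<sigma>, S, T) (p, q) * (of_bool ((p, q) \<in> X) - w p q))"
        unfolding eq by (simp add: a_def sum_distrib_left case_prod_unfold mult_ac)
      also have "\<dots> \<le> exp (4 * real N)"
        using member_le_sum[OF inA _ finA, of "\<lambda>s. exp (\<Sum>(p, q)\<in>E. a s (p, q) * (of_bool ((p, q) \<in> X) - w p q))"] tot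
        by (auto simp del: exp_le_cancel_iff intro: order_trans)
      finally have "\<mu> * (\<sigma> * (\<Sum>p\<in>S. \<Sum>q\<in>T. Z p q)) \<le> 4 * real N" by simp
      then show ?thesis using N by (simp add: \<mu>_def field_simps)
    qed
    from this[of 1] this[of "-1"] show ?thesis by (simp add: abs_le_iff)
  qed
  show ?thesis
    using X bnd unfolding Z_def by (intro exI[of _ X]) (auto simp: E_def)
qed

section \<open>Borel versions of orderons\<close>

abbreviation "square2 \<equiv> unit_square \<times> unit_square"

lemma unit_square_cbox: "unit_square = cbox (0, 0) (1, 1)"
  by (auto simp: unit_square_def cbox_Pair_eq)

lemma has_uniform_cbox: "(\<forall>i\<in>Basis. a \<bullet> i < b \<bullet> i) \<Longrightarrow> has_uniform (cbox a b)" for a b :: "'a::euclidean_space"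
proof -
  assume *: "\<forall>i\<in>Basis. a \<bullet> i < b \<bullet> i"
  then have "(\<Prod>i\<in>Basis. (b - a) \<bullet> i) > 0"
    by (intro prod_pos) (auto simp: inner_diff_left)
  then show ?thesis
    using * by (fastforce simp: has_uniform_def emeasure_lborel_cbox_eq less_imp_le inner_diff_left)
qed

lemma has_uniform_unit_square: "has_uniform unit_square"
  unfolding unit_square_cbox by (rule has_uniform_cbox) (auto simp: Basis_prod_def)

lemma square2_borel [measurable]: "square2 \<in> sets borel"
  by (intro borel_Times) (simp_all add: unit_square_cbox)

definition borel_orderon :: "(point \<times> point \<Rightarrow> real) \<Rightarrow> bool" where
  "borel_orderon g \<longleftrightarrow> g \<in> borel_measurable borel \<and> (\<forall>p. 0 \<le> g p \<and> g p \<le> 1) \<and> (\<forall>u v. g (u, v) = g (v, u))"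

lemma lborel_distr_swap: "distr lborel lborel (\<lambda>(x, y). (y, x)) = (lborel :: ('a::euclidean_space \<times> 'a) measure)"
proof -
  show ?thesis using lborel_pair.distr_pair_swap[where ?'a = 'a and ?'b = 'a] by (simp add: lborel_prod)
qed

text \<open>
  A Borel function that agrees almost everywhere with \<open>U\<close> need not be symmetric or bounded
  everywhere. Clamping it to the unit interval and averaging it with its reflection repairs
  this without changing it at almost all points of the square.
\<close>
lemma borel_orderon_version:
  assumes "orderon U"
  shows "\<exists>g. borel_orderon g \<and> (AE p in lborel. p \<in> square2 \<longrightarrow> U p = g p)"
proof -
  define V where "V = (\<lambda>p. if p \<in> square2 then U p else 0)"
  have "V \<in> borel_measurable lebesgue"
    using assms unfolding orderon_def V_def
    by (subst borel_measurable_if) auto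
  then obtain g0 where g0: "g0 \<in> borel_measurable lborel" "AE p in lborel. V p = g0 p"
    using completion_ex_borel_measurable_real[of V lborel] by auto
  define g1 where "g1 = (\<lambda>p. max 0 (min 1 (g0 p)))"
  define g where "g = (\<lambda>p. (g1 p + g1 (case p of (u, v) \<Rightarrow> (v, u))) / 2)"
  have g1m[measurable]: "g1 \<in> borel_measurable borel" using g0(1) unfolding g1_def by simp
  have sw[measurable]: "(\<lambda>(u, v). (v, u)) \<in> (borel :: (point \<times> point) measure) \<rightarrow>\<^sub>M borel"
    by (intro borel_measurable_continuous_onI) (auto simp: case_prod_unfold intro!: continuous_intros)
  have "g \<in> borel_measurable borel"
    unfolding g_def by measurable
  then have "borel_orderon g"
    by (auto simp: borel_orderon_def g_def g1_def)
  moreover have "AE p in lborel. p \<in> square2 \<longrightarrow> U p = g p"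
  proof -
    have "AE p in distr lborel lborel (\<lambda>(x, y). (y, x)). V p = g0 p"
      using g0(2) by (simp only: lborel_distr_swap)
    then have "AE p in lborel. V (case p of (x, y) \<Rightarrow> (y, x)) = g0 (case p of (x, y) \<Rightarrow> (y, x))"
      using sw by (intro AE_distrD[of "\<lambda>(x, y). (y, x)" _ lborel]) auto
    with g0(2) show ?thesis
    proof eventually_elim
      case (elim p)
      obtain u v where p: "p = (u, v)" by (cases p)
      show ?case
      proof
        assume "p \<in> square2"
        then have sq: "u \<in> unit_square" "v \<in> unit_square" by (auto simp: p)
        then have "U (u, v) = U (v, u)" "0 \<le> U (u, v)" "U (u, v) \<le> 1"
          using assms by (auto simp: orderon_def)
        moreover have "g0 (u, v) = U (u, v)" "g0 (v, u) = U (v, u)"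
          using elim sq by (auto simp: p V_def)
        ultimately show "U p = g p" by (simp add: p g_def g1_def)
      qed
    qed
  qed
  ultimately show ?thesis by blast
qed

lemma AE_pairs_in_square:
  assumes "AE p in lborel. p \<in> square2 \<longrightarrow> P p" "i \<in> I" "j \<in> I" "i \<noteq> j" "finite I"
  shows "AE v in PiM I (\<lambda>_. lborel). v \<in> PiE I (\<lambda>_. unit_square) \<longrightarrow> P (v i, v j)"
  using AE_PiM_pair[of I "\<lambda>_. unit_square" i j P] assms has_uniform_unit_square
  by (subst AE_PiM_uniform_on[symmetric]) auto

text \<open>
  The domain of integration and the integrand of \<open>ordered_density\<close>.
\<close>
definition sorted_tuples :: "nat \<Rightarrow> (nat \<Rightarrow> point) set" where
  "sorted_tuples k = {v \<in> {1..k} \<rightarrow>\<^sub>E unit_square. \<forall>i\<in>{1..k}. \<forall>j\<in>{1..k}. i \<le> j \<longrightarrow> fst (v i) \<le> fst (v j)}"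

definition graph_weight :: "ordered_graph \<Rightarrow> (point \<times> point \<Rightarrow> real) \<Rightarrow> (nat \<Rightarrow> point) \<Rightarrow> real" where
  "graph_weight F W v = 
        (\<Prod>(i, j)\<in>{(i, j) \<in> pairs_below (fst F). {i, j} \<in> snd F}. W (v i, v j)) *
        (\<Prod>(i, j)\<in>{(i, j) \<in> pairs_below (fst F). {i, j} \<notin> snd F}. 1 - W (v i, v j))"

abbreviation tuples :: "nat \<Rightarrow> (nat \<Rightarrow> point) measure" where
  "tuples k \<equiv> Pi\<^sub>M {1..k} (\<lambda>_. lborel)"

lemma ordered_density_eq:
  "ordered_density F W = fact (fst F) * (LINT v:sorted_tuples (fst F)|completion (tuples (fst F)). graph_weight F W v)"
  by (simp add: ordered_density_def sorted_tuples_def graph_weight_def Let_def)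

lemma finite_pairs_below: "finite (pairs_below k)"
  by (rule finite_subset[of _ "{1..k} \<times> {1..k}"]) (auto simp: pairs_below_def)

lemma sorted_tuples_sets: "sorted_tuples k \<in> sets (tuples k)"
proof -
  let ?D = "{(i, j). i \<in> {1..k} \<and> j \<in> {1..k} \<and> i \<le> j}"
  have fD: "finite ?D" by (rule finite_subset[of _ "{1..k} \<times> {1..k}"]) auto
  have 1: "PiE {1..k} (\<lambda>_. unit_square) \<in> sets (tuples k)"
    by (intro sets_PiM_I_finite) (auto simp: unit_square_cbox)
  have 2: "{v \<in> space (tuples k). \<forall>d\<in>?D. fst (v (fst d)) \<le> fst (v (snd d))} \<in> sets (tuples k)"
  proof (intro sets.sets_Collect_finite_All fD)
    fix d assume d: "d \<in> ?D"
    have "(fst :: point \<Rightarrow> real) \<in> borel_measurable borel"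
      by (intro borel_measurable_continuous_onI continuous_intros)
    then have "(\<lambda>v. fst (v i)) \<in> borel_measurable (tuples k)" if "i \<in> {1..k}" for i
      using that by (intro measurable_compose[OF measurable_component_singleton, of i]) auto
    then show "{v \<in> space (tuples k). fst (v (fst d)) \<le> fst (v (snd d))} \<in> sets (tuples k)"
      using d by (intro borel_measurable_le) auto
  qed
  have "sorted_tuples k = PiE {1..k} (\<lambda>_. unit_square) \<inter> {v \<in> space (tuples k). \<forall>d\<in>?D. fst (v (fst d)) \<le> fst (v (snd d))}"
    by (force simp: sorted_tuples_def space_PiM PiE_def)
  then show ?thesis using sets.Int[OF 1 2] by simp
qed

lemma graph_weight_measurable:
  assumes "borel_orderon g"
  shows "graph_weight F g \<in> borel_measurable (tuples (fst F))"
proof -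
  have pm: "(\<lambda>v. (v i, v j)) \<in> tuples (fst F) \<rightarrow>\<^sub>M borel" if "i \<in> {1..fst F}" "j \<in> {1..fst F}" for i j
  proof -
    have "(\<lambda>v. (v i, v j)) \<in> tuples (fst F) \<rightarrow>\<^sub>M (borel \<Otimes>\<^sub>M borel)"
      using that by (intro measurable_Pair measurable_component_singleton[THEN measurable_compose, of _ _ _ "\<lambda>x. x"]) auto
    then show ?thesis by (simp only: borel_prod)
  qed
  have g: "g \<in> borel_measurable borel" using assms by (simp add: borel_orderon_def)
  show ?thesis
    unfolding graph_weight_def
    using measurable_compose[OF pm g]
    by (intro borel_measurable_times borel_measurable_prod) (auto simp: pairs_below_def)
qed

lemma completion_measurable_AE:
  assumes h: "h \<in> completion M \<rightarrow>\<^sub>M N" and ae: "AE x in completion M. f x = h x"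
    and sp: "\<And>x. x \<in> space M \<Longrightarrow> f x \<in> space N"
  shows "f \<in> completion M \<rightarrow>\<^sub>M N"
proof (rule measurableI)
  fix A assume A: "A \<in> sets N"
  show "f -` A \<inter> space (completion M) \<in> sets (completion M)"
  proof (rule completion.in_sets_AE)
    show "AE x in completion M. (x \<in> h -` A \<inter> space (completion M)) = (x \<in> f -` A \<inter> space (completion M))"
      using ae by eventually_elim auto
  qed (use measurable_sets[OF h A] in auto)
qed (use sp in auto)

text \<open>
  Two entries of a random tuple have a joint density, so a null set of pairs is met only by a
  null set of tuples.
\<close>
lemma ordered_density_cong:
  assumes g: "borel_orderon g" and ae: "AE p in lborel. p \<in> square2 \<longrightarrow> U p = g p"
  shows "ordered_density F U = ordered_density F g"
proof -
  let ?k = "fst F"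
  have "AE v in tuples ?k. \<forall>d\<in>pairs_below ?k. v \<in> PiE {1..?k} (\<lambda>_. unit_square) \<longrightarrow> U (v (fst d), v (snd d)) = g (v (fst d), v (snd d))"
    using finite_pairs_below
  proof (rule AE_finite_allI)
    fix d assume "d \<in> pairs_below ?k"
    then show "AE v in tuples ?k. v \<in> PiE {1..?k} (\<lambda>_. unit_square) \<longrightarrow> U (v (fst d), v (snd d)) = g (v (fst d), v (snd d))"
      by (intro AE_pairs_in_square ae) (auto simp: pairs_below_def)
  qed
  then have "AE v in tuples ?k. indicator (sorted_tuples ?k) v *\<^sub>R graph_weight F U v = indicator (sorted_tuples ?k) v *\<^sub>R graph_weight F g v"
  proof eventually_elim
    case (elim v)
    show ?case
    proof (cases "v \<in> sorted_tuples ?k")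
      case True
      then have "v \<in> PiE {1..?k} (\<lambda>_. unit_square)" by (auto simp: sorted_tuples_def)
      with elim have "U (v i, v j) = g (v i, v j)" if "(i, j) \<in> pairs_below ?k" for i j using that by force
      then have "graph_weight F U v = graph_weight F g v"
        unfolding graph_weight_def by (intro arg_cong2[where f="(*)"] prod.cong refl) auto
      then show ?thesis by simp
    qed simp
  qed
  then have ae': "AE v in completion (tuples ?k). indicator (sorted_tuples ?k) v *\<^sub>R graph_weight F U v = indicator (sorted_tuples ?k) v *\<^sub>R graph_weight F g v"
    by (rule AE_completion)
  have m: "(\<lambda>v. indicator (sorted_tuples ?k) v *\<^sub>R graph_weight F g v) \<in> borel_measurable (completion (tuples ?k))"
    using sorted_tuples_sets graph_weight_measurable[OF g] by (intro measurable_completion borel_measurable_scaleR) auto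
  have "(LINT v:sorted_tuples ?k|completion (tuples ?k). graph_weight F U v) = (LINT v:sorted_tuples ?k|completion (tuples ?k). graph_weight F g v)"
    unfolding set_lebesgue_integral_def
  proof (rule integral_cong_AE)
    show "(\<lambda>v. indicator (sorted_tuples ?k) v *\<^sub>R graph_weight F U v) \<in> borel_measurable (completion (tuples ?k))"
      using ae' by (intro completion_measurable_AE[OF m]) auto
  qed (rule m ae')+
  then show ?thesis by (simp add: ordered_density_eq)
qed

section \<open>Graphs of positive density\<close>

lemma density_point_eventually:
  fixes g :: "'a::euclidean_space \<Rightarrow> real"
  assumes "density_point g p" "0 < \<delta>" "0 < \<eta>"
  shows "\<forall>\<^sub>F h in at_right 0. measure lborel {q \<in> cbox p (p + h *\<^sub>R One). \<delta> \<le> \<bar>g q - g p\<bar>} \<le> \<eta> * h ^ DIM('a)"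
proof -
  obtain d where "d > 0" "\<forall>h. 0 < h \<and> h < d \<longrightarrow> measure lborel {q \<in> cbox p (p + h *\<^sub>R One). \<delta> \<le> \<bar>g q - g p\<bar>} \<le> \<eta> * h ^ DIM('a)"
    using assms(1)[unfolded density_point_def, rule_format, OF assms(2,3)] by (elim exE conjE)
  then show ?thesis
    unfolding eventually_at_right_field by (intro exI[of _ d]) simp
qed

lemma eventually_less_at_right_0: "0 < a \<Longrightarrow> \<forall>\<^sub>F h in at_right 0. h < (a::real)"
  by (rule eventually_mono[OF eventually_at_right_real]) auto

lemma mem_cbox_point: "u \<in> cbox a b \<longleftrightarrow> fst a \<le> fst u \<and> fst u \<le> fst b \<and> snd a \<le> snd u \<and> snd u \<le> snd b"
  for u a b :: point
  by (cases a; cases b; cases u) (auto simp: cbox_Pair_eq)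

lemma mem_box_point: "u \<in> box a b \<longleftrightarrow> fst a < fst u \<and> fst u < fst b \<and> snd a < snd u \<and> snd u < snd b"
  for u a b :: point
  by (cases a; cases b; cases u) (auto simp: mem_box Basis_prod_def)

lemma cube_pair: "cbox u (u + (h, h)) \<times> cbox v (v + (h, h)) = cbox (u, v) ((u, v) + h *\<^sub>R One)"
  for u v :: point
proof -
  have "(One :: point \<times> point) = ((1, 1), (1, 1))"
    by (simp add: Basis_prod_def sum.union_disjoint sum.reindex inj_on_def zero_prod_def[symmetric] prod_eq_iff fst_sum snd_sum)
  then show ?thesis by (cases u; cases v) (simp add: cbox_Pair_eq)
qed

lemma DIM_point_pair: "DIM(point \<times> point) = 4" by simp

lemma has_uniform_cube: "0 < h \<Longrightarrow> has_uniform (cbox u (u + (h, h)))" for u :: point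
  by (rule has_uniform_cbox) (auto simp: Basis_prod_def inner_add_left)

lemma graph_weight_range:
  assumes "borel_orderon g"
  shows "0 \<le> graph_weight F g v" "graph_weight F g v \<le> 1"
proof -
  have g: "0 \<le> g p" "g p \<le> 1" for p using assms unfolding borel_orderon_def by blast+
  show "0 \<le> graph_weight F g v" "graph_weight F g v \<le> 1"
    unfolding graph_weight_def
    by (auto intro!: mult_nonneg_nonneg prod_nonneg mult_le_one prod_le_1 g simp: case_prod_unfold)
qed

lemma ordered_density_zeroD:
  assumes g: "borel_orderon g" and zero: "\<not> ordered_density F g > 0"
  shows "AE v in tuples (fst F). v \<in> sorted_tuples (fst F) \<longrightarrow> graph_weight F g v = 0"
proof -
  let ?k = "fst F"
  let ?f = "\<lambda>v. indicator (sorted_tuples ?k) v *\<^sub>R graph_weight F g v"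
  have m: "?f \<in> borel_measurable (completion (tuples ?k))"
    using sorted_tuples_sets graph_weight_measurable[OF g] by (intro measurable_completion borel_measurable_scaleR) auto
  interpret L: product_sigma_finite "\<lambda>_::nat. lborel :: point measure" by standard
  have "emeasure (tuples ?k) (sorted_tuples ?k) \<le> emeasure (tuples ?k) (PiE {1..?k} (\<lambda>_. unit_square))"
    by (intro emeasure_mono sets_PiM_I_finite) (auto simp: sorted_tuples_def unit_square_cbox)
  also have "\<dots> = (\<Prod>i\<in>{1..?k}. emeasure lborel unit_square)"
    by (intro L.emeasure_PiM) (auto simp: unit_square_cbox)
  also have "\<dots> < \<infinity>"
    using has_uniform_unit_square by (simp add: has_uniform_def power_less_top_ennreal top.not_eq_extremum)
  finally have fin: "emeasure (completion (tuples ?k)) (sorted_tuples ?k) < \<infinity>"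
    using sorted_tuples_sets by simp
  have int: "integrable (completion (tuples ?k)) ?f"
  proof (rule Bochner_Integration.integrable_bound)
    show "integrable (completion (tuples ?k)) (indicator (sorted_tuples ?k) :: _ \<Rightarrow> real)"
      using fin sorted_tuples_sets by (intro integrable_real_indicator) auto
    show "AE v in completion (tuples ?k). norm (?f v) \<le> norm (indicator (sorted_tuples ?k) v :: real)"
      using graph_weight_range[OF g] by (intro AE_I2) (auto simp: indicator_def)
  qed (rule m)
  have "0 \<le> (LINT v|completion (tuples ?k). ?f v)"
    using graph_weight_range[OF g] by (intro integral_nonneg_AE AE_I2) auto
  moreover have "ordered_density F g = fact ?k * (LINT v|completion (tuples ?k). ?f v)"
    by (simp add: ordered_density_eq set_lebesgue_integral_def)
  ultimately have "(LINT v|completion (tuples ?k). ?f v) = 0"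
    using zero by (auto simp: zero_less_mult_iff)
  then have "AE v in completion (tuples ?k). ?f v = 0"
    using int graph_weight_range[OF g] by (subst (asm) integral_nonneg_eq_0_iff_AE) auto
  then have "AE v in tuples ?k. ?f v = 0" by (simp add: AE_completion_iff)
  then show ?thesis by eventually_elim (auto simp: indicator_def)
qed

text \<open>
  If \<open>g\<close> is nonzero on the edges and different from one on the non-edges at a tuple \<open>P\<close> all of
  whose pairs are density points, then this stays true for most tuples near \<open>P\<close>, by a union
  bound over the pairs. As the abscissae of \<open>P\<close> increase strictly, the nearby tuples are sorted
  too, so the integrand of the ordered density is positive on a set of positive measure.
\<close>
lemma ordered_density_pos:
  fixes P :: "nat \<Rightarrow> point"
  assumes g: "borel_orderon g"
    and sorted: "\<And>i j. (i, j) \<in> pairs_below k \<Longrightarrow> fst (P i) < fst (P j)"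
    and inside: "\<And>i. i \<in> {1..k} \<Longrightarrow> P i \<in> box (0, 0) (1, 1)"
    and dens: "\<And>i j. (i, j) \<in> pairs_below k \<Longrightarrow> density_point g (P i, P j)"
    and edge: "\<And>i j. (i, j) \<in> pairs_below k \<Longrightarrow> {i, j} \<in> E \<Longrightarrow> g (P i, P j) \<noteq> 0"
    and nonedge: "\<And>i j. (i, j) \<in> pairs_below k \<Longrightarrow> {i, j} \<notin> E \<Longrightarrow> g (P i, P j) \<noteq> 1"
  shows "ordered_density (k, E) g > 0"
proof (rule ccontr)
  assume neg: "\<not> ordered_density (k, E) g > 0"
  have g01: "0 \<le> g p" "g p \<le> 1" for p using g unfolding borel_orderon_def by blast+
  define \<delta> where "\<delta> = Min (insert 1 ((\<lambda>(i, j). if {i, j} \<in> E then g (P i, P j) else 1 - g (P i, P j)) ` pairs_below k))"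
  have pos: "0 < (if {i, j} \<in> E then g (P i, P j) else 1 - g (P i, P j))" if "(i, j) \<in> pairs_below k" for i j
    using edge[OF that] nonedge[OF that] g01[of "(P i, P j)"] by (simp add: less_le)
  have "\<delta> > 0"
    unfolding \<delta>_def using pos by (subst Min_gr_iff) (auto simp only: finite_pairs_below finite_insert finite_imageI ball_simps split: prod.split)
  have delta: "{i, j} \<in> E \<Longrightarrow> \<delta> \<le> g (P i, P j)" "{i, j} \<notin> E \<Longrightarrow> \<delta> \<le> 1 - g (P i, P j)"
    if "(i, j) \<in> pairs_below k" for i j
  proof -
    have "\<delta> \<le> (case (i, j) of (i, j) \<Rightarrow> if {i, j} \<in> E then g (P i, P j) else 1 - g (P i, P j))"
      unfolding \<delta>_def by (intro Min_le finite.insertI finite_imageI finite_pairs_below insertI2 imageI that)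
    then show "{i, j} \<in> E \<Longrightarrow> \<delta> \<le> g (P i, P j)" "{i, j} \<notin> E \<Longrightarrow> \<delta> \<le> 1 - g (P i, P j)"
      by simp_all
  qed
  define \<eta> where "\<eta> = 1 / (real k ^ 2 + 1)"
  have eta: "\<eta> > 0" "\<eta> * real k ^ 2 < 1" by (auto simp: \<eta>_def field_simps add_pos_nonneg)
  have "\<forall>\<^sub>F h in at_right 0. \<forall>d\<in>pairs_below k.
      measure lborel {q \<in> cbox (P (fst d), P (snd d)) ((P (fst d), P (snd d)) + h *\<^sub>R One). \<delta> \<le> \<bar>g q - g (P (fst d), P (snd d))\<bar>} \<le> \<eta> * h ^ DIM(point \<times> point)
        \<and> h < fst (P (snd d)) - fst (P (fst d))"
  proof (intro eventually_ball_finite finite_pairs_below ballI eventually_conj)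
    fix d assume "d \<in> pairs_below k"
    then have d: "(fst d, snd d) \<in> pairs_below k" by simp
    show "\<forall>\<^sub>F h in at_right 0. measure lborel {q \<in> cbox (P (fst d), P (snd d)) ((P (fst d), P (snd d)) + h *\<^sub>R One). \<delta> \<le> \<bar>g q - g (P (fst d), P (snd d))\<bar>} \<le> \<eta> * h ^ DIM(point \<times> point)"
      by (rule density_point_eventually[OF dens[OF d] \<open>\<delta> > 0\<close> eta(1)])
    show "\<forall>\<^sub>F h in at_right 0. h < fst (P (snd d)) - fst (P (fst d))"
      using sorted[OF d] by (intro eventually_less_at_right_0) simp
  qed
  moreover have "\<forall>\<^sub>F h in at_right 0. \<forall>i\<in>{1..k}. h < 1 - fst (P i) \<and> h < 1 - snd (P i)"
    using inside
    by (intro eventually_ball_finite ballI eventually_conj eventually_less_at_right_0) (auto simp: mem_box_point)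
  moreover have "\<forall>\<^sub>F h in at_right 0. h > (0::real)" by (simp add: eventually_at_right_less)
  ultimately have "\<forall>\<^sub>F h in at_right 0. (0::real) < h \<and> (\<forall>i\<in>{1..k}. h < 1 - fst (P i) \<and> h < 1 - snd (P i)) \<and> (\<forall>d\<in>pairs_below k.
      measure lborel {q \<in> cbox (P (fst d), P (snd d)) ((P (fst d), P (snd d)) + h *\<^sub>R One). \<delta> \<le> \<bar>g q - g (P (fst d), P (snd d))\<bar>} \<le> \<eta> * h ^ DIM(point \<times> point)
        \<and> h < fst (P (snd d)) - fst (P (fst d)))"
    by eventually_elim blast
  then obtain h where hh: "(0::real) < h \<and> (\<forall>i\<in>{1..k}. h < 1 - fst (P i) \<and> h < 1 - snd (P i)) \<and> (\<forall>d\<in>pairs_below k.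
      measure lborel {q \<in> cbox (P (fst d), P (snd d)) ((P (fst d), P (snd d)) + h *\<^sub>R One). \<delta> \<le> \<bar>g q - g (P (fst d), P (snd d))\<bar>} \<le> \<eta> * h ^ DIM(point \<times> point)
        \<and> h < fst (P (snd d)) - fst (P (fst d)))"
    using eventually_happens'[OF trivial_limit_at_right_real] by blast
  have h: "0 < h" and h1: "\<And>i. i \<in> {1..k} \<Longrightarrow> h < 1 - fst (P i) \<and> h < 1 - snd (P i)"
    and h2: "\<And>i j. (i, j) \<in> pairs_below k \<Longrightarrow>
      measure lborel {q \<in> cbox (P i, P j) ((P i, P j) + h *\<^sub>R One). \<delta> \<le> \<bar>g q - g (P i, P j)\<bar>} \<le> \<eta> * h ^ DIM(point \<times> point)"
    and h3: "\<And>i j. (i, j) \<in> pairs_below k \<Longrightarrow> fst (P i) + h < fst (P j)"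
    using hh by force+
  define C where "C = (\<lambda>i. cbox (P i) (P i + (h, h)))"
  have C: "has_uniform (C i)" for i unfolding C_def by (rule has_uniform_cube[OF h])
  define B where "B = (\<lambda>i j. if i < j then {q. \<delta> \<le> \<bar>g q - g (P i, P j)\<bar>} else {})"
  have CC: "C i \<times> C j = cbox (P i, P j) ((P i, P j) + h *\<^sub>R One)" for i j
    unfolding C_def by (rule cube_pair)
  have key: "\<exists>i\<in>{1..k}. \<exists>j\<in>{1..k}. i \<noteq> j \<and> (v i, v j) \<in> B i j"
    if v: "v \<in> PiE {1..k} C" and z: "v \<in> sorted_tuples k \<longrightarrow> graph_weight (k, E) g v = 0" for v
  proof -
    have vC: "fst (P i) \<le> fst (v i)" "fst (v i) \<le> fst (P i) + h" "snd (P i) \<le> snd (v i)" "snd (v i) \<le> snd (P i) + h" if "i \<in> {1..k}" for i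
      using PiE_mem[OF v that] by (auto simp: C_def mem_cbox_point)
    have "v i \<in> unit_square" if i: "i \<in> {1..k}" for i
      using vC[OF i] h1[OF i] inside[OF i] h by (auto simp: unit_square_cbox mem_cbox_point mem_box_point)
    moreover have "fst (v i) \<le> fst (v j)" if "i \<in> {1..k}" "j \<in> {1..k}" "i \<le> j" for i j
    proof (cases "i = j")
      case False
      then have "(i, j) \<in> pairs_below k" using that by (auto simp: pairs_below_def)
      from h3[OF this] vC[OF that(1)] vC[OF that(2)] show ?thesis by linarith
    qed simp
    ultimately have "v \<in> sorted_tuples k" using v by (auto simp: sorted_tuples_def PiE_iff)
    then have zero: "graph_weight (k, E) g v = 0" using z by simp
    show "\<exists>i\<in>{1..k}. \<exists>j\<in>{1..k}. i \<noteq> j \<and> (v i, v j) \<in> B i j"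
    proof (rule ccontr)
      assume neg: "\<not> ?thesis"
      have good: "\<bar>g (v i, v j) - g (P i, P j)\<bar> < \<delta>" if "(i, j) \<in> pairs_below k" for i j
      proof (rule ccontr)
        assume "\<not> ?thesis"
        moreover have ij: "i \<in> {1..k}" "j \<in> {1..k}" "i < j" using that by (auto simp: pairs_below_def)
        ultimately have "(v i, v j) \<in> B i j" by (simp add: B_def)
        then have "i \<noteq> j \<and> (v i, v j) \<in> B i j" using ij(3) by simp
        then have "\<exists>i\<in>{1..k}. \<exists>j\<in>{1..k}. i \<noteq> j \<and> (v i, v j) \<in> B i j"
          by (rule bexI[where x = i, OF bexI[where x = j]]) (fact ij)+
        then show False by (rule notE[OF neg])
      qed
      have good': "0 < g (v i, v j) \<or> {i, j} \<notin> E" "0 < 1 - g (v i, v j) \<or> {i, j} \<in> E"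
        if "(i, j) \<in> pairs_below k" for i j
        using good[OF that] delta[OF that] by (cases "{i, j} \<in> E"; simp add: abs_less_iff)+
      have "graph_weight (k, E) g v > 0"
        unfolding graph_weight_def
      proof (intro mult_pos_pos prod_pos)
        fix d assume "d \<in> {(i, j). (i, j) \<in> pairs_below (fst (k, E)) \<and> {i, j} \<in> snd (k, E)}"
        then show "0 < (case d of (i, j) \<Rightarrow> g (v i, v j))"
          using good'(1) by (cases d) auto
      next
        fix d assume "d \<in> {(i, j). (i, j) \<in> pairs_below (fst (k, E)) \<and> {i, j} \<notin> snd (k, E)}"
        then show "0 < (case d of (i, j) \<Rightarrow> 1 - g (v i, v j))"
          using good'(2) by (cases d) auto
      qed
      with zero show False by simp
    qed
  qed
  have "\<not> (AE v in PiM {1..k} (\<lambda>i. uniform_on (C i)). \<exists>i\<in>{1..k}. \<exists>j\<in>{1..k}. i \<noteq> j \<and> (v i, v j) \<in> B i j)"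
  proof (rule not_AE_bad_pair[where \<eta> = \<eta>])
    have [measurable]: "g \<in> borel_measurable borel" using g by (simp add: borel_orderon_def)
    show "B i j \<in> sets borel" for i j 
    proof -
      have "{q \<in> space borel. \<delta> \<le> \<bar>g q - g (P i, P j)\<bar>} \<in> sets borel" by measurable
      then show ?thesis by (simp add: B_def)
    qed
    fix i j assume ij: "i \<in> {1..k}" "j \<in> {1..k}" "i \<noteq> j"
    have m: "measure lborel (C i \<times> C j) = h ^ DIM(point \<times> point)"
      unfolding CC by (rule measure_cube) (use h in simp)
    show "measure lborel ((C i \<times> C j) \<inter> B i j) \<le> \<eta> * measure lborel (C i \<times> C j)"
    proof (cases "i < j")
      case True
      then have "(i, j) \<in> pairs_below k" using ij by (auto simp: pairs_below_def)
      have "(C i \<times> C j) \<inter> B i j = {q \<in> cbox (P i, P j) ((P i, P j) + h *\<^sub>R One). \<delta> \<le> \<bar>g q - g (P i, P j)\<bar>}"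
        unfolding CC B_def using True by (simp only: if_True) blast
      with h2[OF \<open>(i, j) \<in> pairs_below k\<close>] m show ?thesis by (simp only:)
    next
      case False
      then show ?thesis using eta by (simp add: B_def)
    qed
  qed (use eta C in auto)
  moreover have "AE v in PiM {1..k} (\<lambda>i. uniform_on (C i)). \<exists>i\<in>{1..k}. \<exists>j\<in>{1..k}. i \<noteq> j \<and> (v i, v j) \<in> B i j"
  proof -
    have "AE v in tuples k. v \<in> sorted_tuples k \<longrightarrow> graph_weight (k, E) g v = 0"
      using ordered_density_zeroD[OF g neg] unfolding fst_conv .
    then have "AE v in tuples k. v \<in> PiE {1..k} C \<longrightarrow> (\<exists>i\<in>{1..k}. \<exists>j\<in>{1..k}. i \<noteq> j \<and> (v i, v j) \<in> B i j)"
      by (rule eventually_mono) (rule impI, rule key)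
    then show ?thesis by (subst AE_PiM_uniform_on) (simp_all only: C finite_atLeastAtMost)
  qed
  ultimately show False by (rule notE)
qed

section \<open>Homogeneous point configurations\<close>

text \<open>
  The cells are open, hence pairwise disjoint; the grid points that they miss form a null set.
  Strips and layers are numbered from zero.
\<close>
definition cell :: "nat \<Rightarrow> nat \<Rightarrow> real set" where
  "cell l k = {real k / real l <..< (real k + 1) / real l}"

lemma emeasure_cell: "0 < l \<Longrightarrow> emeasure lborel (cell l k) = ennreal (1 / real l)"
  by (simp add: cell_def divide_right_mono add_divide_distrib)

lemma has_uniform_cell: "0 < l \<Longrightarrow> has_uniform (cell l k)"
  by (simp add: has_uniform_def emeasure_cell) (simp add: cell_def)

lemma floor_cell:
  assumes "0 < l" "r \<in> cell l k"
  shows "nat \<lfloor>real l * r\<rfloor> = k"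
proof -
  have "real k < real l * r" "real l * r < real k + 1"
    using assms by (auto simp: cell_def field_simps)
  then have "\<lfloor>real l * r\<rfloor> = int k" by (simp add: floor_eq_iff)
  then show ?thesis by simp
qed

lemma cell_in_unit: "0 < l \<Longrightarrow> k < l \<Longrightarrow> r \<in> cell l k \<Longrightarrow> 0 < r \<and> r < 1"
proof -
  assume *: "0 < l" "k < l" "r \<in> cell l k"
  have "0 \<le> real k / real l" by simp
  moreover have "(real k + 1) / real l \<le> 1" using * by (simp add: field_simps)
  ultimately show ?thesis using * unfolding cell_def greaterThanLessThan_iff by linarith
qed

text \<open>
  One abscissa per strip, and one ordinate per layer of each strip. All layers of a strip share
  the abscissa, so points close to the points \<open>(x j, a j i)\<close> can have their layers interleaved
  in the order of abscissae. No condition is put on pairs of points in the same strip: they lie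
  on the null set of pairs with equal abscissae.
\<close>
definition strip_points :: "(point \<times> point \<Rightarrow> real) \<Rightarrow> nat \<Rightarrow> (nat \<Rightarrow> real) \<Rightarrow> (nat \<Rightarrow> nat \<Rightarrow> real) \<Rightarrow> bool" where
  "strip_points g l x a \<longleftrightarrow> (\<forall>j<l. x j \<in> cell l j) \<and> (\<forall>j<l. \<forall>i<l. a j i \<in> cell l i) \<and>
     (\<forall>j<l. \<forall>j'<l. \<forall>i<l. \<forall>i'<l. j \<noteq> j' \<longrightarrow> density_point g ((x j, a j i), (x j', a j' i')))"

abbreviation sampled :: "(point \<times> point \<Rightarrow> real) \<Rightarrow> (nat \<Rightarrow> real) \<Rightarrow> (nat \<Rightarrow> nat \<Rightarrow> real) \<Rightarrow> nat \<Rightarrow> nat \<Rightarrow> nat \<Rightarrow> nat \<Rightarrow> real" where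
  "sampled g x a j i j' i' \<equiv> g ((x j, a j i), (x j', a j' i'))"

lemma strip_pointsD:
  assumes "strip_points g l x a"
  shows "\<And>j. j < l \<Longrightarrow> 0 < x j \<and> x j < 1"
    and "\<And>j j'. j < j' \<Longrightarrow> j' < l \<Longrightarrow> x j < x j'"
    and "\<And>j i. j < l \<Longrightarrow> i < l \<Longrightarrow> 0 < a j i \<and> a j i < 1"
    and "\<And>j j' i i'. j < l \<Longrightarrow> j' < l \<Longrightarrow> i < l \<Longrightarrow> i' < l \<Longrightarrow> j \<noteq> j' \<Longrightarrow>
      density_point g ((x j, a j i), (x j', a j' i'))"
proof -
  have x: "\<forall>j<l. x j \<in> cell l j" and a: "\<forall>j<l. \<forall>i<l. a j i \<in> cell l i"
    using assms by (auto simp: strip_points_def)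
  show "0 < x j \<and> x j < 1" if "j < l" for j using cell_in_unit[OF _ that] x that by simp
  show "0 < a j i \<and> a j i < 1" if "j < l" "i < l" for j i using cell_in_unit[OF _ that(2)] a that by simp
  show "x j < x j'" if "j < j'" "j' < l" for j j'
  proof -
    have "x j < (real j + 1) / real l" "real j' / real l < x j'"
      using x that by (auto simp: cell_def)
    moreover have "(real j + 1) / real l \<le> real j' / real l" using that by (intro divide_right_mono) auto
    ultimately show ?thesis by linarith
  qed
  show "density_point g ((x j, a j i), (x j', a j' i'))"
    if "j < l" "j' < l" "i < l" "i' < l" "j \<noteq> j'" for j j' i i'
    using assms that by (simp add: strip_points_def)
qed

text \<open>
  The theorem \<open>ramsey_full\<close> colours two-element sets by numbers. Here a pair is given in increasing
  order, and the colours may come from any finite set, such as a set of functions.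
\<close>
lemma multicolour_ramsey:
  fixes C :: "'c set"
  assumes "finite C"
  shows "\<exists>M. \<forall>col :: nat \<Rightarrow> nat \<Rightarrow> 'c. (\<forall>t t'. t < t' \<longrightarrow> t' < M \<longrightarrow> col t t' \<in> C) \<longrightarrow>
      (\<exists>T c. T \<subseteq> {..<M} \<and> card T = n \<and> c \<in> C \<and> (\<forall>t\<in>T. \<forall>t'\<in>T. t < t' \<longrightarrow> col t t' = c))"
proof -
  obtain f where f: "bij_betw f C {..<card C}"
    using ex_bij_betw_finite_nat[OF assms] by (auto simp: atLeast0LessThan)
  obtain M :: nat where M: "partn_lst {..<M} (replicate (card C) n) 2"
    using ramsey_full by blast
  show ?thesis
  proof (intro exI[of _ M] allI impI)
    fix col :: "nat \<Rightarrow> nat \<Rightarrow> 'c"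
    assume col: "\<forall>t t'. t < t' \<longrightarrow> t' < M \<longrightarrow> col t t' \<in> C"
    define F where "F = (\<lambda>X. f (col (Min X) (Max X)))"
    have mm: "Min {t, t'} = t" "Max {t, t'} = t'" if "t < t'" for t t' :: nat using that by auto
    have "F \<in> nsets {..<M} 2 \<rightarrow> {..<length (replicate (card C) n)}"
    proof
      fix X assume "X \<in> nsets {..<M} 2"
      then obtain t t' where X: "X = {t, t'}" "t < t'" "t' < M"
        by (auto simp: nsets_def card_2_iff doubleton_eq_iff) (metis insert_commute linorder_neqE_nat)
      then have "col t t' \<in> C" using col by blast
      then show "F X \<in> {..<length (replicate (card C) n)}"
        using bij_betwE[OF f] X by (auto simp: F_def mm)
    qed
    then obtain i T where i: "i < card C" and T: "T \<in> nsets {..<M} n" "F ` nsets T 2 \<subseteq> {i}"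
      using M unfolding partn_lst_def monochromatic_def by fastforce
    obtain c where c: "c \<in> C" "f c = i"
      using f i unfolding bij_betw_def by (metis imageE lessThan_iff)
    have "col t t' = c" if "t \<in> T" "t' \<in> T" "t < t'" for t t'
    proof -
      have "{t, t'} \<in> nsets T 2" using that by (auto simp: nsets_def)
      then have "F {t, t'} = i" using subsetD[OF T(2) imageI] by simp
      then have "f (col t t') = f c" using that c by (simp add: F_def mm)
      moreover have "col t t' \<in> C" using col that T by (auto simp: nsets_def)
      ultimately show ?thesis using f c by (auto simp: bij_betw_def inj_on_def)
    qed
    then show "\<exists>T c. T \<subseteq> {..<M} \<and> card T = n \<and> c \<in> C \<and> (\<forall>t\<in>T. \<forall>t'\<in>T. t < t' \<longrightarrow> col t t' = c)"
      using T c by (intro exI[of _ T] exI[of _ c]) (auto simp: nsets_def)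
  qed
qed

lemma exists_good_tuple:
  fixes C :: "'i \<Rightarrow> 'a::euclidean_space set"
  assumes "finite I" "\<And>i. has_uniform (C i)"
    and "\<And>i j. i \<in> I \<Longrightarrow> j \<in> I \<Longrightarrow> i \<noteq> j \<Longrightarrow> B i j \<in> sets borel"
    and "\<And>i j. i \<in> I \<Longrightarrow> j \<in> I \<Longrightarrow> i \<noteq> j \<Longrightarrow>
      measure lborel ((C i \<times> C j) \<inter> B i j) \<le> \<eta> * measure lborel (C i \<times> C j)"
    and "\<eta> * real (card I) ^ 2 < 1" "0 \<le> \<eta>"
  shows "\<exists>v. (\<forall>i\<in>I. v i \<in> C i) \<and> (\<forall>i\<in>I. \<forall>j\<in>I. i \<noteq> j \<longrightarrow> (v i, v j) \<notin> B i j)"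
proof (rule ccontr)
  assume neg: "\<not> ?thesis"
  have "AE v in PiM I (\<lambda>i. uniform_on (C i)). v \<in> PiE I C"
    by (subst AE_PiM_uniform_on) (simp_all add: assms)
  then have "AE v in PiM I (\<lambda>i. uniform_on (C i)). \<exists>i\<in>I. \<exists>j\<in>I. i \<noteq> j \<and> (v i, v j) \<in> B i j"
  proof (rule eventually_mono)
    fix v assume "v \<in> PiE I C"
    then show "\<exists>i\<in>I. \<exists>j\<in>I. i \<noteq> j \<and> (v i, v j) \<in> B i j"
      using neg by (metis PiE_mem)
  qed
  moreover have "\<not> (AE v in PiM I (\<lambda>i. uniform_on (C i)). \<exists>i\<in>I. \<exists>j\<in>I. i \<noteq> j \<and> (v i, v j) \<in> B i j)"
    by (rule not_AE_bad_pair[where \<eta> = \<eta>]) (use assms in auto)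
  ultimately show False by (rule notE[rotated])
qed


lemma measure_cbox_point:
  fixes a b :: point
  assumes "fst a \<le> fst b" "snd a \<le> snd b"
  shows "measure lborel (cbox a b) = (fst b - fst a) * (snd b - snd a)"
  using assms by (cases a; cases b) (subst content_cbox, auto simp: Basis_prod_def)

text \<open>
  The points are chosen at random from thin windows in small cubes at the points \<open>(x j, a j i)\<close>,
  \<open>M\<close> windows for each of them; from left to right, the windows near the abscissa \<open>x j\<close> run
  through the layers cyclically. As \<open>((x j, a j i), (x j', a j' i'))\<close>
  is a density point for \<open>j \<noteq> j'\<close>, the value of \<open>g\<close> at a random pair from different strips is
  close to its value there with a probability that is as close to one as desired, and almost
  every pair is a density point. The point with number \<open>p = j * K + t * l + i\<close> belongs to
  strip \<open>j\<close> and layer \<open>i\<close>.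
\<close>
lemma clustered_points:
  fixes x :: "nat \<Rightarrow> real" and a :: "nat \<Rightarrow> nat \<Rightarrow> real"
  assumes g: "borel_orderon g"
    and l: "1 \<le> l" and M: "1 \<le> M" and \<delta>: "0 < \<delta>"
    and sp: "strip_points g l x a"
  defines "K \<equiv> M * l"
  defines "z \<equiv> \<lambda>p. (x (p div K), a (p div K) (p mod l))"
  shows "\<exists>R. (\<forall>p < l * K. R p \<in> box (0, 0) (1, 1)) \<and>
    (\<forall>p q. p < q \<longrightarrow> q < l * K \<longrightarrow> fst (R p) < fst (R q) \<and> density_point g (R p, R q) \<and>
       (p div K \<noteq> q div K \<longrightarrow> \<bar>g (R p, R q) - g (z p, z q)\<bar> < \<delta>))"
proof -
  note x01 = strip_pointsD(1)[OF sp] and xmono = strip_pointsD(2)[OF sp]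
    and a01 = strip_pointsD(3)[OF sp] and dens = strip_pointsD(4)[OF sp]
  define n where "n = l * K"
  have K: "K > 0" using l M by (simp add: K_def)
  have jlt: "p div K < l" and ilt: "p mod l < l" if "p < n" for p
    using that K l by (auto simp: n_def less_mult_imp_div_less)
  have [measurable]: "g \<in> borel_measurable borel" using g by (simp add: borel_orderon_def)
  have "AE p in lborel. density_point g p"
    using g by (intro AE_density_point) (auto simp only: borel_orderon_def)
  then obtain N where N: "N \<in> null_sets lborel" "{p \<in> space lborel. \<not> density_point g p} \<subseteq> N"
    by (rule AE_E) (auto simp: null_sets_def)
  define \<eta>' where "\<eta>' = 1 / (real n ^ 2 + 1)"
  have eta': "\<eta>' > 0" "\<eta>' * real n ^ 2 < 1" by (auto simp: \<eta>'_def field_simps add_pos_nonneg)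
  \<comment> \<open>a product of two windows fills the fraction \<open>1 / (4 * K\<^sup>2)\<close> of the product of their cubes\<close>
  define \<eta> where "\<eta> = \<eta>' / (4 * real K ^ 2)"
  have eta: "\<eta> > 0" using eta' K by (simp add: \<eta>_def)
  let ?bad = "\<lambda>p q. {uv. \<delta> \<le> \<bar>g uv - g (z p, z q)\<bar>}"
  let ?Q = "\<lambda>h p q. {uv \<in> cbox (z p, z q) ((z p, z q) + h *\<^sub>R One). \<delta> \<le> \<bar>g uv - g (z p, z q)\<bar>}"
  have "\<forall>\<^sub>F h in at_right 0. \<forall>p\<in>{..<n}. \<forall>q\<in>{..<n}. p div K \<noteq> q div K \<longrightarrow>
      measure lborel (?Q h p q) \<le> \<eta> * h ^ DIM(point \<times> point)"
  proof (intro eventually_ball_finite finite_lessThan ballI)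
    fix p q assume pq: "p \<in> {..<n}" "q \<in> {..<n}"
    show "\<forall>\<^sub>F h in at_right 0. p div K \<noteq> q div K \<longrightarrow> measure lborel (?Q h p q) \<le> \<eta> * h ^ DIM(point \<times> point)"
    proof (cases "p div K = q div K")
      case False
      have "density_point g (z p, z q)"
        unfolding z_def using pq False jlt ilt by (intro dens) auto
      from density_point_eventually[OF this \<delta> eta] show ?thesis
        by (rule eventually_mono) (rule impI)
    qed simp
  qed
  moreover have "\<forall>\<^sub>F h in at_right 0. \<forall>p\<in>{..<n}. \<forall>q\<in>{..<n}. p div K < q div K \<longrightarrow> h < x (q div K) - x (p div K)"
  proof (intro eventually_ball_finite finite_lessThan ballI)
    fix p q assume pq: "p \<in> {..<n}" "q \<in> {..<n}"
    show "\<forall>\<^sub>F h in at_right 0. p div K < q div K \<longrightarrow> h < x (q div K) - x (p div K)"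
    proof (cases "p div K < q div K")
      case True
      then show ?thesis using xmono[OF True] jlt pq by (simp add: eventually_less_at_right_0)
    qed simp
  qed
  moreover have "\<forall>\<^sub>F h in at_right 0. \<forall>p\<in>{..<n}. h < 1 - fst (z p) \<and> h < 1 - snd (z p)"
    unfolding z_def using x01 a01 jlt ilt
    by (intro eventually_ball_finite ballI eventually_conj eventually_less_at_right_0) auto
  moreover have "\<forall>\<^sub>F h in at_right 0. h > (0::real)" by (simp add: eventually_at_right_less)
  ultimately have ev: "\<forall>\<^sub>F h in at_right 0. h > (0::real) \<and> (\<forall>p\<in>{..<n}. h < 1 - fst (z p) \<and> h < 1 - snd (z p)) \<and>
      (\<forall>p\<in>{..<n}. \<forall>q\<in>{..<n}. p div K < q div K \<longrightarrow> h < x (q div K) - x (p div K)) \<and>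
      (\<forall>p\<in>{..<n}. \<forall>q\<in>{..<n}. p div K \<noteq> q div K \<longrightarrow> measure lborel (?Q h p q) \<le> \<eta> * h ^ DIM(point \<times> point))"
    by eventually_elim (intro conjI)
  obtain h where hh: "h > (0::real) \<and> (\<forall>p\<in>{..<n}. h < 1 - fst (z p) \<and> h < 1 - snd (z p)) \<and>
      (\<forall>p\<in>{..<n}. \<forall>q\<in>{..<n}. p div K < q div K \<longrightarrow> h < x (q div K) - x (p div K)) \<and>
      (\<forall>p\<in>{..<n}. \<forall>q\<in>{..<n}. p div K \<noteq> q div K \<longrightarrow> measure lborel (?Q h p q) \<le> \<eta> * h ^ DIM(point \<times> point))"
    using eventually_happens'[OF trivial_limit_at_right_real ev] by (elim exE)
  have h: "0 < h" using hh by (rule conjunct1)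
  have h1: "h < 1 - fst (z p)" "h < 1 - snd (z p)" if "p < n" for p
    using bspec[OF conjunct1[OF conjunct2[OF hh]], of p] that by auto
  have h2: "x (p div K) + h < x (q div K)" if "p < n" "q < n" "p div K < q div K" for p q
    using conjunct1[OF conjunct2[OF conjunct2[OF hh]], rule_format, of p q] that by auto
  have h3: "measure lborel (?Q h p q) \<le> \<eta> * h ^ DIM(point \<times> point)" if "p < n" "q < n" "p div K \<noteq> q div K" for p q
    using conjunct2[OF conjunct2[OF conjunct2[OF hh]], rule_format, of p q] that by auto
  define s where "s = (\<lambda>p. h * real (p mod K) / real K)"
  have s: "0 \<le> s p" "s p + h / (2 * real K) \<le> h" for p
  proof -
    show "0 \<le> s p" using h by (simp add: s_def)
    have "real (p mod K) + 1 / 2 \<le> real K"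
      using mod_less_divisor[OF K, of p] by linarith
    then have "h * (real (p mod K) + 1 / 2) / real K \<le> h * real K / real K"
      using h K by (intro divide_right_mono mult_left_mono) auto
    then show "s p + h / (2 * real K) \<le> h" using K by (simp add: s_def field_simps)
  qed
  \<comment> \<open>a window takes half of the width available to it, so consecutive abscissae differ strictly\<close>
  define C where "C = (\<lambda>p. cbox (fst (z p) + s p, snd (z p)) (fst (z p) + s p + h / (2 * real K), snd (z p) + h))"
  have hK: "0 < h / (2 * real K)" using h K by simp
  have C: "has_uniform (C p)" for p
    unfolding C_def using h hK by (intro has_uniform_cbox) (auto simp: Basis_prod_def)
  have Cb: "C p \<in> sets borel" for p using C by (simp add: has_uniform_def)
  have mC: "measure lborel (C p) = h / (2 * real K) * h" for p
    unfolding C_def using h hK by (subst measure_cbox_point) auto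
  have mCC: "measure lborel (C p \<times> C q) = h ^ 4 / (4 * real K ^ 2)" for p q
    using K by (simp add: measure_lborel_Times Cb mC power2_eq_square power4_eq_xxxx field_simps)
  have Csub: "C p \<subseteq> cbox (z p) (z p + (h, h))" for p
    using s[of p] by (auto simp: C_def mem_cbox_point)
  define B where "B = (\<lambda>p q. N \<union> (if p div K \<noteq> q div K then ?bad p q else {}))"
  have Nb: "N \<in> sets borel" using N by (auto simp: null_sets_def)
  have Bb: "B p q \<in> sets borel" for p q
  proof -
    have "{uv \<in> space borel. \<delta> \<le> \<bar>g uv - g (z p, z q)\<bar>} \<in> sets borel" by measurable
    then show ?thesis using Nb by (simp add: B_def)
  qed
  have "\<exists>v. (\<forall>p\<in>{..<n}. v p \<in> C p) \<and> (\<forall>p\<in>{..<n}. \<forall>q\<in>{..<n}. p \<noteq> q \<longrightarrow> (v p, v q) \<notin> B p q)"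
  proof (rule exists_good_tuple[where \<eta> = \<eta>'])
    fix p q assume pq: "p \<in> {..<n}" "q \<in> {..<n}" "p \<noteq> q"
    have "measure lborel ((C p \<times> C q) \<inter> B p q) \<le> \<eta> * h ^ 4"
    proof (cases "p div K = q div K")
      case True
      have "(C p \<times> C q) \<inter> N \<in> null_sets lborel"
        by (rule null_sets_subset[OF N(1)]) (use Cb Nb in \<open>auto intro!: sets.Int borel_Times\<close>)
      then have "measure lborel ((C p \<times> C q) \<inter> N) = 0" by (simp add: measure_def null_sets_def)
      then show ?thesis using True eta by (simp add: B_def)
    next
      case False
      have Qb: "?Q h p q \<in> sets lborel"
      proof -
        have "{uv \<in> space borel. \<delta> \<le> \<bar>g uv - g (z p, z q)\<bar>} \<inter> cbox (z p, z q) ((z p, z q) + h *\<^sub>R One) \<in> sets borel"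
          by (intro sets.Int) measurable
        then show ?thesis by (simp add: Int_def conj_commute)
      qed
      have "emeasure lborel (?Q h p q) \<le> emeasure lborel (cbox (z p, z q) ((z p, z q) + h *\<^sub>R One))"
        by (intro emeasure_mono) auto
      also have "\<dots> < \<infinity>" by (simp add: emeasure_lborel_cbox_eq)
      finally have Qf: "emeasure lborel (?Q h p q) < \<infinity>" .
      have sub: "(C p \<times> C q) \<inter> B p q \<subseteq> N \<union> ?Q h p q"
      proof
        fix uv assume uv: "uv \<in> (C p \<times> C q) \<inter> B p q"
        then have "uv \<in> cbox (z p) (z p + (h, h)) \<times> cbox (z q) (z q + (h, h))"
          using Csub by blast
        then have "uv \<in> cbox (z p, z q) ((z p, z q) + h *\<^sub>R One)" by (simp only: cube_pair)
        moreover have "uv \<in> N \<union> ?bad p q" using uv False by (simp only: B_def if_True simp_thms) blast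
        ultimately show "uv \<in> N \<union> ?Q h p q" by blast
      qed
      have "emeasure lborel ((C p \<times> C q) \<inter> B p q) \<le> emeasure lborel (N \<union> ?Q h p q)"
        by (rule emeasure_mono[OF sub]) (rule sets.Un[OF null_setsD2[OF N(1)] Qb])
      also have "N \<union> ?Q h p q = ?Q h p q \<union> N" by (rule Un_commute)
      also have "emeasure lborel \<dots> = emeasure lborel (?Q h p q)"
        by (rule emeasure_Un_null_set[OF Qb N(1)])
      finally have "measure lborel ((C p \<times> C q) \<inter> B p q) \<le> measure lborel (?Q h p q)"
        unfolding measure_def by (rule enn2real_mono) (use Qf in simp)
      also have "\<dots> \<le> \<eta> * h ^ DIM(point \<times> point)" using pq False by (intro h3) auto
      finally show ?thesis by (simp only: DIM_point_pair)
    qed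
    also have "\<eta> * h ^ 4 = \<eta>' * measure lborel (C p \<times> C q)" by (simp add: mCC \<eta>_def)
    finally show "measure lborel ((C p \<times> C q) \<inter> B p q) \<le> \<eta>' * measure lborel (C p \<times> C q)" .
  qed (use C Bb eta' in auto)
  then obtain R where R: "\<forall>p\<in>{..<n}. R p \<in> C p" "\<forall>p\<in>{..<n}. \<forall>q\<in>{..<n}. p \<noteq> q \<longrightarrow> (R p, R q) \<notin> B p q"
    by (elim exE conjE)
  have RC: "fst (z p) + s p \<le> fst (R p)" "fst (R p) \<le> fst (z p) + s p + h / (2 * real K)"
      "snd (z p) \<le> snd (R p)" "snd (R p) \<le> snd (z p) + h" if "p < n" for p
    using bspec[OF R(1), of p] that by (auto simp: C_def mem_cbox_point)
  have "R p \<in> box (0, 0) (1, 1)" if "p < n" for p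
    using RC[OF that] s[of p] h1[OF that] x01[OF jlt[OF that]] a01[OF jlt[OF that] ilt[OF that]]
    by (simp add: mem_box_point z_def)
  moreover have "fst (R p) < fst (R q)" if "p < q" "q < n" for p q
  proof -
    have pn: "p < n" using that by simp
    have "p div K \<le> q div K" using that by (simp add: div_le_mono)
    then consider "p div K < q div K" | "p div K = q div K" by linarith
    then show ?thesis
    proof cases
      case 1
      have "fst (R p) \<le> x (p div K) + h" using RC[OF pn] s[of p] by (simp add: z_def)
      also have "\<dots> < x (q div K)" by (rule h2[OF pn that(2) 1])
      also have "\<dots> \<le> fst (R q)" using RC[OF that(2)] s[of q] by (simp add: z_def)
      finally show ?thesis .
    next
      case 2
      have "p mod K < q mod K" using that 2 div_mult_mod_eq[of p K] div_mult_mod_eq[of q K]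
        by (metis nat_add_left_cancel_less)
      then have "real (p mod K) + 1 \<le> real (q mod K)" by linarith
      then have "h * (real (p mod K) + 1) / real K \<le> h * real (q mod K) / real K"
        using h K by (intro divide_right_mono mult_left_mono) auto
      then have "s p + h / real K \<le> s q" by (simp add: s_def field_simps add_divide_distrib)
      moreover have "h / (2 * real K) < h / real K" using h K by (simp add: field_simps)
      ultimately show ?thesis using RC[OF pn] RC[OF that(2)] 2 by (simp add: z_def)
    qed
  qed
  moreover have "density_point g (R p, R q)" if "p < q" "q < n" for p q
  proof (rule ccontr)
    assume "\<not> density_point g (R p, R q)"
    then have "(R p, R q) \<in> N" using N(2) by auto
    then show False using R(2) that by (auto simp: B_def)
  qed
  moreover have "\<bar>g (R p, R q) - g (z p, z q)\<bar> < \<delta>" if "p < q" "q < n" "p div K \<noteq> q div K" for p q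
    using R(2)[rule_format, of p q] that by (simp add: B_def)
  ultimately show ?thesis unfolding n_def by blast
qed


text \<open>
  The vertex \<open>p = (j * n + s) * l + i\<close> belongs to strip \<open>j = p div (n * l)\<close>, block \<open>s\<close> of this
  strip, and layer \<open>i = p mod l\<close>. Up to \<open>1 / n\<close>, the value of \<open>g\<close> at a pair of points from
  different blocks depends only on their strips and layers and, in the same strip, on the order
  of the blocks.
\<close>
definition homogeneous :: "(point \<times> point \<Rightarrow> real) \<Rightarrow> nat \<Rightarrow> (nat \<Rightarrow> nat \<Rightarrow> nat \<Rightarrow> nat \<Rightarrow> real) \<Rightarrow> nat \<Rightarrow>
    (nat \<Rightarrow> point) \<Rightarrow> (nat \<Rightarrow> nat \<Rightarrow> nat \<Rightarrow> real) \<Rightarrow> bool" where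
  "homogeneous g l A n Q c \<longleftrightarrow>
    (\<forall>p < l * (n * l). Q p \<in> box (0, 0) (1, 1)) \<and>
    (\<forall>j<l. \<forall>i<l. \<forall>i'<l. 0 \<le> c j i i' \<and> c j i i' \<le> 1) \<and>
    (\<forall>p q. p < q \<longrightarrow> q < l * (n * l) \<longrightarrow> fst (Q p) < fst (Q q) \<and> density_point g (Q p, Q q) \<and>
       (p div l \<noteq> q div l \<longrightarrow>
         \<bar>g (Q p, Q q) - (if p div (n * l) = q div (n * l) then c (p div (n * l)) (p mod l) (q mod l)
           else A (p div (n * l)) (p mod l) (q div (n * l)) (q mod l))\<bar> \<le> 1 / real n))"

text \<open>
  Inside a strip nothing is known about the values of \<open>g\<close> at clustered points. Colour a pair
  of indices \<open>t < t'\<close> by these values, rounded to multiples of \<open>1 / n\<close>, for all strips and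
  all pairs of layers at once; a monochromatic set of \<open>n\<close> indices provides the blocks, and its
  colour the constants \<open>c\<close>.
\<close>
lemma homogeneous_points:
  fixes x :: "nat \<Rightarrow> real" and a :: "nat \<Rightarrow> nat \<Rightarrow> real"
  assumes g: "borel_orderon g"
    and l: "1 \<le> l" and n: "1 \<le> n"
    and sp: "strip_points g l x a"
  shows "\<exists>Q c. homogeneous g l (sampled g x a) n Q c"
proof -
  define D where "D = {..<l} \<times> {..<l} \<times> {..<l}"
  define Col where "Col = (PiE D (\<lambda>_. {0..int n}))"
  have finCol: "finite Col" unfolding Col_def D_def by (intro finite_PiE) auto
  obtain M where M: "\<And>col :: nat \<Rightarrow> nat \<Rightarrow> nat \<times> nat \<times> nat \<Rightarrow> int. (\<And>t t'. t < t' \<Longrightarrow> t' < M \<Longrightarrow> col t t' \<in> Col) \<Longrightarrow>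
      (\<exists>T c. T \<subseteq> {..<M} \<and> card T = n \<and> c \<in> Col \<and> (\<forall>t\<in>T. \<forall>t'\<in>T. t < t' \<longrightarrow> col t t' = c))"
    using multicolour_ramsey[OF finCol, of n] by blast
  have M1: "1 \<le> M"
  proof (rule ccontr)
    assume "\<not> 1 \<le> M"
    then have "\<exists>T c. T \<subseteq> {..<M} \<and> card T = n \<and> c \<in> Col \<and> (\<forall>t\<in>T. \<forall>t'\<in>T. t < t' \<longrightarrow> undefined t t' = c)"
      using \<open>\<not> 1 \<le> M\<close> by (intro M) auto
    then obtain T where "T \<subseteq> {..<M}" "card T = n" by blast
    moreover have "M = 0" using \<open>\<not> 1 \<le> M\<close> by simp
    ultimately show False using n by simp
  qed
  define K where "K = M * l"
  define z where "z = (\<lambda>j i. (x j, a j i))"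
  have n_pos: "1 / real n > 0" using n by simp
  have "\<exists>R. (\<forall>p < l * K. R p \<in> box (0, 0) (1, 1)) \<and>
    (\<forall>p q. p < q \<longrightarrow> q < l * K \<longrightarrow> fst (R p) < fst (R q) \<and> density_point g (R p, R q) \<and>
       (p div K \<noteq> q div K \<longrightarrow> \<bar>g (R p, R q) - g (z (p div K) (p mod l), z (q div K) (q mod l))\<bar> < 1 / real n))"
    unfolding K_def z_def
    by (rule clustered_points[OF g l M1 n_pos sp])
  then obtain R where R: "\<forall>p < l * K. R p \<in> box (0, 0) (1, 1)"
    and Rp0: "\<forall>p q. p < q \<longrightarrow> q < l * K \<longrightarrow> fst (R p) < fst (R q) \<and> density_point g (R p, R q) \<and>
       (p div K \<noteq> q div K \<longrightarrow> \<bar>g (R p, R q) - g (z (p div K) (p mod l), z (q div K) (q mod l))\<bar> < 1 / real n)"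
    by (elim exE conjE)
  note Rp = Rp0[rule_format]
  define V where "V = (\<lambda>t t' (j, i, i'). g (R ((j * M + t) * l + i), R ((j * M + t') * l + i')))"
  define col where "col = (\<lambda>t t'. \<lambda>d\<in>D. \<lfloor>real n * V t t' d\<rfloor>)"
  have g01: "0 \<le> g p" "g p \<le> 1" for p using g unfolding borel_orderon_def by blast+
  have V01: "0 \<le> V t t' d" "V t t' d \<le> 1" for t t' d
    unfolding V_def by (cases d; simp add: g01)+
  have "col t t' \<in> Col" for t t'
  proof -
    have "0 \<le> \<lfloor>real n * V t t' d\<rfloor>" "\<lfloor>real n * V t t' d\<rfloor> \<le> int n" for d
    proof -
      show "0 \<le> \<lfloor>real n * V t t' d\<rfloor>" using V01 by simp
      have "real n * V t t' d \<le> real n * 1" using V01 by (intro mult_left_mono) auto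
      then show "\<lfloor>real n * V t t' d\<rfloor> \<le> int n" by (simp add: floor_le_iff)
    qed
    then show ?thesis by (auto simp: Col_def col_def)
  qed
  then obtain T \<kappa> where T: "T \<subseteq> {..<M}" "card T = n" and \<kappa>: "\<kappa> \<in> Col"
    and hom: "\<And>t t'. t \<in> T \<Longrightarrow> t' \<in> T \<Longrightarrow> t < t' \<Longrightarrow> col t t' = \<kappa>"
    using M[of col] by blast
  have finT: "finite T" using T(1) finite_subset by blast
  define e where "e = (\<lambda>s. sorted_list_of_set T ! s)"
  have eT: "e s \<in> T" if "s < n" for s
    using that finT T(2) unfolding e_def by (metis length_sorted_list_of_set nth_mem set_sorted_list_of_set)
  have emono: "e s < e s'" if "s < s'" "s' < n" for s s'
    using that finT T(2) unfolding e_def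
    by (intro sorted_wrt_nth_less[of "(<)"]) auto
  have eM: "e s < M" if "s < n" for s using eT[OF that] T(1) by auto
  define idx where "idx = (\<lambda>p. ((p div (n * l)) * M + e ((p div l) mod n)) * l + p mod l)"
  have l0: "0 < l" and n0: "0 < n" using l n by auto
  have divn: "p div (n * l) = (p div l) div n" for p
    by (metis div_mult2_eq mult.commute)
  have sn: "(p div l) mod n < n" for p using n0 by simp
  have jl: "p div (n * l) < l" if "p < l * (n * l)" for p
    using that by (simp add: less_mult_imp_div_less)
  have idx_mod: "idx p mod l = p mod l" and idx_div: "idx p div l = (p div (n * l)) * M + e ((p div l) mod n)" for p
    using l0 by (auto simp: idx_def)
  have idx_div2: "idx p div K = p div (n * l)" for p
  proof -
    have "idx p div K = (idx p div l) div M" unfolding K_def by (metis div_mult2_eq mult.commute)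
    then show ?thesis using eM[OF sn, of p] M1 by (simp add: idx_div)
  qed
  have idx_lt: "idx p < l * K" if "p < l * (n * l)" for p
    using idx_div2[of p] jl[OF that] l0 M1 by (metis K_def div_less_iff_less_mult mult_pos_pos less_le_trans zero_less_one)
  have idx_mono: "idx p < idx q" if pq: "p < q" for p q
  proof -
    have "p div l \<le> q div l" using pq by (simp add: div_le_mono)
    then consider "p div l = q div l" | "p div l < q div l" by linarith
    then show ?thesis
    proof cases
      case 1
      then have "p mod l < q mod l"
        using pq div_mult_mod_eq[of p l] div_mult_mod_eq[of q l] by (metis nat_add_left_cancel_less)
      then show ?thesis using 1 by (simp add: idx_def divn)
    next
      case 2
      have "(p div (n * l)) * M + e ((p div l) mod n) < (q div (n * l)) * M + e ((q div l) mod n)"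
      proof (cases "p div (n * l) = q div (n * l)")
        case True
        then have "(p div l) mod n < (q div l) mod n"
          using 2 div_mult_mod_eq[of "p div l" n] div_mult_mod_eq[of "q div l" n] unfolding divn
          by (metis nat_add_left_cancel_less)
        then show ?thesis using True emono[OF _ sn] by simp
      next
        case False
        have "p div (n * l) \<le> q div (n * l)" using pq by (simp add: div_le_mono)
        then have "Suc (p div (n * l)) \<le> q div (n * l)" using False by simp
        then have "Suc (p div (n * l)) * M \<le> (q div (n * l)) * M" by (rule mult_le_mono1)
        then show ?thesis using eM[OF sn, of p] by simp
      qed
      then have "Suc (idx p div l) \<le> idx q div l" by (simp add: idx_div)
      then show ?thesis by (metis Suc_le_eq div_le_mono not_less)
    qed
  qed
  define Q where "Q = (\<lambda>p. R (idx p))"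
  define c where "c = (\<lambda>j i i'. real_of_int (\<kappa> (j, i, i')) / real n)"
  have main: "\<bar>g (Q p, Q q) - (if p div (n * l) = q div (n * l) then c (p div (n * l)) (p mod l) (q mod l)
           else g (z (p div (n * l)) (p mod l), z (q div (n * l)) (q mod l)))\<bar> \<le> 1 / real n"
    if pq: "p < q" "q < l * (n * l)" "p div l \<noteq> q div l" for p q
  proof (cases "p div (n * l) = q div (n * l)")
    case False
    then show ?thesis
      using Rp[OF idx_mono[OF pq(1)] idx_lt[OF pq(2)]] by (simp add: idx_div2 idx_mod Q_def less_imp_le)
  next
    case True
    define t where "t = e ((p div l) mod n)"
    define t' where "t' = e ((q div l) mod n)"
    have "p div l < q div l" using pq by (simp add: div_le_mono le_neq_trans)
    then have "(p div l) mod n < (q div l) mod n"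
      using True div_mult_mod_eq[of "p div l" n] div_mult_mod_eq[of "q div l" n] unfolding divn
      by (metis nat_add_left_cancel_less)
    then have tt: "t < t'" unfolding t_def t'_def by (intro emono sn)
    define d where "d = (p div (n * l), p mod l, q mod l)"
    have "d \<in> D" using jl[of p] pq l0 by (simp add: d_def D_def)
    have "col t t' = \<kappa>" using tt by (intro hom) (auto simp: t_def t'_def eT sn)
    then have "\<kappa> d = \<lfloor>real n * V t t' d\<rfloor>" using \<open>d \<in> D\<close> by (auto simp: col_def)
    moreover have "V t t' d = g (Q p, Q q)"
      using True by (simp add: V_def d_def Q_def idx_def t_def t'_def)
    ultimately have "real_of_int (\<kappa> d) \<le> real n * g (Q p, Q q)" "real n * g (Q p, Q q) < real_of_int (\<kappa> d) + 1"
      by (simp_all add: floor_correct)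
    then have "\<bar>real n * g (Q p, Q q) - real_of_int (\<kappa> d)\<bar> \<le> 1" by simp
    then have "\<bar>real n * g (Q p, Q q) - real_of_int (\<kappa> d)\<bar> / real n \<le> 1 / real n"
      using n0 by (intro divide_right_mono) auto
    moreover have "g (Q p, Q q) - real_of_int (\<kappa> d) / real n = (real n * g (Q p, Q q) - real_of_int (\<kappa> d)) / real n"
      using n0 by (simp add: field_simps)
    ultimately have "\<bar>g (Q p, Q q) - real_of_int (\<kappa> d) / real n\<bar> \<le> 1 / real n"
      by (simp only: abs_divide abs_of_nat)
    then show ?thesis using True by (simp add: c_def d_def)
  qed
  have c01: "0 \<le> c j i i' \<and> c j i i' \<le> 1" if "j < l" "i < l" "i' < l" for j i i'
  proof -
    have "(j, i, i') \<in> D" using that by (simp add: D_def)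
    then have "\<kappa> (j, i, i') \<in> {0..int n}" using \<kappa> by (auto simp: Col_def)
    then show ?thesis using n0 by (auto simp: c_def field_simps)
  qed
  show ?thesis
    unfolding homogeneous_def
  proof (intro exI[of _ Q] exI[of _ c] conjI allI impI)
    show "Q p \<in> box (0, 0) (1, 1)" if "p < l * (n * l)" for p
      using R idx_lt[OF that] by (simp add: Q_def)
    show "fst (Q p) < fst (Q q)" "density_point g (Q p, Q q)" if "p < q" "q < l * (n * l)" for p q
      using Rp[OF idx_mono[OF that(1)] idx_lt[OF that(2)]] by (simp_all add: Q_def)
  qed (erule (2) main[unfolded z_def] | simp add: c01)+
qed

section \<open>Random strip points\<close>

definition layer_box :: "nat \<Rightarrow> nat \<Rightarrow> nat \<Rightarrow> point set" where
  "layer_box l j i = cell l j \<times> cell l i"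

lemma layer_box_sub: "0 < l \<Longrightarrow> j < l \<Longrightarrow> i < l \<Longrightarrow> layer_box l j i \<subseteq> unit_square"
proof
  assume *: "0 < l" "j < l" "i < l"
  fix p assume "p \<in> layer_box l j i"
  then have "fst p \<in> cell l j" "snd p \<in> cell l i" by (auto simp: layer_box_def)
  then show "p \<in> unit_square"
    using cell_in_unit[OF *(1,2), of "fst p"] cell_in_unit[OF *(1,3), of "snd p"]
    by (simp add: unit_square_def mem_Times_iff less_imp_le)
qed

lemma has_uniform_layer_box: "0 < l \<Longrightarrow> has_uniform (layer_box l j i)"
  unfolding layer_box_def by (intro has_uniform_Times has_uniform_cell)

lemma layer_box_disjoint:
  assumes "0 < l" "p \<in> layer_box l j i" "p \<in> layer_box l j' i'"
  shows "j = j' \<and> i = i'"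
proof -
  have "fst p \<in> cell l j" "fst p \<in> cell l j'" "snd p \<in> cell l i" "snd p \<in> cell l i'"
    using assms by (auto simp: layer_box_def mem_Times_iff)
  then show ?thesis
    using floor_cell[OF assms(1), of "fst p"] floor_cell[OF assms(1), of "snd p"] by auto
qed

lemma emeasure_layer_box_pair:
  assumes "0 < l"
  shows "emeasure lborel (layer_box l j i \<times> layer_box l j' i') = ennreal (1 / real l ^ 4)"
proof -
  have b: "cell l k \<in> sets borel" for k by (simp add: cell_def)
  show ?thesis
    using assms
    by (simp only: emeasure_lborel_Times layer_box_def b borel_Times emeasure_cell ennreal_mult'[symmetric] divide_nonneg_nonneg zero_le_one of_nat_0_le_iff)
       (simp add: power4_eq_xxxx ennreal_mult'[symmetric])
qed

text \<open>
  Coordinate \<open>0\<close> is the abscissa of strip \<open>j\<close>, and coordinate \<open>Suc i\<close> is its ordinate in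
  layer \<open>i\<close>.
\<close>
definition strip_law :: "nat \<Rightarrow> nat \<Rightarrow> (nat \<Rightarrow> real) measure" where
  "strip_law l j = PiM {..l} (\<lambda>k. uniform_on (if k = 0 then cell l j else cell l (k - 1)))"

lemma prob_space_strip_law: "0 < l \<Longrightarrow> prob_space (strip_law l j)"
  unfolding strip_law_def by (intro prob_space_PiM prob_space_uniform_on) (auto intro: has_uniform_cell)

lemma distr_strip_law:
  assumes "0 < l" "i < l"
  shows "distr (strip_law l j) borel (\<lambda>y. (y 0, y (Suc i))) = uniform_on (layer_box l j i)"
proof -
  let ?M = "\<lambda>k. uniform_on (if k = 0 then cell l j else cell l (k - 1))"
  have "distr (strip_law l j) borel (\<lambda>y. (y 0, y (Suc i))) = distr (PiM {..l} ?M) (?M 0 \<Otimes>\<^sub>M ?M (Suc i)) (\<lambda>y. (y 0, y (Suc i)))"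
    unfolding strip_law_def
  proof (rule distr_cong)
    have "sets (?M 0 \<Otimes>\<^sub>M ?M (Suc i)) = sets (borel \<Otimes>\<^sub>M borel)"
      by (intro sets_pair_measure_cong sets_uniform_on)
    then show "sets borel = sets (?M 0 \<Otimes>\<^sub>M ?M (Suc i))" by (simp only: borel_prod)
  qed (rule refl)+
  also have "\<dots> = ?M 0 \<Otimes>\<^sub>M ?M (Suc i)"
  proof (rule distr_PiM_pair)
    show "prob_space (?M k)" for k using assms by (intro prob_space_uniform_on) (auto intro: has_uniform_cell)
  qed (use assms in simp_all)
  also have "\<dots> = uniform_on (layer_box l j i)"
    unfolding layer_box_def if_P[OF refl] if_not_P[OF nat.distinct(2)] diff_Suc_1
    by (rule uniform_on_pair[OF has_uniform_cell[OF assms(1)] has_uniform_cell[OF assms(1)]])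
  finally show ?thesis .
qed

definition rep_law :: "nat \<Rightarrow> (nat \<Rightarrow> nat \<Rightarrow> real) measure" where
  "rep_law l = PiM {..<l} (strip_law l)"

lemma prob_space_rep_law: "0 < l \<Longrightarrow> prob_space (rep_law l)"
  unfolding rep_law_def by (intro prob_space_PiM prob_space_strip_law)

definition rep_pair :: "nat \<Rightarrow> nat \<Rightarrow> nat \<Rightarrow> nat \<Rightarrow> (nat \<Rightarrow> nat \<Rightarrow> real) \<Rightarrow> point \<times> point" where
  "rep_pair j i j' i' Y = ((Y j 0, Y j (Suc i)), (Y j' 0, Y j' (Suc i')))"

lemma strip_pair_measurable:
  assumes "i < l"
  shows "(\<lambda>y. (y 0, y (Suc i))) \<in> strip_law l j \<rightarrow>\<^sub>M (borel :: point measure)"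
proof -
  have "(\<lambda>y. y k) \<in> strip_law l j \<rightarrow>\<^sub>M borel" if "k \<le> l" for k
    using measurable_component_singleton[of k "{..l}" "\<lambda>k. uniform_on (if k = 0 then cell l j else cell l (k - 1))"] that
    unfolding strip_law_def by (simp cong: measurable_cong_sets)
  then have "(\<lambda>y. (y 0, y (Suc i))) \<in> strip_law l j \<rightarrow>\<^sub>M borel \<Otimes>\<^sub>M borel"
    using assms by (intro measurable_Pair) auto
  then show ?thesis by (simp only: borel_prod)
qed

lemma rep_pair_measurable:
  assumes "j < l" "j' < l" "i < l" "i' < l"
  shows "rep_pair j i j' i' \<in> rep_law l \<rightarrow>\<^sub>M borel"
proof -
  have "(\<lambda>Y. (Y j 0, Y j (Suc i))) \<in> rep_law l \<rightarrow>\<^sub>M borel" if "j < l" "i < l" for j i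
  proof -
    have "(\<lambda>Y. Y j) \<in> rep_law l \<rightarrow>\<^sub>M strip_law l j"
      unfolding rep_law_def using that by (intro measurable_component_singleton) simp
    from measurable_compose[OF this strip_pair_measurable[OF that(2)]] show ?thesis .
  qed
  then have "rep_pair j i j' i' \<in> rep_law l \<rightarrow>\<^sub>M borel \<Otimes>\<^sub>M borel"
    unfolding rep_pair_def using assms by (intro measurable_Pair) auto
  then show ?thesis by (simp only: borel_prod)
qed

text \<open>
  The two points come from different strips, so they are independent although points of the
  same strip share their abscissa. This is why the pair is uniformly distributed on a product of
  two boxes.
\<close>
lemma distr_rep_pair:
  assumes l: "0 < l" and jj: "j < l" "j' < l" "j \<noteq> j'" and ii: "i < l" "i' < l"
  shows "distr (rep_law l) borel (rep_pair j i j' i') = uniform_on (layer_box l j i \<times> layer_box l j' i')"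
proof -
  let ?Y = "strip_law l" and ?f = "\<lambda>i y. (y 0, y (Suc i)) :: point"
  have sb: "sets (borel :: (point \<times> point) measure) = sets (borel \<Otimes>\<^sub>M borel)" by (simp only: borel_prod)
  have m: "(\<lambda>(y, y'). (?f i y, ?f i' y')) \<in> ?Y j \<Otimes>\<^sub>M ?Y j' \<rightarrow>\<^sub>M borel \<Otimes>\<^sub>M borel"
    unfolding case_prod_unfold
    by (intro measurable_Pair measurable_compose[OF measurable_fst strip_pair_measurable]
         measurable_compose[OF measurable_snd strip_pair_measurable] ii)
  have pm: "(\<lambda>Y. (Y j, Y j')) \<in> rep_law l \<rightarrow>\<^sub>M ?Y j \<Otimes>\<^sub>M ?Y j'"
    unfolding rep_law_def using jj by (intro measurable_Pair measurable_component_singleton) auto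
  have "distr (rep_law l) borel (rep_pair j i j' i')
      = distr (rep_law l) (borel \<Otimes>\<^sub>M borel) ((\<lambda>(y, y'). (?f i y, ?f i' y')) \<circ> (\<lambda>Y. (Y j, Y j')))"
    by (intro distr_cong refl sb) (simp add: rep_pair_def)
  also have "\<dots> = distr (distr (rep_law l) (?Y j \<Otimes>\<^sub>M ?Y j') (\<lambda>Y. (Y j, Y j'))) (borel \<Otimes>\<^sub>M borel) (\<lambda>(y, y'). (?f i y, ?f i' y'))"
    by (rule distr_distr[OF m pm, symmetric])
  also have "distr (rep_law l) (?Y j \<Otimes>\<^sub>M ?Y j') (\<lambda>Y. (Y j, Y j')) = ?Y j \<Otimes>\<^sub>M ?Y j'"
    unfolding rep_law_def using jj l by (intro distr_PiM_pair prob_space_strip_law) auto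
  also have "distr (?Y j \<Otimes>\<^sub>M ?Y j') (borel \<Otimes>\<^sub>M borel) (\<lambda>(y, y'). (?f i y, ?f i' y'))
      = distr (?Y j) borel (?f i) \<Otimes>\<^sub>M distr (?Y j') borel (?f i')"
  proof (rule pair_measure_distr[symmetric])
    show "sigma_finite_measure (distr (?Y j') borel (?f i'))"
      unfolding distr_strip_law[OF l ii(2)]
      by (intro prob_space_imp_sigma_finite prob_space_uniform_on has_uniform_layer_box l)
  qed (intro strip_pair_measurable ii)+
  also have "\<dots> = uniform_on (layer_box l j i \<times> layer_box l j' i')"
    unfolding distr_strip_law[OF l ii(1)] distr_strip_law[OF l ii(2)]
    by (intro uniform_on_pair has_uniform_layer_box l)
  finally show ?thesis .
qed

text \<open>
  The first moment method: the boxes are disjoint and each pair of points is uniform on its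
  pair of boxes, which has volume \<open>1 / l ^ 4\<close>, so the sum has expectation at most \<open>\<eta> * l ^ 4\<close>
  and exceeds twice this value with probability less than one. A property of almost all pairs
  can be required in addition.
\<close>
lemma representatives:
  fixes h :: "point \<times> point \<Rightarrow> real"
  assumes l: "0 < l" and hm: "h \<in> borel_measurable borel" and h0: "\<And>p. 0 \<le> h p" and \<eta>: "0 < \<eta>"
    and hint: "(\<integral>\<^sup>+p. ennreal (h p) * indicator square2 p \<partial>lborel) \<le> ennreal \<eta>"
    and D: "AE p in lborel. Dn p"
  shows "\<exists>x a. (\<forall>j<l. x j \<in> cell l j) \<and> (\<forall>j<l. \<forall>i<l. a j i \<in> cell l i) \<and>
     (\<forall>j<l. \<forall>j'<l. \<forall>i<l. \<forall>i'<l. j \<noteq> j' \<longrightarrow> Dn ((x j, a j i), (x j', a j' i'))) \<and>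
     (\<Sum>(j, i, j', i') \<in> {(j, i, j', i'). j < l \<and> i < l \<and> j' < l \<and> i' < l \<and> j \<noteq> j'}.
        h ((x j, a j i), (x j', a j' i'))) \<le> 2 * \<eta> * real l ^ 4"
proof -
  define Q where "Q = {(j, i, j', i'). j < l \<and> i < l \<and> j' < l \<and> i' < l \<and> j \<noteq> j'}"
  have finQ: "finite Q"
    by (rule finite_subset[of _ "{..<l} \<times> {..<l} \<times> {..<l} \<times> {..<l}"]) (auto simp: Q_def)
  define Bx where "Bx = (\<lambda>(j, i, j', i'). layer_box l j i \<times> layer_box l j' i')"
  define \<phi> where "\<phi> = (\<lambda>(j, i, j', i'). rep_pair j i j' i')"
  have \<phi>m: "\<phi> d \<in> rep_law l \<rightarrow>\<^sub>M borel" and \<phi>d: "distr (rep_law l) borel (\<phi> d) = uniform_on (Bx d)"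
    and Bfat: "has_uniform (Bx d)" and Bem: "emeasure lborel (Bx d) = ennreal (1 / real l ^ 4)" and Bsub: "Bx d \<subseteq> square2"
    if "d \<in> Q" for d
  proof -
    obtain j i j' i' where d: "d = (j, i, j', i')" by (cases d)
    have q: "j < l" "i < l" "j' < l" "i' < l" "j \<noteq> j'" using that by (auto simp: Q_def d)
    show "\<phi> d \<in> rep_law l \<rightarrow>\<^sub>M borel" using q rep_pair_measurable by (simp add: d \<phi>_def)
    show "distr (rep_law l) borel (\<phi> d) = uniform_on (Bx d)"
      using q distr_rep_pair[OF l] by (simp add: d \<phi>_def Bx_def)
    show "has_uniform (Bx d)" unfolding d Bx_def prod.case by (intro has_uniform_Times has_uniform_layer_box l)
    show "emeasure lborel (Bx d) = ennreal (1 / real l ^ 4)"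
      unfolding d Bx_def prod.case by (rule emeasure_layer_box_pair[OF l])
    show "Bx d \<subseteq> square2" using q layer_box_sub[OF l] unfolding d Bx_def prod.case by blast
  qed
  have disj: "disjoint_family_on Bx Q"
    unfolding disjoint_family_on_def
  proof (intro ballI impI)
    fix d e assume de: "d \<in> Q" "e \<in> Q" "d \<noteq> e"
    show "Bx d \<inter> Bx e = {}"
    proof (rule ccontr)
      assume "Bx d \<inter> Bx e \<noteq> {}"
      then obtain w where w: "w \<in> Bx d" "w \<in> Bx e" by blast
      obtain j i j' i' where d: "d = (j, i, j', i')" by (cases d)
      obtain k m k' m' where e: "e = (k, m, k', m')" by (cases e)
      have "fst w \<in> layer_box l j i" "snd w \<in> layer_box l j' i'" "fst w \<in> layer_box l k m" "snd w \<in> layer_box l k' m'"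
        using w unfolding d e Bx_def prod.case by (simp_all only: mem_Times_iff)
      then have "d = e" unfolding d e
        using layer_box_disjoint[OF l, of "fst w" j i k m] layer_box_disjoint[OF l, of "snd w" j' i' k' m'] by simp
      with de show False by simp
    qed
  qed
  define S where "S = (\<lambda>Y. \<Sum>d\<in>Q. ennreal (h (\<phi> d Y)))"
  have hm': "(\<lambda>p. ennreal (h p)) \<in> borel_measurable borel" using hm by simp
  have "(\<integral>\<^sup>+Y. S Y \<partial>rep_law l) = (\<Sum>d\<in>Q. \<integral>\<^sup>+Y. ennreal (h (\<phi> d Y)) \<partial>rep_law l)"
    unfolding S_def by (intro nn_integral_sum measurable_compose[OF \<phi>m hm'])
  also have "\<dots> = (\<Sum>d\<in>Q. \<integral>\<^sup>+p. ennreal (h p) \<partial>uniform_on (Bx d))"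
  proof (intro sum.cong refl)
    fix d assume d: "d \<in> Q"
    show "(\<integral>\<^sup>+Y. ennreal (h (\<phi> d Y)) \<partial>rep_law l) = (\<integral>\<^sup>+p. ennreal (h p) \<partial>uniform_on (Bx d))"
      unfolding \<phi>d[OF d, symmetric] by (rule nn_integral_distr[symmetric]) (use \<phi>m[OF d] hm in simp_all)
  qed
  also have "\<dots> = (\<Sum>d\<in>Q. (\<integral>\<^sup>+p. ennreal (h p) * indicator (Bx d) p \<partial>lborel) / ennreal (1 / real l ^ 4))"
  proof (intro sum.cong refl)
    fix d assume d: "d \<in> Q"
    show "(\<integral>\<^sup>+p. ennreal (h p) \<partial>uniform_on (Bx d)) = (\<integral>\<^sup>+p. ennreal (h p) * indicator (Bx d) p \<partial>lborel) / ennreal (1 / real l ^ 4)"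
      unfolding uniform_on_def Bem[OF d, symmetric]
      using Bfat[OF d] hm by (intro nn_integral_uniform_measure) (auto simp: has_uniform_def top.not_eq_extremum zero_less_iff_neq_zero)
  qed
  also have "\<dots> = (\<integral>\<^sup>+p. (\<Sum>d\<in>Q. ennreal (h p) * indicator (Bx d) p) \<partial>lborel) / ennreal (1 / real l ^ 4)"
  proof (subst nn_integral_sum)
    fix d assume d: "d \<in> Q"
    have "Bx d \<in> sets borel" using Bfat[OF d] by (simp add: has_uniform_def)
    then show "(\<lambda>p. ennreal (h p) * indicator (Bx d) p) \<in> borel_measurable lborel" using hm by simp
  qed (simp add: divide_ennreal_def sum_distrib_right)
  also have "\<dots> \<le> (\<integral>\<^sup>+p. ennreal (h p) * indicator square2 p \<partial>lborel) / ennreal (1 / real l ^ 4)"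
  proof (intro divide_right_mono_ennreal nn_integral_mono)
    fix p
    have "(\<Sum>d\<in>Q. indicator (Bx d) p) = (indicator (\<Union>(Bx ` Q)) p :: ennreal)"
      using indicator_UN_disjoint[OF finQ disj] by (rule sym)
    also have "\<dots> \<le> indicator square2 p"
    proof -
      have "p \<in> \<Union>(Bx ` Q) \<longrightarrow> p \<in> square2" using Bsub by blast
      then show ?thesis by (cases "p \<in> \<Union>(Bx ` Q)") simp_all
    qed
    finally show "(\<Sum>d\<in>Q. ennreal (h p) * indicator (Bx d) p) \<le> ennreal (h p) * indicator square2 p"
      by (simp add: sum_distrib_left[symmetric] mult_left_mono)
  qed
  also have "\<dots> \<le> ennreal \<eta> / ennreal (1 / real l ^ 4)" by (intro divide_right_mono_ennreal hint)
  also have "\<dots> = ennreal (\<eta> * real l ^ 4)" using l \<eta> by (simp add: divide_ennreal)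
  finally have ES: "(\<integral>\<^sup>+Y. S Y \<partial>rep_law l) \<le> ennreal (\<eta> * real l ^ 4)" .
  interpret W: prob_space "rep_law l" by (rule prob_space_rep_law[OF l])
  have nAE: "\<not> (AE Y in rep_law l. ennreal (2 * \<eta> * real l ^ 4) \<le> S Y)"
  proof
    assume "AE Y in rep_law l. ennreal (2 * \<eta> * real l ^ 4) \<le> S Y"
    then have "(\<integral>\<^sup>+Y. ennreal (2 * \<eta> * real l ^ 4) \<partial>rep_law l) \<le> (\<integral>\<^sup>+Y. S Y \<partial>rep_law l)"
      by (rule nn_integral_mono_AE)
    then have "ennreal (2 * \<eta> * real l ^ 4) \<le> (\<integral>\<^sup>+Y. S Y \<partial>rep_law l)"
      by (simp add: W.emeasure_space_1)
    with ES have "ennreal (2 * \<eta> * real l ^ 4) \<le> ennreal (\<eta> * real l ^ 4)" by (rule order_trans[rotated])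
    then show False using \<eta> l by (simp add: ennreal_le_iff)
  qed
  have c1: "AE Y in rep_law l. \<forall>j\<in>{..<l}. \<forall>k\<in>{..l}. Y j k \<in> (if k = 0 then cell l j else cell l (k - 1))"
  proof (intro AE_finite_allI finite_lessThan finite_atMost)
    fix j k assume jk: "j \<in> {..<l}" "k \<in> {..l}"
    let ?C = "\<lambda>k. if k = 0 then cell l j else cell l (k - 1)"
    have "AE r in uniform_on (?C k). r \<in> ?C k"
      by (subst AE_uniform_on) (auto intro: has_uniform_cell l)
    then have "AE y in strip_law l j. y k \<in> ?C k"
      unfolding strip_law_def using jk
      by (intro AE_PiM_component prob_space_uniform_on) (auto intro: has_uniform_cell l)
    then show "AE Y in rep_law l. Y j k \<in> ?C k"
      unfolding rep_law_def using jk
      by (intro AE_PiM_component[where P = "\<lambda>y. y k \<in> ?C k"] prob_space_strip_law l) auto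
  qed
  have c2: "AE Y in rep_law l. \<forall>d\<in>Q. Dn (\<phi> d Y)"
  proof (intro AE_finite_allI finQ)
    fix d assume d: "d \<in> Q"
    have "AE p in uniform_on (Bx d). Dn p"
      unfolding AE_uniform_on[OF Bfat[OF d]] using D by (rule eventually_mono) (rule impI)
    then have "AE p in distr (rep_law l) borel (\<phi> d). Dn p" by (simp only: \<phi>d[OF d])
    then show "AE Y in rep_law l. Dn (\<phi> d Y)" by (rule AE_distrD[OF \<phi>m[OF d]])
  qed
  have "\<exists>Y. (\<forall>j\<in>{..<l}. \<forall>k\<in>{..l}. Y j k \<in> (if k = 0 then cell l j else cell l (k - 1))) \<and>
     (\<forall>d\<in>Q. Dn (\<phi> d Y)) \<and> S Y \<le> ennreal (2 * \<eta> * real l ^ 4)"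
  proof (rule ccontr)
    assume neg: "\<not> ?thesis"
    from c1 c2 have "AE Y in rep_law l. ennreal (2 * \<eta> * real l ^ 4) \<le> S Y"
    proof eventually_elim
      case (elim Y)
      then have "\<not> S Y \<le> ennreal (2 * \<eta> * real l ^ 4)" using neg by blast
      then show ?case by simp
    qed
    with nAE show False by (rule notE)
  qed
  then obtain Y where Y1: "\<forall>j\<in>{..<l}. \<forall>k\<in>{..l}. Y j k \<in> (if k = 0 then cell l j else cell l (k - 1))"
    and Y2: "\<forall>d\<in>Q. Dn (\<phi> d Y)" and Y3: "S Y \<le> ennreal (2 * \<eta> * real l ^ 4)"
    by (elim exE conjE)
  have "S Y = ennreal (\<Sum>d\<in>Q. h (\<phi> d Y))" unfolding S_def by (intro sum_ennreal h0)
  then have S: "(\<Sum>d\<in>Q. h (\<phi> d Y)) \<le> 2 * \<eta> * real l ^ 4"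
    using Y3 \<eta> by (simp add: ennreal_le_iff)
  show ?thesis
  proof (intro exI[of _ "\<lambda>j. Y j 0"] exI[of _ "\<lambda>j i. Y j (Suc i)"] conjI allI impI)
    show "Y j 0 \<in> cell l j" if "j < l" for j using Y1[rule_format, of j 0] that by simp
    show "Y j (Suc i) \<in> cell l i" if "j < l" "i < l" for j i using Y1[rule_format, of j "Suc i"] that by simp
    show "Dn ((Y j 0, Y j (Suc i)), (Y j' 0, Y j' (Suc i')))" if "j < l" "j' < l" "i < l" "i' < l" "j \<noteq> j'" for j j' i i'
      using Y2[rule_format, of "(j, i, j', i')"] that by (simp add: Q_def \<phi>_def rep_pair_def)
    show "(\<Sum>(j, i, j', i') \<in> {(j, i, j', i'). j < l \<and> i < l \<and> j' < l \<and> i' < l \<and> j \<noteq> j'}.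
        h ((Y j 0, Y j (Suc i)), (Y j' 0, Y j' (Suc i')))) \<le> 2 * \<eta> * real l ^ 4"
      using S unfolding Q_def \<phi>_def rep_pair_def by (simp add: case_prod_unfold)
  qed
qed

section \<open>Layered step functions\<close>

lemma AE_hyperplane:
  fixes a :: "'a::euclidean_space"
  assumes "a \<noteq> 0"
  shows "AE p in lborel. a \<bullet> p \<noteq> b"
proof -
  have "AE p in lebesgue. p \<notin> {x. a \<bullet> x = b}"
    using negligible_hyperplane[of a b] assms by (intro AE_not_in) (simp add: negligible_iff_null_sets)
  then show ?thesis by (simp add: AE_completion_iff)
qed

text \<open>
  The pairs at which none of the step functions below has an ambiguous value.
\<close>
definition off_grid :: "nat \<Rightarrow> point \<times> point \<Rightarrow> bool" where
  "off_grid l = (\<lambda>((x, a), (y, b)). x \<noteq> y \<and> (\<forall>k\<in>{..l}. x \<noteq> real k / real l \<and> a \<noteq> real k / real l \<and> y \<noteq> real k / real l \<and> b \<noteq> real k / real l))"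

lemma AE_off_grid: "AE p in lborel. off_grid l p"
proof -
  have d: "AE p in lborel. ((1, 0), (-1, 0)) \<bullet> (p :: point \<times> point) \<noteq> 0"
    by (rule AE_hyperplane) (simp add: zero_prod_def)
  have "AE p in lborel. \<forall>k\<in>{..l}. ((1, 0), (0, 0)) \<bullet> (p :: point \<times> point) \<noteq> real k / real l"
    by (intro AE_finite_allI AE_hyperplane) (simp_all add: zero_prod_def)
  moreover have "AE p in lborel. \<forall>k\<in>{..l}. ((0, 1), (0, 0)) \<bullet> (p :: point \<times> point) \<noteq> real k / real l"
    by (intro AE_finite_allI AE_hyperplane) (simp_all add: zero_prod_def)
  moreover have "AE p in lborel. \<forall>k\<in>{..l}. ((0, 0), (1, 0)) \<bullet> (p :: point \<times> point) \<noteq> real k / real l"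
    by (intro AE_finite_allI AE_hyperplane) (simp_all add: zero_prod_def)
  moreover have "AE p in lborel. \<forall>k\<in>{..l}. ((0, 0), (0, 1)) \<bullet> (p :: point \<times> point) \<noteq> real k / real l"
    by (intro AE_finite_allI AE_hyperplane) (simp_all add: zero_prod_def)
  ultimately show ?thesis
    using d by eventually_elim (auto simp: off_grid_def)
qed

text \<open>
  The minimum only matters at the right end \<open>r = 1\<close> of the unit interval.
\<close>
definition cell_of :: "nat \<Rightarrow> real \<Rightarrow> nat" where
  "cell_of l r = min (l - 1) (nat \<lfloor>real l * r\<rfloor>)"

lemma cell_of_less: "0 < l \<Longrightarrow> cell_of l r < l"
  by (auto simp: cell_of_def)

lemma cell_of_eq: "0 < l \<Longrightarrow> k < l \<Longrightarrow> r \<in> cell l k \<Longrightarrow> cell_of l r = k"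
  using floor_cell[of l r k] by (simp add: cell_of_def)

lemma in_cell_of:
  assumes l: "0 < l" and r: "0 \<le> r" "r \<le> 1" and off: "\<forall>k\<in>{..l}. r \<noteq> real k / real l"
  shows "r \<in> cell l (cell_of l r)"
proof -
  have lr: "0 \<le> real l * r" "real l * r \<le> real l" using l r by (auto simp: mult_left_le)
  define k where "k = nat \<lfloor>real l * r\<rfloor>"
  have kr: "real k = of_int \<lfloor>real l * r\<rfloor>" using lr by (simp add: k_def)
  have k: "real k \<le> real l * r" "real l * r < real k + 1" unfolding kr by linarith+
  have kl: "k \<le> l" using k lr by linarith
  have "r \<noteq> real k / real l" using off kl by auto
  then have "real k \<noteq> real l * r" using l by (simp add: field_simps)
  then have k1: "real k < real l * r" using k by simp
  then have "k < l" using lr by linarith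
  then have "cell_of l r = k" by (simp add: cell_of_def k_def[symmetric])
  then show ?thesis using k k1 l by (simp add: cell_def field_simps)
qed

lemma closed_interval_cell:
  assumes l: "0 < l" and j: "j \<in> {1..l}" and r: "r \<in> {(real j - 1) / real l .. real j / real l}"
    and off: "\<forall>k\<in>{..l}. r \<noteq> real k / real l"
  shows "cell_of l r = j - 1"
proof -
  have rj: "real (j - 1) = real j - 1" using j by auto
  have "r \<noteq> real j / real l" using off[rule_format, of j] j by simp
  moreover have "j - 1 \<in> {..l}" using j by auto
  then have "r \<noteq> (real j - 1) / real l" using off[rule_format, of "j - 1"] unfolding rj by blast
  ultimately have "r \<in> cell l (j - 1)" using r unfolding cell_def rj greaterThanLessThan_iff atLeastAtMost_iff by (simp add: less_le)
  then show ?thesis using j l by (intro cell_of_eq) auto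
qed

lemma measurable_cell_of [measurable]: "cell_of l \<in> borel \<rightarrow>\<^sub>M count_space UNIV"
  unfolding cell_of_def by measurable

text \<open>
  The values inside a strip are given for the point with the smaller abscissa first, so the two
  branches for \<open>x < y\<close> and \<open>y < x\<close> make the function symmetric.
\<close>
definition layered :: "nat \<Rightarrow> (nat \<Rightarrow> nat \<Rightarrow> nat \<Rightarrow> nat \<Rightarrow> real) \<Rightarrow> (nat \<Rightarrow> nat \<Rightarrow> nat \<Rightarrow> real) \<Rightarrow> point \<times> point \<Rightarrow> real" where
  "layered l A c = (\<lambda>((x, a), (y, b)).
     if cell_of l x \<noteq> cell_of l y then A (cell_of l x) (cell_of l a) (cell_of l y) (cell_of l b)
     else if x < y then c (cell_of l x) (cell_of l a) (cell_of l b)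
     else if y < x then c (cell_of l x) (cell_of l b) (cell_of l a) else 0)"

lemma borel_coords [measurable]:
  "(\<lambda>p. fst (fst p)) \<in> borel_measurable (borel :: (point \<times> point) measure)"
  "(\<lambda>p. snd (fst p)) \<in> borel_measurable (borel :: (point \<times> point) measure)"
  "(\<lambda>p. fst (snd p)) \<in> borel_measurable (borel :: (point \<times> point) measure)"
  "(\<lambda>p. snd (snd p)) \<in> borel_measurable (borel :: (point \<times> point) measure)"
  by (intro borel_measurable_continuous_onI continuous_intros)+

lemma layered_borel: "layered l A c \<in> borel_measurable borel"
proof -
  define X1 where "X1 = (\<lambda>p :: point \<times> point. cell_of l (fst (fst p)))"
  define X2 where "X2 = (\<lambda>p :: point \<times> point. cell_of l (snd (fst p)))"
  define X3 where "X3 = (\<lambda>p :: point \<times> point. cell_of l (fst (snd p)))"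
  define X4 where "X4 = (\<lambda>p :: point \<times> point. cell_of l (snd (snd p)))"
  have m [measurable]: "X1 \<in> borel \<rightarrow>\<^sub>M count_space UNIV" "X2 \<in> borel \<rightarrow>\<^sub>M count_space UNIV"
    "X3 \<in> borel \<rightarrow>\<^sub>M count_space UNIV" "X4 \<in> borel \<rightarrow>\<^sub>M count_space UNIV"
    unfolding X1_def X2_def X3_def X4_def by (intro measurable_compose[OF _ measurable_cell_of] borel_coords)+
  have "(\<lambda>p. A i j k (X4 p)) \<in> borel_measurable borel" for i j k
    by (rule measurable_compose[OF m(4)]) simp
  note measurable_compose_countable[where f = "\<lambda>k p. A i j k (X4 p)" for i j, OF this m(3)]
  note measurable_compose_countable[where f = "\<lambda>j p. A i j (X3 p) (X4 p)" for i, OF this m(2)]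
  note A = measurable_compose_countable[where f = "\<lambda>i p. A i (X2 p) (X3 p) (X4 p)", OF this m(1)]
  have "(\<lambda>p. c i j (X4 p)) \<in> borel_measurable borel" for i j
    by (rule measurable_compose[OF m(4)]) simp
  note measurable_compose_countable[where f = "\<lambda>j p. c i j (X4 p)" for i, OF this m(2)]
  note c1 = measurable_compose_countable[where f = "\<lambda>i p. c i (X2 p) (X4 p)", OF this m(1)]
  have "(\<lambda>p. c i j (X2 p)) \<in> borel_measurable borel" for i j
    by (rule measurable_compose[OF m(2)]) simp
  note measurable_compose_countable[where f = "\<lambda>j p. c i j (X2 p)" for i, OF this m(4)]
  note c2 = measurable_compose_countable[where f = "\<lambda>i p. c i (X4 p) (X2 p)", OF this m(1)]
  have "Measurable.pred borel (\<lambda>p. X1 p = k)" for k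
    by (rule measurable_compose[OF m(1)]) simp
  note measurable_compose_countable[where f = "\<lambda>k p. X1 p = k", OF this m(3)]
  note eq = pred_intros_logic(2)[OF this]
  have "layered l A c = (\<lambda>p. if X1 p \<noteq> X3 p then A (X1 p) (X2 p) (X3 p) (X4 p)
     else if fst (fst p) < fst (snd p) then c (X1 p) (X2 p) (X4 p)
     else if fst (snd p) < fst (fst p) then c (X1 p) (X4 p) (X2 p) else 0)"
    unfolding layered_def X1_def X2_def X3_def X4_def case_prod_unfold ..
  also have "\<dots> \<in> borel_measurable borel"
    by (intro measurable_If[OF _ _ eq[unfolded pred_def]] measurable_If A c1 c2 borel_measurable_less borel_coords borel_measurable_const)
  finally show ?thesis .
qed

lemma layered_orderon:
  assumes l: "0 < l"
    and A01: "\<And>j i j' i'. 0 \<le> A j i j' i' \<and> A j i j' i' \<le> 1" and sym: "\<And>j i j' i'. A j i j' i' = A j' i' j i"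
    and c01: "\<And>j i i'. j < l \<Longrightarrow> i < l \<Longrightarrow> i' < l \<Longrightarrow> 0 \<le> c j i i' \<and> c j i i' \<le> 1"
  shows "orderon (layered l A c)"
proof -
  have "layered l A c \<in> borel_measurable lebesgue"
    using layered_borel by (intro measurable_completion) simp
  then have "layered l A c \<in> borel_measurable (lebesgue_on square2)"
    by (rule measurable_restrict_space1)
  moreover have "0 \<le> layered l A c (u, v) \<and> layered l A c (u, v) \<le> 1 \<and> layered l A c (u, v) = layered l A c (v, u)" for u v
    using A01 c01[OF cell_of_less[OF l] cell_of_less[OF l] cell_of_less[OF l]] sym[of "cell_of l (fst u)"]
    by (cases u; cases v) (simp add: layered_def)
  ultimately show ?thesis by (simp add: orderon_def)
qed

lemma ae_constant_onI:
  assumes "\<And>p. p \<in> S \<Longrightarrow> off_grid l p \<Longrightarrow> W p = c"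
  shows "ae_constant_on W S"
proof -
  have "AE p in lborel. p \<in> S \<longrightarrow> W p = c"
    using AE_off_grid[of l] by (rule eventually_mono) (use assms in blast)
  then have "AE p in lebesgue. p \<in> S \<longrightarrow> W p = c" by (rule AE_completion)
  then show ?thesis unfolding ae_constant_on_def by (rule exI)
qed

lemma off_gridD:
  assumes "off_grid l ((x, a), (y, b))"
  shows "\<forall>k\<in>{..l}. x \<noteq> real k / real l" "\<forall>k\<in>{..l}. a \<noteq> real k / real l"
    "\<forall>k\<in>{..l}. y \<noteq> real k / real l" "\<forall>k\<in>{..l}. b \<noteq> real k / real l"
  using assms unfolding off_grid_def prod.case by blast+

lemma strip_layer_box_cells:
  assumes "0 < l" "j \<in> {1..l}" "i \<in> {1..l}" "j' \<in> {1..l}" "i' \<in> {1..l}"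
    and "(x, a) \<in> strip_layer_box l l j i" "(y, b) \<in> strip_layer_box l l j' i'" "off_grid l ((x, a), (y, b))"
  shows "cell_of l x = j - 1" "cell_of l a = i - 1" "cell_of l y = j' - 1" "cell_of l b = i' - 1"
proof -
  show "cell_of l x = j - 1"
    using assms(6) by (intro closed_interval_cell[OF assms(1,2) _ off_gridD(1)[OF assms(8)]]) (simp add: strip_layer_box_def)
  show "cell_of l a = i - 1"
    using assms(6) by (intro closed_interval_cell[OF assms(1,3) _ off_gridD(2)[OF assms(8)]]) (simp add: strip_layer_box_def)
  show "cell_of l y = j' - 1"
    using assms(7) by (intro closed_interval_cell[OF assms(1,4) _ off_gridD(3)[OF assms(8)]]) (simp add: strip_layer_box_def)
  show "cell_of l b = i' - 1"
    using assms(7) by (intro closed_interval_cell[OF assms(1,5) _ off_gridD(4)[OF assms(8)]]) (simp add: strip_layer_box_def)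
qed

lemma layered_strip_layered:
  assumes l: "0 < l"
    and A01: "\<And>j i j' i'. 0 \<le> A j i j' i' \<and> A j i j' i' \<le> 1" and sym: "\<And>j i j' i'. A j i j' i' = A j' i' j i"
    and c01: "\<And>j i i'. j < l \<Longrightarrow> i < l \<Longrightarrow> i' < l \<Longrightarrow> 0 \<le> c j i i' \<and> c j i i' \<le> 1"
  shows "strip_layered l l (layered l A c)"
  unfolding strip_layered_def
proof (intro conjI ballI impI)
  show "orderon (layered l A c)" by (rule layered_orderon[OF l A01 sym c01])
  show "0 < l" "0 < l" by fact+
next
  fix j j' i i' assume ji: "j \<in> {1..l}" "j' \<in> {1..l}" "i \<in> {1..l}" "i' \<in> {1..l}"
  have box: "cell_of l x = j - 1" "cell_of l a = i - 1" "cell_of l y = j' - 1" "cell_of l b = i' - 1"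
    if "(x, a) \<in> strip_layer_box l l j i" "(y, b) \<in> strip_layer_box l l j' i'" "off_grid l ((x, a), (y, b))" for x a y b
    using strip_layer_box_cells[OF l ji(1,3,2,4) that] by simp_all
  show "ae_constant_on (layered l A c) (strip_layer_box l l j i \<times> strip_layer_box l l j' i')" if "j \<noteq> j'"
  proof (rule ae_constant_onI[where c = "A (j - 1) (i - 1) (j' - 1) (i' - 1)"])
    fix p assume p: "p \<in> strip_layer_box l l j i \<times> strip_layer_box l l j' i'" "off_grid l p"
    obtain x a y b where pp: "p = ((x, a), (y, b))" by (cases p; cases "fst p"; cases "snd p") auto
    have "j - 1 \<noteq> j' - 1" using that ji by auto
    then show "layered l A c p = A (j - 1) (i - 1) (j' - 1) (i' - 1)"
      using box[of x a y b] p by (simp add: pp layered_def)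
  qed
next
  fix j i i' assume ji: "j \<in> {1..l}" "i \<in> {1..l}" "i' \<in> {1..l}"
  have box: "cell_of l x = j - 1" "cell_of l a = i - 1" "cell_of l y = j - 1" "cell_of l b = i' - 1"
    if "(x, a) \<in> strip_layer_box l l j i" "(y, b) \<in> strip_layer_box l l j i'" "off_grid l ((x, a), (y, b))" for x a y b
    using strip_layer_box_cells[OF l ji(1,2,1,3) that] by simp_all
  show "ae_constant_on (layered l A c) {((x, a), (y, b)). (x, a) \<in> strip_layer_box l l j i \<and> (y, b) \<in> strip_layer_box l l j i' \<and> x < y}"
    by (rule ae_constant_onI[where c = "c (j - 1) (i - 1) (i' - 1)" and l = l]) (auto simp: layered_def box)
  show "ae_constant_on (layered l A c) {((x, a), (y, b)). (x, a) \<in> strip_layer_box l l j i \<and> (y, b) \<in> strip_layer_box l l j i' \<and> y < x}"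
    by (rule ae_constant_onI[where c = "c (j - 1) (i' - 1) (i - 1)" and l = l]) (auto simp: layered_def box)
qed

section \<open>Interleaving automorphisms of the square\<close>

text \<open>
  A Lebesgue set differs from a Borel set by a subset of a Borel null set, and the preimage of
  that null set is null; so it is enough to test the measure on Borel sets.
\<close>
lemma measure_preserving_borelI:
  fixes f :: "point \<Rightarrow> point"
  assumes fm: "f \<in> borel \<rightarrow>\<^sub>M borel" and fs: "\<And>u. u \<in> unit_square \<Longrightarrow> f u \<in> unit_square"
    and mp: "\<And>A. A \<in> sets borel \<Longrightarrow> A \<subseteq> unit_square \<Longrightarrow> emeasure lborel (f -` A \<inter> unit_square) = emeasure lborel A"
  shows "measure_preserving_on_square f"
proof -
  have us: "unit_square \<in> sets borel" by (simp add: unit_square_cbox)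
  have usl: "unit_square \<in> sets lebesgue" using us by (simp add: unit_square_cbox)
  have key: "f -` A \<inter> unit_square \<in> sets lebesgue \<and> emeasure lebesgue (f -` A \<inter> unit_square) = emeasure lebesgue A"
    if A: "A \<in> sets lebesgue" "A \<subseteq> unit_square" for A
  proof -
    obtain B N N' where B: "B \<in> sets lborel" "N' \<in> null_sets lborel" "N \<subseteq> N'" "A = B \<union> N"
      using A(1) by (rule sets_completionE) auto
    have Bs: "B \<subseteq> unit_square" using B A by auto
    have preB: "f -` B \<inter> unit_square \<in> sets borel"
      using measurable_sets[OF fm, of B] B us by (auto simp: space_borel)
    have preN: "f -` (N' \<inter> unit_square) \<inter> unit_square \<in> null_sets lborel"
    proof -
      have "N' \<inter> unit_square \<in> null_sets lborel" using B us by (intro null_set_Int2) simp_all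
      then have "emeasure lborel (f -` (N' \<inter> unit_square) \<inter> unit_square) = 0"
        by (subst mp) (auto simp: null_sets_def)
      moreover have "f -` (N' \<inter> unit_square) \<inter> unit_square \<in> sets borel"
        using measurable_sets[OF fm, of "N' \<inter> unit_square"] B us by (auto simp: space_borel null_sets_def)
      ultimately show ?thesis by (simp add: null_sets_def)
    qed
    have sub: "f -` N \<inter> unit_square \<subseteq> f -` (N' \<inter> unit_square) \<inter> unit_square"
      using B fs by auto
    have n1: "f -` N \<inter> unit_square \<in> null_sets lebesgue"
      by (rule null_sets_completion_subset[OF sub null_sets_completionI[OF preN]])
    have n2: "N \<in> null_sets lebesgue"
      using B by (intro null_sets_completion_subset[OF B(3) null_sets_completionI])
    have eq: "f -` A \<inter> unit_square = (f -` B \<inter> unit_square) \<union> (f -` N \<inter> unit_square)"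
      using B by auto
    have Bl: "f -` B \<inter> unit_square \<in> sets lebesgue" "B \<in> sets lebesgue"
      using preB B by auto
    have "emeasure lebesgue (f -` A \<inter> unit_square) = emeasure lebesgue (f -` B \<inter> unit_square)"
      unfolding eq by (rule emeasure_Un_null_set[OF Bl(1) n1])
    also have "\<dots> = emeasure lborel (f -` B \<inter> unit_square)" using preB by simp
    also have "\<dots> = emeasure lborel B" using B(1) Bs by (intro mp) simp_all
    also have "\<dots> = emeasure lebesgue B" using B(1) by simp
    also have "\<dots> = emeasure lebesgue A"
      unfolding B(4) by (rule emeasure_Un_null_set[OF Bl(2) n2, symmetric])
    finally show ?thesis
      unfolding eq using sets.Un[OF Bl(1) null_setsD2[OF n1]] by (rule conjI[rotated])
  qed
  have sp: "space (lebesgue_on unit_square) = unit_square" by (simp add: space_restrict_space)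
  have sets_on: "A \<in> sets (lebesgue_on unit_square) \<longleftrightarrow> A \<in> sets lebesgue \<and> A \<subseteq> unit_square" for A
    using usl by (simp add: sets_restrict_space_iff conj_commute)
  have fm': "f \<in> lebesgue_on unit_square \<rightarrow>\<^sub>M lebesgue_on unit_square"
    by (rule measurableI) (use fs key sp sets_on in auto)
  moreover have "distr (lebesgue_on unit_square) (lebesgue_on unit_square) f = lebesgue_on unit_square"
  proof (rule measure_eqI)
    fix A assume "A \<in> sets (distr (lebesgue_on unit_square) (lebesgue_on unit_square) f)"
    then have A: "A \<in> sets (lebesgue_on unit_square)" by simp
    then have A': "A \<in> sets lebesgue" "A \<subseteq> unit_square" by (simp_all add: sets_on)
    have "emeasure (distr (lebesgue_on unit_square) (lebesgue_on unit_square) f) A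
        = emeasure (lebesgue_on unit_square) (f -` A \<inter> unit_square)"
      using fm' A by (simp add: emeasure_distr sp)
    also have "\<dots> = emeasure lebesgue (f -` A \<inter> unit_square)"
      by (rule emeasure_restrict_space) (use usl in auto)
    also have "\<dots> = emeasure lebesgue A" using key[OF A'] by simp
    also have "\<dots> = emeasure (lebesgue_on unit_square) A"
      by (rule emeasure_restrict_space[symmetric]) (use usl A' in auto)
    finally show "emeasure (distr (lebesgue_on unit_square) (lebesgue_on unit_square) f) A = emeasure (lebesgue_on unit_square) A" .
  qed simp
  ultimately show ?thesis by (simp add: measure_preserving_on_square_def)
qed

lemma measure_preserving_on_square_cong:
  assumes "measure_preserving_on_square f" "\<And>u. u \<in> unit_square \<Longrightarrow> f u = g u"
  shows "measure_preserving_on_square g"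
proof -
  have sp: "space (lebesgue_on unit_square) = unit_square" by (simp add: space_restrict_space)
  have "g \<in> lebesgue_on unit_square \<rightarrow>\<^sub>M lebesgue_on unit_square"
    using assms sp by (subst measurable_cong[of _ _ f]) (auto simp: measure_preserving_on_square_def)
  moreover have "distr (lebesgue_on unit_square) (lebesgue_on unit_square) g = distr (lebesgue_on unit_square) (lebesgue_on unit_square) f"
    using assms sp by (intro distr_cong) auto
  ultimately show ?thesis using assms(1) by (simp add: measure_preserving_on_square_def)
qed

lemma square_automorphismI:
  assumes fm: "f \<in> borel \<rightarrow>\<^sub>M borel" and gm: "g \<in> borel \<rightarrow>\<^sub>M borel"
    and fs: "\<And>u. u \<in> unit_square \<Longrightarrow> f u \<in> unit_square" and gs: "\<And>u. u \<in> unit_square \<Longrightarrow> g u \<in> unit_square"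
    and gf: "\<And>u. u \<in> unit_square \<Longrightarrow> g (f u) = u" and fg: "\<And>u. u \<in> unit_square \<Longrightarrow> f (g u) = u"
    and mp: "\<And>A. A \<in> sets borel \<Longrightarrow> A \<subseteq> unit_square \<Longrightarrow> emeasure lborel (f -` A \<inter> unit_square) = emeasure lborel A"
  shows "f \<in> square_automorphisms"
proof -
  have us: "unit_square \<in> sets borel" by (simp add: unit_square_cbox)
  have bij: "bij_betw f unit_square unit_square"
    by (rule bij_betw_byWitness[where f' = g]) (use fs gs fg gf in auto)
  have inv: "inv_into unit_square f u = g u" if "u \<in> unit_square" for u
    using inv_into_f_f[OF bij_betw_imp_inj_on[OF bij] gs[OF that]] fg[OF that] by simp
  have "measure_preserving_on_square g"
  proof (rule measure_preserving_borelI[OF gm gs])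
    fix A :: "point set" assume A: "A \<in> sets borel" "A \<subseteq> unit_square"
    let ?B = "g -` A \<inter> unit_square"
    have B: "?B \<in> sets borel" using measurable_sets[OF gm A(1)] us by (auto simp: space_borel)
    have "f -` ?B \<inter> unit_square = A"
    proof (intro set_eqI iffI)
      fix u assume "u \<in> f -` ?B \<inter> unit_square"
      then show "u \<in> A" using gf[of u] by simp
    next
      fix u assume "u \<in> A"
      moreover from this have "u \<in> unit_square" using A by blast
      ultimately show "u \<in> f -` ?B \<inter> unit_square" using gf[of u] fs[of u] by simp
    qed
    then show "emeasure lborel ?B = emeasure lborel A" using mp[OF B] by simp
  qed
  then have "measure_preserving_on_square (inv_into unit_square f)"
    by (rule measure_preserving_on_square_cong) (simp add: inv)
  then show ?thesis
    using bij measure_preserving_borelI[OF fm fs mp] by (simp add: square_automorphisms_def)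
qed

text \<open>
  The map has determinant one.
\<close>
lemma distr_lborel_stretch:
  fixes c s t :: real
  assumes c: "0 < c"
  shows "distr lborel borel (\<lambda>u::point. (s + c * fst u, t + snd u / c)) = lborel"
proof -
  define d where "d = (\<lambda>b::point. if b = (1, 0) then c else 1 / c)"
  have T: "(\<lambda>u::point. (s, t) + (\<Sum>b\<in>Basis. (d b * (u \<bullet> b)) *\<^sub>R b)) = (\<lambda>u. (s + c * fst u, t + snd u / c))"
    by (auto simp: d_def Basis_prod_def fun_eq_iff)
  have "lborel = density (distr lborel borel (\<lambda>u::point. (s, t) + (\<Sum>b\<in>Basis. (d b * (u \<bullet> b)) *\<^sub>R b))) (\<lambda>_. (\<Prod>b\<in>Basis. \<bar>d b\<bar>))"
    by (rule lborel_affine_euclidean) (use c in \<open>auto simp: d_def\<close>)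
  also have "(\<Prod>b\<in>Basis. \<bar>d b\<bar>) = 1" using c by (simp add: d_def Basis_prod_def)
  finally show ?thesis unfolding T by (simp add: density_1)
qed


definition half_open_square :: "point set" where
  "half_open_square = {0..<1} \<times> {0..<1}"

text \<open>
  Cut the square into \<open>k * l\<close> vertical slices. The \<open>l\<close> slices with numbers \<open>b * l + i\<close> for
  \<open>i < l\<close> form the column with number \<open>b\<close>; each of them is stretched to the full width of the
  column and pressed down to height \<open>1 / l\<close>, and they are stacked as horizontal layers. This
  carries the slices of consecutive vertices of a graph to the layers of one column. Half-open
  pieces make it a bijection; the right and upper sides of the square stay fixed.
\<close>
definition interleave :: "nat \<Rightarrow> nat \<Rightarrow> point \<Rightarrow> point" where
  "interleave k l u = (if u \<in> half_open_square
     then let p = nat \<lfloor>real (k * l) * fst u\<rfloor>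
       in (real (p div l) / real k + real l * (fst u - real p / real (k * l)), (real (p mod l) + snd u) / real l)
     else u)"

definition deinterleave :: "nat \<Rightarrow> nat \<Rightarrow> point \<Rightarrow> point" where
  "deinterleave k l u = (if u \<in> half_open_square
     then let b = nat \<lfloor>real k * fst u\<rfloor>; i = nat \<lfloor>real l * snd u\<rfloor>
       in (real (b * l + i) / real (k * l) + (fst u - real b / real k) / real l, real l * snd u - real i)
     else u)"

lemma half_open_iff: "u \<in> half_open_square \<longleftrightarrow> 0 \<le> fst u \<and> fst u < 1 \<and> 0 \<le> snd u \<and> snd u < 1"
  by (auto simp: half_open_square_def mem_Times_iff)

lemma half_open_sub: "half_open_square \<subseteq> unit_square"
  by (auto simp: half_open_square_def unit_square_def)

lemma nat_floor_scaled:
  assumes "0 < n" "0 \<le> x" "x < 1"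
  shows "nat \<lfloor>real n * x\<rfloor> < n" "real (nat \<lfloor>real n * x\<rfloor>) \<le> real n * x" "real n * x < real (nat \<lfloor>real n * x\<rfloor>) + 1"
proof -
  have 0: "0 \<le> real n * x" "real n * x < real n" using assms by auto
  then have *: "real (nat \<lfloor>real n * x\<rfloor>) = of_int \<lfloor>real n * x\<rfloor>" by simp
  show 1: "real (nat \<lfloor>real n * x\<rfloor>) \<le> real n * x" "real n * x < real (nat \<lfloor>real n * x\<rfloor>) + 1"
    unfolding * by linarith+
  have "real (nat \<lfloor>real n * x\<rfloor>) < real n" using 0 1(1) by linarith
  then show "nat \<lfloor>real n * x\<rfloor> < n" by simp
qed

lemma nat_floorI: "real m \<le> y \<Longrightarrow> y < real m + 1 \<Longrightarrow> nat \<lfloor>y\<rfloor> = m"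
  by (simp add: floor_eq_iff nat_eq_iff)

text \<open>
  In these scaled coordinates the integer parts are the new column and layer, and the fractional
  parts are the position within the old slice.
\<close>
lemma interleave_coords:
  assumes kl: "0 < k" "0 < l" and u: "u \<in> half_open_square"
  defines "p \<equiv> nat \<lfloor>real (k * l) * fst u\<rfloor>"
  shows "real k * fst (interleave k l u) = real (p div l) + (real (k * l) * fst u - real p)"
    and "real l * snd (interleave k l u) = real (p mod l) + snd u"
    and "interleave k l u \<in> half_open_square"
    and "nat \<lfloor>real k * fst (interleave k l u)\<rfloor> = p div l"
    and "nat \<lfloor>real l * snd (interleave k l u)\<rfloor> = p mod l"
proof -
  have x: "0 \<le> fst u" "fst u < 1" "0 \<le> snd u" "snd u < 1" using u by (auto simp: half_open_iff)
  have N: "0 < k * l" using kl by simp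
  note p = nat_floor_scaled[OF N x(1,2), folded p_def]
  have f: "interleave k l u = (real (p div l) / real k + real l * (fst u - real p / real (k * l)), (real (p mod l) + snd u) / real l)"
    using u by (simp add: interleave_def Let_def p_def)
  show 1: "real k * fst (interleave k l u) = real (p div l) + (real (k * l) * fst u - real p)"
    using kl unfolding f by (simp add: field_simps)
  show 2: "real l * snd (interleave k l u) = real (p mod l) + snd u"
    using kl unfolding f by simp
  show 3: "nat \<lfloor>real k * fst (interleave k l u)\<rfloor> = p div l"
    using p by (intro nat_floorI) (simp_all add: 1)
  show 4: "nat \<lfloor>real l * snd (interleave k l u)\<rfloor> = p mod l"
    using x by (intro nat_floorI) (simp_all add: 2)
  have "p div l < k" using p(1) by (simp add: less_mult_imp_div_less)
  then have "real (p div l) + 1 \<le> real k" by linarith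
  then have "0 \<le> real k * fst (interleave k l u)" "real k * fst (interleave k l u) < real k * 1"
    unfolding 1 using p by linarith+
  then have a: "0 \<le> fst (interleave k l u)" "fst (interleave k l u) < 1"
    using kl by (simp_all add: zero_le_mult_iff)
  have "p mod l < l" using kl by simp
  then have "real (p mod l) + 1 \<le> real l" by linarith
  then have "0 \<le> real l * snd (interleave k l u)" "real l * snd (interleave k l u) < real l * 1"
    unfolding 2 using x by linarith+
  then have b: "0 \<le> snd (interleave k l u)" "snd (interleave k l u) < 1"
    using kl by (simp_all add: zero_le_mult_iff)
  show "interleave k l u \<in> half_open_square" using a b by (simp add: half_open_iff)
qed

lemma deinterleave_coords:
  assumes kl: "0 < k" "0 < l" and u: "u \<in> half_open_square"
  defines "b \<equiv> nat \<lfloor>real k * fst u\<rfloor>" and "i \<equiv> nat \<lfloor>real l * snd u\<rfloor>"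
  shows "real (k * l) * fst (deinterleave k l u) = real (b * l + i) + (real k * fst u - real b)"
    and "snd (deinterleave k l u) = real l * snd u - real i"
    and "deinterleave k l u \<in> half_open_square"
    and "nat \<lfloor>real (k * l) * fst (deinterleave k l u)\<rfloor> = b * l + i"
    and "i < l"
proof -
  have x: "0 \<le> fst u" "fst u < 1" "0 \<le> snd u" "snd u < 1" using u by (auto simp: half_open_iff)
  note b = nat_floor_scaled[OF kl(1) x(1,2), folded b_def]
  note i = nat_floor_scaled[OF kl(2) x(3,4), folded i_def]
  have f: "deinterleave k l u = (real (b * l + i) / real (k * l) + (fst u - real b / real k) / real l, real l * snd u - real i)"
    using u by (simp add: deinterleave_def Let_def b_def i_def)
  show 1: "real (k * l) * fst (deinterleave k l u) = real (b * l + i) + (real k * fst u - real b)"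
    using kl unfolding f by (simp add: field_simps)
  show 2: "snd (deinterleave k l u) = real l * snd u - real i" unfolding f by simp
  show 3: "nat \<lfloor>real (k * l) * fst (deinterleave k l u)\<rfloor> = b * l + i"
    using b unfolding 1 by (intro nat_floorI) linarith+
  show "i < l" by (rule i)
  have "b * l + i < Suc b * l" using i by simp
  also have "\<dots> \<le> k * l" using b by (intro mult_le_mono1) simp
  finally have "real (b * l + i) + 1 \<le> real (k * l)" by linarith
  then have "0 \<le> real (k * l) * fst (deinterleave k l u)" "real (k * l) * fst (deinterleave k l u) < real (k * l) * 1"
    unfolding 1 using b by linarith+
  moreover have "0 < real (k * l)" using kl by simp
  ultimately have a: "0 \<le> fst (deinterleave k l u)" "fst (deinterleave k l u) < 1"
    by (simp_all only: zero_le_mult_iff mult_less_cancel_left_pos) auto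
  show "deinterleave k l u \<in> half_open_square" using a i by (simp add: half_open_iff 2)
qed

lemma deinterleave_interleave:
  assumes kl: "0 < k" "0 < l"
  shows "deinterleave k l (interleave k l u) = u"
proof (cases "u \<in> half_open_square")
  case False
  then show ?thesis by (simp add: interleave_def deinterleave_def)
next
  case True
  define p where "p = nat \<lfloor>real (k * l) * fst u\<rfloor>"
  note c = interleave_coords[OF kl True, folded p_def]
  note d = deinterleave_coords[OF kl c(3), unfolded c(4) c(5)]
  have "real (k * l) * fst (deinterleave k l (interleave k l u)) = real (k * l) * fst u"
    unfolding d(1) c(1) by (simp only: div_mult_mod_eq)
  then have "fst (deinterleave k l (interleave k l u)) = fst u" using kl by simp
  moreover have "snd (deinterleave k l (interleave k l u)) = snd u" unfolding d(2) c(2) by simp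
  ultimately show ?thesis by (rule prod_eqI)
qed

lemma interleave_deinterleave:
  assumes kl: "0 < k" "0 < l"
  shows "interleave k l (deinterleave k l u) = u"
proof (cases "u \<in> half_open_square")
  case False
  then show ?thesis by (simp add: interleave_def deinterleave_def)
next
  case True
  define b where "b = nat \<lfloor>real k * fst u\<rfloor>"
  define i where "i = nat \<lfloor>real l * snd u\<rfloor>"
  note d = deinterleave_coords[OF kl True, folded b_def i_def]
  have bi: "(b * l + i) div l = b" "(b * l + i) mod l = i" using d(5) by auto
  note c = interleave_coords[OF kl d(3), unfolded d(4) bi]
  have "real k * fst (interleave k l (deinterleave k l u)) = real k * fst u"
    unfolding c(1) d(1) by simp
  then have "fst (interleave k l (deinterleave k l u)) = fst u" using kl by simp
  moreover have "real l * snd (interleave k l (deinterleave k l u)) = real l * snd u"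
    unfolding c(2) d(2) by simp
  then have "snd (interleave k l (deinterleave k l u)) = snd u" using kl by simp
  ultimately show ?thesis by (rule prod_eqI)
qed


lemma borel_fst_snd:
  "(fst :: point \<Rightarrow> real) \<in> borel_measurable borel" "(snd :: point \<Rightarrow> real) \<in> borel_measurable borel"
  by (intro borel_measurable_continuous_onI continuous_intros)+

lemma half_open_borel: "half_open_square \<in> sets borel"
  unfolding half_open_square_def by (intro borel_Times) simp_all

lemma borel_of_nat_floor:
  fixes h :: "point \<Rightarrow> real" and q :: "nat \<Rightarrow> nat"
  assumes "h \<in> borel_measurable borel"
  shows "(\<lambda>u. real (q (nat \<lfloor>h u\<rfloor>))) \<in> borel_measurable borel"
proof -
  have "(\<lambda>u. nat \<lfloor>h u\<rfloor>) \<in> borel \<rightarrow>\<^sub>M count_space UNIV"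
    using assms by measurable
  from measurable_compose[OF this, of "\<lambda>p. real (q p)" borel] show ?thesis by simp
qed

lemma borel_PairI:
  fixes f g :: "point \<Rightarrow> real"
  assumes "f \<in> borel_measurable borel" "g \<in> borel_measurable borel"
  shows "(\<lambda>u. (f u, g u)) \<in> borel \<rightarrow>\<^sub>M (borel :: point measure)"
proof -
  have "(\<lambda>u. (f u, g u)) \<in> borel \<rightarrow>\<^sub>M borel \<Otimes>\<^sub>M borel" using assms by (intro measurable_Pair)
  then show ?thesis by (simp only: borel_prod)
qed

lemma interleave_borel: "interleave k l \<in> borel \<rightarrow>\<^sub>M borel"
proof -
  let ?p = "\<lambda>u::point. nat \<lfloor>real (k * l) * fst u\<rfloor>"
  have m: "(\<lambda>u::point. real (k * l) * fst u) \<in> borel_measurable borel"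
    using borel_fst_snd by (intro borel_measurable_times borel_measurable_const)
  note b = borel_of_nat_floor[OF m, of "\<lambda>p. p div l"] borel_of_nat_floor[OF m, of "\<lambda>p. p mod l"] borel_of_nat_floor[OF m, of "\<lambda>p. p"]
  have 1: "(\<lambda>u. (real (?p u div l) / real k + real l * (fst u - real (?p u) / real (k * l)), (real (?p u mod l) + snd u) / real l)) \<in> borel \<rightarrow>\<^sub>M borel"
    by (intro borel_PairI borel_measurable_add borel_measurable_divide borel_measurable_times borel_measurable_diff borel_measurable_const b borel_fst_snd)
  have "{u \<in> space borel. u \<in> half_open_square} \<in> sets borel" using half_open_borel by simp
  from measurable_If[OF 1 measurable_ident this] show ?thesis
    unfolding interleave_def Let_def id_def .
qed

lemma deinterleave_borel: "deinterleave k l \<in> borel \<rightarrow>\<^sub>M borel"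
proof -
  let ?b = "\<lambda>u::point. nat \<lfloor>real k * fst u\<rfloor>" and ?i = "\<lambda>u::point. nat \<lfloor>real l * snd u\<rfloor>"
  have m: "(\<lambda>u::point. real k * fst u) \<in> borel_measurable borel" "(\<lambda>u::point. real l * snd u) \<in> borel_measurable borel"
    using borel_fst_snd by (intro borel_measurable_times borel_measurable_const; simp)+
  note b = borel_of_nat_floor[OF m(1), of "\<lambda>p. p"] borel_of_nat_floor[OF m(2), of "\<lambda>p. p"]
  have 1: "(\<lambda>u. ((real (?b u) * real l + real (?i u)) / real (k * l) + (fst u - real (?b u) / real k) / real l, real l * snd u - real (?i u))) \<in> borel \<rightarrow>\<^sub>M borel"
    by (intro borel_PairI borel_measurable_add borel_measurable_divide borel_measurable_times borel_measurable_diff borel_measurable_const b borel_fst_snd)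
  have "{u \<in> space borel. u \<in> half_open_square} \<in> sets borel" using half_open_borel by simp
  from measurable_If[OF 1 measurable_ident this] show ?thesis
    unfolding deinterleave_def Let_def id_def of_nat_add of_nat_mult .
qed

lemma emeasure_half_open:
  assumes "A \<in> sets borel" "A \<subseteq> unit_square"
  shows "emeasure lborel (A \<inter> half_open_square) = emeasure lborel A"
proof (rule emeasure_eq_AE)
  have "AE u in lborel. (1, 0) \<bullet> (u :: point) \<noteq> 1" "AE u in lborel. (0, 1) \<bullet> (u :: point) \<noteq> 1"
    by (rule AE_hyperplane, simp add: zero_prod_def)+
  then show "AE u in lborel. (u \<in> A \<inter> half_open_square) = (u \<in> A)"
  proof eventually_elim
    case (elim u)
    then have "fst u \<noteq> 1" "snd u \<noteq> 1" by (cases u; simp)+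
    then show ?case using assms(2) by (auto simp: half_open_iff unit_square_def)
  qed
qed (use assms half_open_borel in auto)

text \<open>
  On the slice \<open>V p\<close> the map is the measure preserving affine map \<open>T p\<close>, which carries the slice
  onto the box \<open>W p\<close>. The slices and the boxes both partition the half-open square.
\<close>
lemma interleave_measure_preserving:
  assumes kl: "0 < k" "0 < l" and A: "A \<in> sets borel" "A \<subseteq> unit_square"
  shows "emeasure lborel (interleave k l -` A \<inter> unit_square) = emeasure lborel A"
proof -
  let ?f = "interleave k l" and ?N = "k * l" and ?H = half_open_square
  have N: "0 < ?N" using kl by simp
  define V where "V = (\<lambda>p. {u \<in> ?H. nat \<lfloor>real ?N * fst u\<rfloor> = p})"
  define W where "W = (\<lambda>p. {u \<in> ?H. nat \<lfloor>real k * fst u\<rfloor> = p div l \<and> nat \<lfloor>real l * snd u\<rfloor> = p mod l})"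
  define T where "T = (\<lambda>p (u :: point). ((real (p div l) / real k - real l * (real p / real ?N)) + real l * fst u, real (p mod l) / real l + snd u / real l))"
  have fl: "{u :: point. nat \<lfloor>h u\<rfloor> = m} \<in> sets borel" if "h \<in> borel_measurable borel" for h :: "point \<Rightarrow> real" and m
  proof -
    have "(\<lambda>u. nat \<lfloor>h u\<rfloor>) \<in> borel \<rightarrow>\<^sub>M count_space UNIV" using that by measurable
    from measurable_sets[OF this, of "{m}"] show ?thesis by (simp add: vimage_def)
  qed
  have lin: "(\<lambda>u::point. c * fst u) \<in> borel_measurable borel" "(\<lambda>u::point. c * snd u) \<in> borel_measurable borel" for c
    using borel_fst_snd by (intro borel_measurable_times borel_measurable_const; simp)+
  have Vb: "V p \<in> sets borel" for p
    using sets.Int[OF half_open_borel fl[OF lin(1)]] by (simp add: V_def Int_def)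
  have Wb: "W p \<in> sets borel" for p
    using sets.Int[OF half_open_borel sets.Int[OF fl[OF lin(1)] fl[OF lin(2)]]] by (simp add: W_def Int_def)
  have Tb: "T p \<in> borel \<rightarrow>\<^sub>M borel" for p
    unfolding T_def
    by (intro borel_PairI borel_measurable_add borel_measurable_divide borel_measurable_times borel_measurable_const borel_fst_snd)
  have fT: "?f u = T p u" if "u \<in> V p" for u p
    using that by (auto simp: V_def interleave_def T_def Let_def add_divide_distrib right_diff_distrib)
  have pre: "V p \<inter> ?f -` A = T p -` (W p \<inter> A)" if p: "p < ?N" for p
  proof (intro set_eqI iffI)
    fix u assume u: "u \<in> V p \<inter> ?f -` A"
    then have "u \<in> ?H" "nat \<lfloor>real ?N * fst u\<rfloor> = p" by (auto simp: V_def)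
    from interleave_coords(3-5)[OF kl this(1), unfolded this(2)] have "?f u \<in> W p" by (simp add: W_def)
    then show "u \<in> T p -` (W p \<inter> A)" using u fT[of u p] by simp
  next
    fix u assume "u \<in> T p -` (W p \<inter> A)"
    then have TW: "T p u \<in> ?H" "nat \<lfloor>real k * fst (T p u)\<rfloor> = p div l" "nat \<lfloor>real l * snd (T p u)\<rfloor> = p mod l" and TA: "T p u \<in> A"
      by (auto simp: W_def)
    have t: "0 \<le> fst (T p u)" "fst (T p u) < 1" "0 \<le> snd (T p u)" "snd (T p u) < 1" using TW(1) by (auto simp: half_open_iff)
    have 1: "real k * fst (T p u) = real (p div l) + (real ?N * fst u - real p)"
      using kl by (simp add: T_def field_simps)
    have 2: "real l * snd (T p u) = real (p mod l) + snd u"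
      using kl by (simp add: T_def field_simps)
    have x: "real p \<le> real ?N * fst u" "real ?N * fst u < real p + 1"
      using nat_floor_scaled(2,3)[OF kl(1) t(1,2), unfolded TW(2), unfolded 1] by linarith+
    have a: "0 \<le> snd u" "snd u < 1"
      using nat_floor_scaled(2,3)[OF kl(2) t(3,4), unfolded TW(3), unfolded 2] by linarith+
    have "real p + 1 \<le> real ?N" using p by linarith
    then have "0 \<le> real ?N * fst u" "real ?N * fst u < real ?N * 1" using x by linarith+
    moreover have "0 < real ?N" using N by linarith
    ultimately have "0 \<le> fst u" "fst u < 1" by (simp_all only: zero_le_mult_iff mult_less_cancel_left_pos) auto
    then have "u \<in> V p" using a x by (simp only: V_def mem_Collect_eq half_open_iff nat_floorI[OF x])
    then show "u \<in> V p \<inter> ?f -` A" using TA fT[of u p] by simp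
  qed
  have fb: "?f -` A \<in> sets borel" using measurable_sets[OF interleave_borel A(1)] by simp
  have us: "unit_square \<in> sets borel" by (simp add: unit_square_cbox)
  have "emeasure lborel (?f -` A \<inter> unit_square) = emeasure lborel (?f -` A \<inter> unit_square \<inter> ?H)"
    using fb us by (intro emeasure_half_open[symmetric]) auto
  also have "?f -` A \<inter> unit_square \<inter> ?H = (\<Union>p\<in>{..<?N}. V p \<inter> ?f -` A)"
    using half_open_sub nat_floor_scaled(1)[OF N] by (auto simp: V_def half_open_iff)
  also have "emeasure lborel \<dots> = (\<Sum>p<?N. emeasure lborel (V p \<inter> ?f -` A))"
    using Vb fb by (intro sum_emeasure[symmetric]) (auto simp: disjoint_family_on_def V_def)
  also have "\<dots> = (\<Sum>p<?N. emeasure lborel (W p \<inter> A))"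
  proof (intro sum.cong refl)
    fix p assume p: "p \<in> {..<?N}"
    have "emeasure lborel (W p \<inter> A) = emeasure (distr lborel borel (T p)) (W p \<inter> A)"
      unfolding T_def using kl by (subst distr_lborel_stretch) auto
    also have "\<dots> = emeasure lborel (T p -` (W p \<inter> A) \<inter> space lborel)"
      using Tb Wb A by (intro emeasure_distr) auto
    finally show "emeasure lborel (V p \<inter> ?f -` A) = emeasure lborel (W p \<inter> A)" using pre[of p] p by simp
  qed
  also have "\<dots> = emeasure lborel (\<Union>p\<in>{..<?N}. W p \<inter> A)"
  proof (intro sum_emeasure)
    show "disjoint_family_on (\<lambda>p. W p \<inter> A) {..<?N}"
      unfolding disjoint_family_on_def W_def by (auto) (metis div_mult_mod_eq)
  qed (use Wb A in auto)
  also have "(\<Union>p\<in>{..<?N}. W p \<inter> A) = A \<inter> ?H"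
  proof (intro set_eqI iffI)
    fix u assume u: "u \<in> A \<inter> ?H"
    define b where "b = nat \<lfloor>real k * fst u\<rfloor>"
    define i where "i = nat \<lfloor>real l * snd u\<rfloor>"
    have h: "0 \<le> fst u" "fst u < 1" "0 \<le> snd u" "snd u < 1" using u by (auto simp: half_open_iff)
    have bi: "b < k" "i < l" using nat_floor_scaled(1)[OF kl(1) h(1,2)] nat_floor_scaled(1)[OF kl(2) h(3,4)] by (simp_all add: b_def i_def)
    have "b * l + i < Suc b * l" using bi by simp
    also have "\<dots> \<le> k * l" using bi by (intro mult_le_mono1) simp
    finally have "b * l + i < ?N" .
    moreover have "u \<in> W (b * l + i)" using u bi by (simp add: W_def b_def i_def)
    ultimately show "u \<in> (\<Union>p\<in>{..<?N}. W p \<inter> A)" using u by blast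
  qed (auto simp: W_def)
  also have "emeasure lborel (A \<inter> ?H) = emeasure lborel A" by (rule emeasure_half_open[OF A])
  finally show ?thesis .
qed

lemma interleave_unit_square:
  assumes "0 < k" "0 < l" "u \<in> unit_square"
  shows "interleave k l u \<in> unit_square" "deinterleave k l u \<in> unit_square"
  using assms interleave_coords(3)[of k l u] deinterleave_coords(3)[of k l u] half_open_sub
  by (cases "u \<in> half_open_square"; auto simp: interleave_def deinterleave_def)+

lemma interleave_automorphism: "0 < k \<Longrightarrow> 0 < l \<Longrightarrow> interleave k l \<in> square_automorphisms"
  by (rule square_automorphismI[where g = "deinterleave k l"])
     (simp_all add: interleave_borel deinterleave_borel interleave_unit_square deinterleave_interleave
       interleave_deinterleave interleave_measure_preserving)

text \<open>
  A point stays in its column, which has width \<open>1 / k\<close>.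
\<close>
lemma shift_interleave_le:
  assumes kl: "0 < k" "0 < l"
  shows "shift (interleave k l) \<le> 1 / real k"
  unfolding shift_def
proof (rule cSUP_least)
  show "unit_square \<noteq> {}" by (auto simp: unit_square_def)
  fix u assume "u \<in> unit_square"
  show "\<bar>fst u - fst (interleave k l u)\<bar> \<le> 1 / real k"
  proof (cases "u \<in> half_open_square")
    case False
    then show ?thesis by (simp add: interleave_def)
  next
    case True
    define p where "p = nat \<lfloor>real (k * l) * fst u\<rfloor>"
    have x: "0 \<le> fst u" "fst u < 1" using True by (auto simp: half_open_iff)
    have N: "0 < k * l" using kl by simp
    note p = nat_floor_scaled[OF N x, folded p_def]
    have "real l * (real k * fst u) = real (k * l) * fst u" by simp
    moreover have "real p = real l * real (p div l) + real (p mod l)"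
      by (simp flip: of_nat_mult of_nat_add)
    moreover have "real (p mod l) + 1 \<le> real l" using mod_less_divisor[OF kl(2), of p] by linarith
    ultimately have *: "real l * real (p div l) \<le> real l * (real k * fst u)" "real l * (real k * fst u) < real l * (real (p div l) + 1)"
      using p unfolding distrib_left by linarith+
    then have "real (p div l) \<le> real k * fst u" "real k * fst u < real (p div l) + 1"
      using kl by simp_all
    then have "\<bar>real k * fst u - real k * fst (interleave k l u)\<bar> \<le> 1"
      unfolding interleave_coords(1)[OF kl True, folded p_def] abs_le_iff using p by linarith
    then have "real k * \<bar>fst u - fst (interleave k l u)\<bar> \<le> 1"
      by (simp add: abs_mult right_diff_distrib[symmetric])
    then show ?thesis using kl by (simp add: field_simps)
  qed
qed

section \<open>Approximation in the mean by layered functions\<close>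

text \<open>
  A measurable function is an almost everywhere limit of continuous functions; clamped to the
  unit interval, these converge in \<open>L\<^sup>1\<close> by dominated convergence.
\<close>
lemma continuous_L1_approx:
  assumes g: "borel_orderon g" and \<eta>: "0 < \<eta>"
  shows "\<exists>V. continuous_on UNIV V \<and> (\<forall>p. 0 \<le> V p \<and> V p \<le> 1) \<and>
     (\<integral>\<^sup>+p. ennreal \<bar>g p - V p\<bar> * indicator square2 p \<partial>lborel) \<le> ennreal \<eta>"
proof -
  have gm: "g \<in> borel_measurable borel" using g by (simp add: borel_orderon_def)
  have g01: "0 \<le> g p" "g p \<le> 1" for p using g unfolding borel_orderon_def by blast+
  have "g \<in> borel_measurable lebesgue" using gm by (intro measurable_completion) simp
  then have "g measurable_on UNIV" by (rule lebesgue_measurable_imp_measurable_on) simp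
  then obtain N w where N: "negligible N" and wc: "\<And>n. continuous_on UNIV (w n)"
    and wl: "\<And>x. x \<notin> N \<Longrightarrow> (\<lambda>n. w n x) \<longlonglongrightarrow> g x"
    unfolding measurable_on_def by auto
  define V where "V = (\<lambda>n p. max 0 (min 1 (w n p)))"
  have Vc: "continuous_on UNIV (V n)" for n unfolding V_def by (intro continuous_intros wc)
  have V01: "0 \<le> V n p" "V n p \<le> 1" for n p by (auto simp: V_def)
  have Vm: "V n \<in> borel_measurable borel" for n by (rule borel_measurable_continuous_onI[OF Vc])
  have "AE p in lebesgue. p \<notin> N" by (intro AE_not_in) (use N in \<open>simp add: negligible_iff_null_sets\<close>)
  then have "AE p in lborel. p \<notin> N" by (simp add: AE_completion_iff)
  then have lim: "AE p in lborel. (\<lambda>n. ennreal \<bar>g p - V n p\<bar> * indicator square2 p) \<longlonglongrightarrow> 0"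
  proof eventually_elim
    case (elim p)
    have "(\<lambda>n. V n p) \<longlonglongrightarrow> max 0 (min 1 (g p))"
      unfolding V_def by (intro tendsto_intros wl elim)
    then have "(\<lambda>n. \<bar>g p - V n p\<bar>) \<longlonglongrightarrow> \<bar>g p - g p\<bar>"
      using g01[of p] by (intro tendsto_intros) simp
    then have "(\<lambda>n. ennreal \<bar>g p - V n p\<bar>) \<longlonglongrightarrow> ennreal 0"
      by (intro tendsto_ennrealI) simp
    then show ?case by (cases "p \<in> square2") simp_all
  qed
  have "(\<lambda>n. \<integral>\<^sup>+p. ennreal \<bar>g p - V n p\<bar> * indicator square2 p \<partial>lborel) \<longlonglongrightarrow> (\<integral>\<^sup>+(p :: point \<times> point). 0 \<partial>lborel)"
  proof (rule nn_integral_dominated_convergence[where u = "\<lambda>n p. ennreal \<bar>g p - V n p\<bar> * indicator square2 p" and u' = "\<lambda>_. 0" and w = "indicator square2"])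
    show "(\<lambda>p. ennreal \<bar>g p - V n p\<bar> * indicator square2 p) \<in> borel_measurable lborel" for n
      using gm Vm[of n] square2_borel by simp
    show "AE p in lborel. ennreal \<bar>g p - V n p\<bar> * indicator square2 p \<le> indicator square2 p" for n
    proof (intro AE_I2)
      fix p
      have "ennreal \<bar>g p - V n p\<bar> \<le> 1" using g01[of p] V01[of n p] by (simp add: ennreal_le_1 abs_le_iff)
      then show "ennreal \<bar>g p - V n p\<bar> * indicator square2 p \<le> indicator square2 p"
        by (cases "p \<in> square2") simp_all
    qed
    have "has_uniform (unit_square \<times> unit_square)" by (intro has_uniform_Times has_uniform_unit_square)
    then show "(\<integral>\<^sup>+p. indicator square2 p \<partial>lborel) < \<infinity>"
      by (simp add: has_uniform_def top.not_eq_extremum)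
  qed (use square2_borel lim in auto)
  then have "(\<lambda>n. \<integral>\<^sup>+p. ennreal \<bar>g p - V n p\<bar> * indicator square2 p \<partial>lborel) \<longlonglongrightarrow> 0" by simp
  then have "\<forall>\<^sub>F n in sequentially. (\<integral>\<^sup>+p. ennreal \<bar>g p - V n p\<bar> * indicator square2 p \<partial>lborel) < ennreal \<eta>"
    by (rule order_tendstoD) (use \<eta> in simp)
  then obtain n where "(\<integral>\<^sup>+p. ennreal \<bar>g p - V n p\<bar> * indicator square2 p \<partial>lborel) < ennreal \<eta>"
    by (auto simp: eventually_sequentially)
  then show ?thesis using Vc[of n] V01[of n] by (intro exI[of _ "V n"]) (simp add: less_imp_le)
qed

lemma d1_le:
  assumes "g \<in> borel_measurable borel" "W \<in> borel_measurable borel"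
    and le: "(\<integral>\<^sup>+p. ennreal \<bar>g p - W p\<bar> * indicator square2 p \<partial>lborel) \<le> ennreal e" and e: "0 \<le> e"
  shows "d1 g W \<le> e"
proof -
  let ?f = "\<lambda>p. indicator square2 p *\<^sub>R \<bar>g p - W p\<bar>"
  have m: "?f \<in> borel_measurable lborel"
    using assms(1,2) square2_borel by simp
  have "d1 g W = enn2real (\<integral>\<^sup>+p. ennreal (?f p) \<partial>lebesgue)"
    unfolding d1_def set_lebesgue_integral_def
    by (intro integral_eq_nn_integral measurable_completion m) simp
  also have "(\<integral>\<^sup>+p. ennreal (?f p) \<partial>lebesgue) = (\<integral>\<^sup>+p. ennreal (?f p) \<partial>lborel)"
    by (rule nn_integral_completion)
  also have "\<dots> = (\<integral>\<^sup>+p. ennreal \<bar>g p - W p\<bar> * indicator square2 p \<partial>lborel)"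
    by (intro nn_integral_cong) (simp add: indicator_def)
  also have "enn2real \<dots> \<le> e" using le e by (intro enn2real_leI)
  finally show ?thesis .
qed

text \<open>
  Let \<open>V\<close> be continuous with \<open>L\<^sup>1\<close> distance at most \<open>\<epsilon> / 8\<close> from \<open>g\<close>, let the grid be
  so fine that \<open>V\<close> oscillates by less than \<open>\<epsilon> / 4\<close> on each pair of boxes, and choose the strip
  points by the first moment method for \<open>\<bar>g - V\<bar>\<close>. At a point of a pair of boxes from different
  strips, the error is at most \<open>\<bar>g - V\<bar>\<close> there, plus the oscillation of \<open>V\<close>, plus \<open>\<bar>g - V\<bar>\<close>
  at the representatives. These contribute \<open>\<epsilon> / 8\<close>, \<open>\<epsilon> / 4\<close> and \<open>\<epsilon> / 4\<close>. The pairs of points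
  in a common strip have total measure \<open>1 / l < \<epsilon> / 4\<close>, so the constants \<open>c\<close> can be arbitrary.
\<close>
lemma exists_layered_approx:
  assumes g: "borel_orderon g" and \<epsilon>: "0 < \<epsilon>"
  shows "\<exists>l x a. 0 < l \<and> strip_points g l x a \<and>
     (\<forall>c. (\<forall>j<l. \<forall>i<l. \<forall>i'<l. 0 \<le> c j i i' \<and> c j i i' \<le> 1) \<longrightarrow>
        d1 g (layered l (sampled g x a) c) \<le> \<epsilon>)"
proof -
  have gm: "g \<in> borel_measurable borel" using g by (simp add: borel_orderon_def)
  have g01: "0 \<le> g p" "g p \<le> 1" for p using g unfolding borel_orderon_def by blast+
  obtain V where Vc: "continuous_on UNIV V" and V01: "\<forall>p. 0 \<le> V p \<and> V p \<le> 1"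
    and VL: "(\<integral>\<^sup>+p. ennreal \<bar>g p - V p\<bar> * indicator square2 p \<partial>lborel) \<le> ennreal (\<epsilon> / 8)"
    using continuous_L1_approx[OF g, of "\<epsilon> / 8"] \<epsilon> by auto
  define h where "h = (\<lambda>p. \<bar>g p - V p\<bar>)"
  have Vm: "V \<in> borel_measurable borel" by (rule borel_measurable_continuous_onI[OF Vc])
  have hm: "h \<in> borel_measurable borel" unfolding h_def using gm Vm by simp
  have h0: "0 \<le> h p" for p by (simp add: h_def)
  have sq2: "square2 = cbox ((0, 0), (0, 0)) ((1, 1), (1, 1))"
    unfolding unit_square_cbox by (simp only: cbox_Pair_eq)
  have "uniformly_continuous_on square2 V"
    unfolding sq2 by (intro compact_uniformly_continuous compact_cbox continuous_on_subset[OF Vc]) simp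
  then obtain d where d: "d > 0" and Vd: "\<And>p q. p \<in> square2 \<Longrightarrow> q \<in> square2 \<Longrightarrow> dist q p < d \<Longrightarrow> dist (V q) (V p) < \<epsilon> / 4"
    unfolding uniformly_continuous_on_def using \<epsilon> by (metis divide_pos_pos zero_less_numeral)
  obtain l :: nat where l0: "l > 0" and ld: "4 / real l < d" and le: "1 / real l < \<epsilon> / 4"
  proof -
    obtain n :: nat where n: "real n > max (4 / d) (4 / \<epsilon>)" using reals_Archimedean2 by blast
    have n1: "4 / d < real n" "4 / \<epsilon> < real n" using n by simp_all
    have "0 < 4 / d" using d by simp
    then have "real n > 0" using n1 by linarith
    then have "n > 0" "4 / real n < d" "1 / real n < \<epsilon> / 4" using n1 d \<epsilon> by (auto simp: field_simps)
    then show ?thesis by (rule that)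
  qed
  have AEd: "AE p in lborel. density_point g p"
    using gm g01 by (intro AE_density_point) auto
  have VLh: "(\<integral>\<^sup>+p. ennreal (h p) * indicator square2 p \<partial>lborel) \<le> ennreal (\<epsilon> / 8)"
    using VL by (simp only: h_def)
  have e8: "0 < \<epsilon> / 8" using \<epsilon> by simp
  obtain x a where xc: "\<forall>j<l. x j \<in> cell l j" and ac: "\<forall>j<l. \<forall>i<l. a j i \<in> cell l i"
    and dens: "\<forall>j<l. \<forall>j'<l. \<forall>i<l. \<forall>i'<l. j \<noteq> j' \<longrightarrow> density_point g ((x j, a j i), (x j', a j' i'))"
    and hsum: "(\<Sum>(j, i, j', i') \<in> {(j, i, j', i'). j < l \<and> i < l \<and> j' < l \<and> i' < l \<and> j \<noteq> j'}.
        h ((x j, a j i), (x j', a j' i'))) \<le> 2 * (\<epsilon> / 8) * real l ^ 4"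
    using representatives[OF l0 hm h0 e8 VLh AEd] by (elim exE conjE)
  define z where "z = (\<lambda>j i. (x j, a j i))"
  define Q where "Q = {(j, i, j', i'). j < l \<and> i < l \<and> j' < l \<and> i' < l \<and> j \<noteq> j'}"
  have finQ: "finite Q"
    by (rule finite_subset[of _ "{..<l} \<times> {..<l} \<times> {..<l} \<times> {..<l}"]) (auto simp: Q_def)
  define Bx where "Bx = (\<lambda>(j, i, j', i'). layer_box l j i \<times> layer_box l j' i')"
  define hz where "hz = (\<lambda>(j, i, j', i'). h (z j i, z j' i'))"
  have hz0: "0 \<le> hz e" for e by (cases e) (simp add: hz_def h0)
  have Bb: "Bx e \<in> sets borel" for e
    by (cases e) (auto simp: Bx_def layer_box_def cell_def intro!: borel_Times)
  have Bem: "emeasure lborel (Bx e) = ennreal (1 / real l ^ 4)" for e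
    by (cases e) (simp add: Bx_def emeasure_layer_box_pair[OF l0])
  have zb: "z j i \<in> layer_box l j i" if "j < l" "i < l" for j i
    using xc ac that by (simp add: z_def layer_box_def)
  define S where "S = (\<lambda>j. (cell l j \<times> {0..1::real}) \<times> (cell l j \<times> {0..1::real}))"
  have Sb: "S j \<in> sets borel" for j by (auto simp: S_def cell_def intro!: borel_Times)
  have Sem: "emeasure lborel (S j) = ennreal (1 / real l ^ 2)" for j
  proof -
    have b: "cell l k \<in> sets borel" for k by (simp add: cell_def)
    show ?thesis unfolding S_def using l0
      by (simp add: emeasure_lborel_Times b borel_Times emeasure_cell power2_eq_square ennreal_mult'[symmetric])
  qed
  have main: "d1 g (layered l (sampled g x a) c) \<le> \<epsilon>"
    if c01: "\<forall>j<l. \<forall>i<l. \<forall>i'<l. 0 \<le> c j i i' \<and> c j i i' \<le> 1" for c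
  proof -
    define W where "W = layered l (sampled g x a) c"
    have Wm: "W \<in> borel_measurable borel" unfolding W_def by (rule layered_borel)
    have W01: "0 \<le> W p \<and> W p \<le> 1" for p
      using g01 c01[rule_format, OF cell_of_less[OF l0] cell_of_less[OF l0] cell_of_less[OF l0]]
      unfolding W_def layered_def case_prod_unfold by (simp split: if_splits)
    define F where "F = (\<lambda>p. ennreal (h p) * indicator square2 p + ennreal (\<epsilon> / 4) * indicator square2 p
        + (\<Sum>e\<in>Q. ennreal (hz e) * indicator (Bx e) p) + (\<Sum>j<l. indicator (S j) p))"
    have pw: "ennreal \<bar>g p - W p\<bar> * indicator square2 p \<le> F p" if off: "off_grid l p" for p
    proof (cases "p \<in> square2")
      case False
      then show ?thesis by simp
    next
      case True
      obtain r s t u where p: "p = ((r, s), (t, u))" by (cases p; cases "fst p"; cases "snd p") auto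
      have rs: "0 \<le> r" "r \<le> 1" "0 \<le> s" "s \<le> 1" "0 \<le> t" "t \<le> 1" "0 \<le> u" "u \<le> 1"
        using True by (auto simp: p unit_square_def)
      define j i j' i' where ji: "j = cell_of l r" "i = cell_of l s" "j' = cell_of l t" "i' = cell_of l u"
      have lt: "j < l" "i < l" "j' < l" "i' < l" by (simp_all add: ji cell_of_less l0)
      have inc: "r \<in> cell l j" "s \<in> cell l i" "t \<in> cell l j'" "u \<in> cell l i'"
        unfolding ji using off_gridD[OF off[unfolded p]] rs by (intro in_cell_of l0; simp)+
      show ?thesis
      proof (cases "j = j'")
        case False
        define e where "e = (j, i, j', i')"
        have eQ: "e \<in> Q" using lt False by (simp add: e_def Q_def)
        have pB: "p \<in> Bx e" using inc by (simp add: p e_def Bx_def layer_box_def)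
        have Wp: "W p = g (z j i, z j' i')"
          using False by (simp add: W_def layered_def p ji z_def)
        define q where "q = (z j i, z j' i')"
        have qsq: "q \<in> square2"
          unfolding q_def using zb[OF lt(1,2)] zb[OF lt(3,4)] layer_box_sub[OF l0 lt(1,2)] layer_box_sub[OF l0 lt(3,4)] by blast
        have dc: "\<bar>\<rho> - \<sigma>\<bar> \<le> 1 / real l" if "\<rho> \<in> cell l k" "\<sigma> \<in> cell l k" for \<rho> \<sigma> k
          using that by (auto simp: cell_def add_divide_distrib abs_le_iff)
        have "dist q p \<le> (dist (x j) r + dist (a j i) s) + (dist (x j') t + dist (a j' i') u)"
          unfolding q_def p z_def dist_Pair_Pair
          by (intro order_trans[OF sqrt_sum_squares_le_sum] add_mono sqrt_sum_squares_le_sum) auto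
        also have "\<dots> \<le> (1 / real l + 1 / real l) + (1 / real l + 1 / real l)"
          unfolding dist_real_def using xc ac lt inc by (intro add_mono dc) auto
        also have "\<dots> < d" using ld by simp
        finally have "dist (V q) (V p) < \<epsilon> / 4" using Vd[OF True qsq] by simp
        then have "\<bar>g p - W p\<bar> \<le> h p + \<epsilon> / 4 + hz e"
          unfolding Wp h_def hz_def e_def prod.case q_def[symmetric] dist_real_def by linarith
        then have "ennreal \<bar>g p - W p\<bar> \<le> ennreal (h p + \<epsilon> / 4 + hz e)" by (rule ennreal_leI)
        also have "\<dots> = ennreal (h p) + ennreal (\<epsilon> / 4) + ennreal (hz e)"
          using h0[of p] hz0[of e] \<epsilon> by (simp add: ennreal_plus[symmetric] del: ennreal_plus)
        also have "ennreal (hz e) \<le> (\<Sum>e\<in>Q. ennreal (hz e) * indicator (Bx e) p)"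
          using member_le_sum[OF eQ _ finQ, of "\<lambda>e. ennreal (hz e) * indicator (Bx e) p"] pB by simp
        finally have "ennreal \<bar>g p - W p\<bar> \<le> ennreal (h p) + ennreal (\<epsilon> / 4) + (\<Sum>e\<in>Q. ennreal (hz e) * indicator (Bx e) p)"
          by (simp add: add_left_mono)
        also have "\<dots> \<le> F p" using True by (simp add: F_def)
        finally show ?thesis using True by simp
      next
        case eq: True
        have "p \<in> S j" using inc rs eq by (simp add: p S_def)
        then have A: "(1::ennreal) \<le> (\<Sum>j<l. indicator (S j) p)"
          using member_le_sum[of j "{..<l}" "\<lambda>j. indicator (S j) p :: ennreal"] lt by simp
        have B: "ennreal \<bar>g p - W p\<bar> \<le> 1"
          using g01[of p] W01[of p] by (simp add: ennreal_le_1 abs_le_iff)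
        have C: "(\<Sum>j<l. indicator (S j) p) \<le> F p" by (simp add: F_def)
        show ?thesis using order_trans[OF B order_trans[OF A C]] True by simp
      qed
    qed
    have "(\<integral>\<^sup>+p. ennreal \<bar>g p - W p\<bar> * indicator square2 p \<partial>lborel) \<le> (\<integral>\<^sup>+p. F p \<partial>lborel)"
      by (intro nn_integral_mono_AE eventually_mono[OF AE_off_grid[of l] pw])
    also have "\<dots> = (\<integral>\<^sup>+p. ennreal (h p) * indicator square2 p \<partial>lborel) + (\<integral>\<^sup>+p. ennreal (\<epsilon> / 4) * indicator square2 p \<partial>lborel)
        + (\<Sum>e\<in>Q. \<integral>\<^sup>+p. ennreal (hz e) * indicator (Bx e) p \<partial>lborel) + (\<Sum>j<l. \<integral>\<^sup>+p. indicator (S j) p \<partial>lborel)"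
      unfolding F_def using hm square2_borel Bb Sb
      by (simp add: nn_integral_add nn_integral_sum)
    also have "\<dots> \<le> ennreal (\<epsilon> / 8) + ennreal (\<epsilon> / 4) + ennreal (\<epsilon> / 4) + ennreal (1 / real l)"
    proof (intro add_mono)
      show "(\<integral>\<^sup>+p. ennreal (h p) * indicator square2 p \<partial>lborel) \<le> ennreal (\<epsilon> / 8)" using VL by (simp only: h_def)
      have "emeasure lborel square2 = 1"
        unfolding sq2 by (simp add: emeasure_lborel_cbox_eq Basis_prod_def zero_prod_def)
      then show "(\<integral>\<^sup>+p. ennreal (\<epsilon> / 4) * indicator square2 p \<partial>lborel) \<le> ennreal (\<epsilon> / 4)"
        using square2_borel by (subst nn_integral_cmult_indicator) simp_all
      have "(\<Sum>e\<in>Q. \<integral>\<^sup>+p. ennreal (hz e) * indicator (Bx e) p \<partial>lborel) = (\<Sum>e\<in>Q. ennreal (hz e * (1 / real l ^ 4)))"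
        using Bb by (intro sum.cong refl) (subst nn_integral_cmult_indicator, simp_all add: Bem hz0 ennreal_mult'[symmetric])
      also have "\<dots> = ennreal (\<Sum>e\<in>Q. hz e * (1 / real l ^ 4))" by (intro sum_ennreal) (simp add: hz0)
      also have "\<dots> = ennreal ((\<Sum>e\<in>Q. hz e) * (1 / real l ^ 4))" by (simp only: sum_distrib_right)
      also have "\<dots> \<le> ennreal ((2 * (\<epsilon> / 8) * real l ^ 4) * (1 / real l ^ 4))"
      proof (intro ennreal_leI mult_right_mono)
        show "(\<Sum>e\<in>Q. hz e) \<le> 2 * (\<epsilon> / 8) * real l ^ 4"
          using hsum unfolding Q_def hz_def z_def .
      qed simp
      also have "\<dots> = ennreal (\<epsilon> / 4)" using l0 by simp
      finally show "(\<Sum>e\<in>Q. \<integral>\<^sup>+p. ennreal (hz e) * indicator (Bx e) p \<partial>lborel) \<le> ennreal (\<epsilon> / 4)" .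
      have "(\<Sum>j<l. \<integral>\<^sup>+p. indicator (S j) p \<partial>lborel) = (\<Sum>j<l. ennreal (1 / real l ^ 2))"
        using Sb by (simp add: Sem)
      also have "\<dots> = ennreal (\<Sum>j<l. 1 / real l ^ 2)" by (rule sum_ennreal) simp
      also have "(\<Sum>j<l. 1 / real l ^ 2) = 1 / real l" by (simp add: power2_eq_square)
      finally show "(\<Sum>j<l. \<integral>\<^sup>+p. indicator (S j) p \<partial>lborel) \<le> ennreal (1 / real l)" by simp
    qed
    also have "\<dots> = ennreal (\<epsilon> / 8 + \<epsilon> / 4 + \<epsilon> / 4 + 1 / real l)"
      using \<epsilon> by (simp add: ennreal_plus[symmetric] del: ennreal_plus)
    also have "\<dots> \<le> ennreal \<epsilon>" using le \<epsilon> by (intro ennreal_leI) linarith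
    finally show ?thesis unfolding W_def[symmetric] using \<epsilon> by (intro d1_le gm Wm) simp_all
  qed
  show ?thesis
  proof (intro exI[of _ l] exI[of _ x] exI[of _ a] conjI l0)
    show "strip_points g l x a" using xc ac dens by (simp add: strip_points_def)
    show "\<forall>c. (\<forall>j<l. \<forall>i<l. \<forall>i'<l. 0 \<le> c j i i' \<and> c j i i' \<le> 1) \<longrightarrow>
        d1 g (layered l (sampled g x a) c) \<le> \<epsilon>"
      by (rule allI, rule impI) (rule main)
  qed
qed

section \<open>Cut norms of step kernels\<close>

lemma lebesgue_Times:
  fixes S :: "'a::euclidean_space set" and T :: "'b::euclidean_space set"
  assumes S: "S \<in> sets lebesgue" and T: "T \<in> sets lebesgue"
  shows "S \<times> T \<in> sets lebesgue" "emeasure lebesgue (S \<times> T) = emeasure lebesgue S * emeasure lebesgue T"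
proof -
  have ex: "\<exists>B N'. B \<in> sets borel \<and> N' \<in> null_sets lborel \<and> B \<subseteq> A \<and> A \<subseteq> B \<union> N' \<and> emeasure lborel B = emeasure lebesgue A"
    if A: "A \<in> sets lebesgue" for A :: "'c::euclidean_space set"
  proof -
    obtain B N N' where B: "B \<in> sets lborel" "N' \<in> null_sets lborel" "N \<subseteq> N'" "A = B \<union> N"
      using A by (rule sets_completionE) auto
    have n: "N \<in> null_sets lebesgue"
      by (rule null_sets_completion_subset[OF B(3) null_sets_completionI[OF B(2)]])
    have "emeasure lebesgue A = emeasure lebesgue B"
      unfolding B(4) by (rule emeasure_Un_null_set[OF _ n]) (use B in simp)
    then show ?thesis using B by (intro exI[of _ B] exI[of _ N']) auto
  qed
  obtain S0 N where S0: "S0 \<in> sets borel" "N \<in> null_sets lborel" "S0 \<subseteq> S" "S \<subseteq> S0 \<union> N" "emeasure lborel S0 = emeasure lebesgue S"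
    using ex[OF S] by blast
  obtain T0 M where T0: "T0 \<in> sets borel" "M \<in> null_sets lborel" "T0 \<subseteq> T" "T \<subseteq> T0 \<union> M" "emeasure lborel T0 = emeasure lebesgue T"
    using ex[OF T] by blast
  have "N \<times> UNIV \<in> null_sets (lborel \<Otimes>\<^sub>M (lborel :: 'b measure))"
    by (rule lborel.times_in_null_sets1[OF S0(2)]) simp
  moreover have "UNIV \<times> M \<in> null_sets ((lborel :: 'a measure) \<Otimes>\<^sub>M lborel)"
    by (rule lborel.times_in_null_sets2[OF _ T0(2)]) simp
  ultimately have "N \<times> UNIV \<union> UNIV \<times> M \<in> null_sets (lborel :: ('a \<times> 'b) measure)"
    unfolding lborel_prod by (rule null_sets.Un)
  then have "AE p in lborel. p \<notin> N \<times> UNIV \<union> UNIV \<times> M" by (rule AE_not_in)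
  then have "AE p in lborel. p \<in> S0 \<times> T0 \<longleftrightarrow> p \<in> S \<times> T"
    by (rule eventually_mono) (use S0 T0 in auto)
  then have ae: "AE p in lebesgue. p \<in> S0 \<times> T0 \<longleftrightarrow> p \<in> S \<times> T" by (rule AE_completion)
  have b: "S0 \<times> T0 \<in> sets borel" using S0 T0 by (intro borel_Times)
  then have bl: "S0 \<times> T0 \<in> sets lebesgue" by simp
  show 1: "S \<times> T \<in> sets lebesgue" by (rule completion.in_sets_AE[OF ae bl]) simp
  have "emeasure lebesgue (S \<times> T) = emeasure lebesgue (S0 \<times> T0)"
    by (rule emeasure_eq_AE[OF _ 1 bl]) (use ae in \<open>auto elim: eventually_mono\<close>)
  also have "\<dots> = emeasure lborel (S0 \<times> T0)" using b by simp
  also have "\<dots> = emeasure lborel S0 * emeasure lborel T0"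
    using S0 T0 by (intro emeasure_lborel_Times)
  finally show "emeasure lebesgue (S \<times> T) = emeasure lebesgue S * emeasure lebesgue T"
    by (simp only: S0 T0)
qed

lemma measure_lebesgue_Times:
  fixes S :: "'a::euclidean_space set" and T :: "'b::euclidean_space set"
  assumes "S \<in> sets lebesgue" "T \<in> sets lebesgue"
  shows "measure lebesgue (S \<times> T) = measure lebesgue S * measure lebesgue T"
  by (simp add: measure_def lebesgue_Times(2)[OF assms] enn2real_mult)

definition vertex_of :: "nat \<Rightarrow> point \<Rightarrow> nat" where
  "vertex_of N u = nat \<lfloor>real N * fst u\<rfloor>"

lemma vertex_of_borel: "{u. vertex_of N u = p} \<in> sets borel"
proof -
  have "(\<lambda>u::point. real N * fst u) \<in> borel_measurable borel"
    using borel_fst_snd by (intro borel_measurable_times borel_measurable_const)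
  then have "(\<lambda>u. vertex_of N u) \<in> borel \<rightarrow>\<^sub>M count_space UNIV" unfolding vertex_of_def by measurable
  from measurable_sets[OF this, of "{p}"] show ?thesis by (simp add: vimage_def)
qed

lemma measure_strip:
  "0 < N \<Longrightarrow> measure lborel (cbox (real p / real N, 0) ((real p + 1) / real N, 1) :: point set) = 1 / real N"
  by (subst measure_cbox_point) (auto simp: add_divide_distrib divide_right_mono)

text \<open>
  The function \<open>X\<close> is the step function with values \<open>Y\<close>, except on the pairs of points in
  a common column, which have total measure \<open>1 / k\<close>. A cut of the step function is a bilinear form in
  the measures that the two sets have in the slices, so it is bounded by the cuts of the
  matrix.
\<close>
lemma cut_norm_step_le:
  fixes X :: "point \<times> point \<Rightarrow> real" and Y :: "nat \<Rightarrow> nat \<Rightarrow> real"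
  assumes kl: "0 < k" "0 < l"
  defines "N \<equiv> k * l"
  assumes ae: "AE p in lborel. p \<in> square2 \<longrightarrow> vertex_of N (fst p) div l \<noteq> vertex_of N (snd p) div l \<longrightarrow>
       X p = Y (vertex_of N (fst p)) (vertex_of N (snd p))"
    and X1: "\<And>p. p \<in> square2 \<Longrightarrow> \<bar>X p\<bar> \<le> 1"
    and cut: "\<And>S T. S \<subseteq> {..<N} \<Longrightarrow> T \<subseteq> {..<N} \<Longrightarrow>
       \<bar>\<Sum>p\<in>S. \<Sum>q\<in>T. if p div l = q div l then 0 else Y p q\<bar> \<le> B"
  shows "cut_norm X \<le> B / real N ^ 2 + 1 / real k"
  unfolding cut_norm_def
proof (rule cSup_least)
  show "{\<bar>LINT p:S \<times> T|lebesgue. X p\<bar> |S T. S \<in> sets lebesgue \<and> S \<subseteq> unit_square \<and> T \<in> sets lebesgue \<and> T \<subseteq> unit_square} \<noteq> {}"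
    by auto
  have N: "0 < N" using kl by (simp add: N_def)
  have B0: "0 \<le> B" using cut[of "{}" "{}"] by simp
  fix e assume "e \<in> {\<bar>LINT p:S \<times> T|lebesgue. X p\<bar> |S T. S \<in> sets lebesgue \<and> S \<subseteq> unit_square \<and> T \<in> sets lebesgue \<and> T \<subseteq> unit_square}"
  then obtain S T where e: "e = \<bar>LINT p:S \<times> T|lebesgue. X p\<bar>"
    and S: "S \<in> sets lebesgue" "S \<subseteq> unit_square" and T: "T \<in> sets lebesgue" "T \<subseteq> unit_square" by blast
  define Yo where "Yo = (\<lambda>p q. if p div l = q div l then 0 else Y p q)"
  define part where "part = (\<lambda>A p. A \<inter> {u. vertex_of N u = p \<and> fst u < 1})"
  have strip: "part A p \<subseteq> cbox (real p / real N, 0) ((real p + 1) / real N, 1)" if A: "A \<subseteq> unit_square" for A p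
  proof
    fix u assume u: "u \<in> part A p"
    then have us: "u \<in> unit_square" and v: "vertex_of N u = p" "fst u < 1" using A by (auto simp: part_def)
    have x: "0 \<le> fst u" "0 \<le> snd u" "snd u \<le> 1" using us by (auto simp: unit_square_cbox mem_cbox_point)
    have "real p \<le> real N * fst u" "real N * fst u < real p + 1"
      using nat_floor_scaled(2,3)[OF N x(1) v(2), unfolded v(1)[unfolded vertex_of_def]] .
    then show "u \<in> cbox (real p / real N, 0) ((real p + 1) / real N, 1)"
      using x N by (simp add: mem_cbox_point field_simps)
  qed
  have fst1: "{u :: point. fst u < 1} \<in> sets borel"
    using borel_measurable_less[OF borel_fst_snd(1) borel_measurable_const[of 1]] by simp
  have partm: "part A p \<in> sets lebesgue" if "A \<in> sets lebesgue" for A p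
  proof -
    have "{u. vertex_of N u = p \<and> fst u < 1} = {u. vertex_of N u = p} \<inter> {u. fst u < 1}" by auto
    then have "{u. vertex_of N u = p \<and> fst u < 1} \<in> sets borel" using fst1 vertex_of_borel by auto
    then show ?thesis unfolding part_def using that by (intro sets.Int) auto
  qed
  have partfin: "emeasure lebesgue (part A p) < \<infinity>" and partle: "measure lebesgue (part A p) \<le> 1 / real N"
    if "A \<in> sets lebesgue" "A \<subseteq> unit_square" for A p
  proof -
    have "emeasure lebesgue (part A p) \<le> emeasure lebesgue (cbox (real p / real N, 0) ((real p + 1) / real N, 1) :: point set)"
      by (intro emeasure_mono strip that) simp
    also have "\<dots> < \<infinity>" by (simp add: emeasure_lborel_cbox_eq)
    finally show "emeasure lebesgue (part A p) < \<infinity>" .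
    have "measure lebesgue (part A p) \<le> measure lebesgue (cbox (real p / real N, 0) ((real p + 1) / real N, 1) :: point set)"
      by (intro measure_mono_fmeasurable strip that partm) simp
    also have "\<dots> = 1 / real N" using measure_strip[OF N] by simp
    finally show "measure lebesgue (part A p) \<le> 1 / real N" .
  qed
  define Z where "Z = (\<lambda>x. \<Sum>p<N. \<Sum>q<N. Yo p q * indicator (part S p \<times> part T q) x)"
  have intt: "integrable lebesgue (\<lambda>x. Yo p q * indicator (part S p \<times> part T q) x)" for p q
  proof (intro integrable_mult_right integrable_real_indicator)
    show "part S p \<times> part T q \<in> sets lebesgue" by (intro lebesgue_Times partm S T)
    show "emeasure lebesgue (part S p \<times> part T q) < \<infinity>"
      unfolding lebesgue_Times(2)[OF partm[OF S(1)] partm[OF T(1)]]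
      using partfin[OF S, of p] partfin[OF T, of q] by (simp only: ennreal_mult_less_top infinity_ennreal_def) simp
  qed
  then have Zint: "integrable lebesgue Z" unfolding Z_def by (intro Bochner_Integration.integrable_sum)
  have "(LINT x|lebesgue. Z x) = (\<Sum>p<N. \<Sum>q<N. Yo p q * measure lebesgue (part S p \<times> part T q))"
  proof -
    have "(LINT x|lebesgue. Z x) = (\<Sum>p<N. \<Sum>q<N. LINT x|lebesgue. Yo p q * indicator (part S p \<times> part T q) x)"
      unfolding Z_def by (simp only: Bochner_Integration.integral_sum Bochner_Integration.integrable_sum intt)
    then show ?thesis by simp
  qed
  also have "\<dots> = (\<Sum>p<N. \<Sum>q<N. (real N * measure lebesgue (part S p)) * (real N * measure lebesgue (part T q)) * Yo p q) / real N ^ 2"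
    using N by (simp add: sum_divide_distrib measure_lebesgue_Times partm S T power2_eq_square mult_ac)
  finally have ZZ: "(LINT x|lebesgue. Z x) = (\<Sum>p<N. \<Sum>q<N. (real N * measure lebesgue (part S p)) * (real N * measure lebesgue (part T q)) * Yo p q) / real N ^ 2" .
  have "\<bar>\<Sum>p<N. \<Sum>q<N. (real N * measure lebesgue (part S p)) * (real N * measure lebesgue (part T q)) * Yo p q\<bar> \<le> B"
  proof (rule fractional_cut_le)
    show "\<bar>\<Sum>p\<in>S'. \<Sum>q\<in>T'. Yo p q\<bar> \<le> B" if "S' \<subseteq> {..<N}" "T' \<subseteq> {..<N}" for S' T'
      using cut[OF that] by (simp add: Yo_def)
    show "0 \<le> real N * measure lebesgue (part S p) \<and> real N * measure lebesgue (part S p) \<le> 1" for p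
      using partle[OF S, of p] N by (simp add: field_simps)
    show "0 \<le> real N * measure lebesgue (part T p) \<and> real N * measure lebesgue (part T p) \<le> 1" for p
      using partle[OF T, of p] N by (simp add: field_simps)
  qed auto
  then have Zle: "\<bar>LINT x|lebesgue. Z x\<bar> \<le> B / real N ^ 2"
    unfolding ZZ using N by (simp add: divide_right_mono)
  define D where "D = (\<lambda>b. cbox (real b / real k, 0) ((real b + 1) / real k, 1) :: point set)"
  define K where "K = (\<lambda>x. \<Sum>b<k. indicator (D b \<times> D b) x :: real)"
  have Dl: "D b \<in> sets lebesgue" for b by (simp add: D_def)
  have mD: "measure lebesgue (D b) = 1 / real k" for b using measure_strip[OF kl(1)] by (simp add: D_def)
  have fD: "emeasure lebesgue (D b) < \<infinity>" for b by (simp add: D_def emeasure_lborel_cbox_eq)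
  have indK: "integrable lebesgue (indicator (D b \<times> D b) :: _ \<Rightarrow> real)" for b
  proof (intro integrable_real_indicator)
    show "D b \<times> D b \<in> sets lebesgue" by (intro lebesgue_Times Dl)
    show "emeasure lebesgue (D b \<times> D b) < \<infinity>"
      unfolding lebesgue_Times(2)[OF Dl Dl] using fD[of b] by (simp only: ennreal_mult_less_top infinity_ennreal_def) simp
  qed
  have Kint: "integrable lebesgue K" unfolding K_def by (intro Bochner_Integration.integrable_sum indK)
  have "(LINT x|lebesgue. K x) = (\<Sum>b<k. measure lebesgue (D b \<times> D b))"
    unfolding K_def using indK by (simp add: Bochner_Integration.integral_sum)
  also have "\<dots> = 1 / real k" using kl by (simp add: measure_lebesgue_Times Dl mD)
  finally have KK: "(LINT x|lebesgue. K x) = 1 / real k" .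
  define X' where "X' = (\<lambda>x. indicator (S \<times> T) x *\<^sub>R X x)"
  have e': "e = \<bar>LINT x|lebesgue. X' x\<bar>" by (simp add: e X'_def set_lebesgue_integral_def)
  show "e \<le> B / real N ^ 2 + 1 / real k"
  proof (cases "integrable lebesgue X'")
    case False
    then have "e = 0" by (simp add: e' not_integrable_integral_eq)
    then show ?thesis using B0 by simp
  next
    case True
    have h: "AE p in lborel. ((1, 0), (0, 0)) \<bullet> (p :: point \<times> point) \<noteq> 1" "AE p in lborel. ((0, 0), (1, 0)) \<bullet> (p :: point \<times> point) \<noteq> 1"
      by (rule AE_hyperplane, simp add: zero_prod_def)+
    have "AE x in lborel. \<bar>X' x - Z x\<bar> \<le> K x"
      using ae h
    proof eventually_elim
      case (elim x)
      have K0: "0 \<le> K x" by (simp add: K_def sum_nonneg)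
      have f1: "fst (fst x) \<noteq> 1" "fst (snd x) \<noteq> 1"
        using elim(2,3) by (cases x; cases "fst x"; cases "snd x"; simp)+
      show ?case
      proof (cases "x \<in> S \<times> T")
        case False
        then have "x \<notin> part S p \<times> part T q" for p q by (auto simp: part_def)
        then have "Z x = 0" by (simp add: Z_def)
        then show ?thesis using False K0 by (simp add: X'_def)
      next
        case in_ST: True
        obtain u v where x: "x = (u, v)" by (cases x)
        have us: "u \<in> unit_square" "v \<in> unit_square" using in_ST S T by (auto simp: x)
        have uv: "0 \<le> fst u" "fst u < 1" "0 \<le> fst v" "fst v < 1" "0 \<le> snd u" "snd u \<le> 1" "0 \<le> snd v" "snd v \<le> 1"
          using us f1 by (auto simp: x unit_square_cbox mem_cbox_point)
        define p where "p = vertex_of N u"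
        define q where "q = vertex_of N v"
        note p = nat_floor_scaled[OF N uv(1,2), folded vertex_of_def p_def]
        note q = nat_floor_scaled[OF N uv(3,4), folded vertex_of_def q_def]
        have "indicator (part S p' \<times> part T q') x = (if p' = p then if q' = q then 1 else 0 else (0::real))" for p' q'
          using in_ST uv by (auto simp: x part_def p_def q_def indicator_def)
        then have "Z x = (\<Sum>p'<N. \<Sum>q'<N. if p' = p then if q' = q then Yo p' q' else 0 else 0)"
          unfolding Z_def by (intro sum.cong refl) simp
        also have "\<dots> = (\<Sum>p'<N. if p' = p then (\<Sum>q'<N. if q' = q then Yo p' q' else 0) else 0)"
          by (intro sum.cong refl) simp
        also have "\<dots> = Yo p q" using p q by (simp add: sum.delta)
        finally have Zx: "Z x = Yo p q" .
        have X'x: "X' x = X x" using in_ST by (simp add: X'_def)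
        have xsq: "x \<in> square2" using us by (simp add: x)
        show ?thesis
        proof (cases "p div l = q div l")
          case False
          have "vertex_of N (fst x) div l \<noteq> vertex_of N (snd x) div l" using False by (simp add: x p_def q_def)
          from elim(1)[rule_format, OF xsq this] False have "X x = Yo p q" by (simp add: x p_def q_def Yo_def)
          then show ?thesis using K0 by (simp add: X'x Zx)
        next
          case True
          define b where "b = p div l"
          have bk: "b < k" using p(1) unfolding b_def N_def by (simp add: less_mult_imp_div_less)
          have inD: "w \<in> D b" if "vertex_of N w div l = b" "0 \<le> fst w" "fst w < 1" "0 \<le> snd w" "snd w \<le> 1" for w
          proof -
            define r where "r = vertex_of N w"
            note r = nat_floor_scaled(2,3)[OF N that(2,3), folded vertex_of_def r_def]
            have "r = l * b + r mod l" using that(1) by (simp add: r_def[symmetric] flip: that(1))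
            then have "real r = real l * real b + real (r mod l)" by (metis of_nat_add of_nat_mult)
            moreover have "real (r mod l) + 1 \<le> real l" using mod_less_divisor[OF kl(2), of r] by linarith
            moreover have "real N * fst w = real l * (real k * fst w)" by (simp add: N_def)
            ultimately have "real l * real b \<le> real l * (real k * fst w)" "real l * (real k * fst w) \<le> real l * (real b + 1)"
              using r unfolding distrib_left by linarith+
            then have "real b \<le> real k * fst w" "real k * fst w \<le> real b + 1" using kl by simp_all
            then show ?thesis using that kl by (simp add: D_def mem_cbox_point field_simps)
          qed
          have "x \<in> D b \<times> D b"
            unfolding x using inD[of u] inD[of v] uv True by (simp add: b_def p_def q_def)
          then have "1 \<le> K x"
            unfolding K_def using member_le_sum[of b "{..<k}" "\<lambda>b. indicator (D b \<times> D b) x :: real"] bk by simp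
          then show ?thesis using X1[OF xsq] True by (simp add: X'x Zx Yo_def)
        qed
      qed
    qed
    then have ae2: "AE x in lebesgue. \<bar>X' x - Z x\<bar> \<le> K x" by (rule AE_completion)
    have d: "integrable lebesgue (\<lambda>x. X' x - Z x)" using True Zint by (rule Bochner_Integration.integrable_diff)
    have "\<bar>LINT x|lebesgue. X' x - Z x\<bar> \<le> (LINT x|lebesgue. \<bar>X' x - Z x\<bar>)"
      using integral_norm_bound[of lebesgue "\<lambda>x. X' x - Z x"] by simp
    also have "\<dots> \<le> (LINT x|lebesgue. K x)"
      by (rule integral_mono_AE[OF _ Kint ae2]) (use d in simp)
    finally have "\<bar>(LINT x|lebesgue. X' x) - (LINT x|lebesgue. Z x)\<bar> \<le> 1 / real k"
      using True Zint by (simp add: KK)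
    then show ?thesis using Zle unfolding e' by linarith
  qed
qed

section \<open>Graphs close to a layered orderon\<close>

lemma cut_norm_nonneg:
  assumes X1: "\<And>p. p \<in> square2 \<Longrightarrow> \<bar>X p\<bar> \<le> 1"
  shows "0 \<le> cut_norm X"
proof -
  let ?S = "{\<bar>LINT p:S \<times> T|lebesgue. X p\<bar> |S T. S \<in> sets lebesgue \<and> S \<subseteq> unit_square \<and> T \<in> sets lebesgue \<and> T \<subseteq> unit_square}"
  have hu2: "has_uniform square2" by (intro has_uniform_Times has_uniform_unit_square)
  have sq: "integrable lebesgue (indicator square2 :: _ \<Rightarrow> real)"
    using hu2 square2_borel by (intro integrable_real_indicator) (simp_all add: has_uniform_def top.not_eq_extremum)
  have "e \<le> (LINT p|lebesgue. indicator square2 p)" if e_in: "e \<in> ?S" for e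
  proof -
    obtain S T where e: "e = \<bar>LINT p:S \<times> T|lebesgue. X p\<bar>" and ST: "S \<subseteq> unit_square" "T \<subseteq> unit_square" using e_in by blast
    define X' where "X' = (\<lambda>p. indicator (S \<times> T) p *\<^sub>R X p)"
    have e': "e = \<bar>LINT p|lebesgue. X' p\<bar>" by (simp add: e X'_def set_lebesgue_integral_def)
    show ?thesis
    proof (cases "integrable lebesgue X'")
      case False
      then show ?thesis by (simp add: e' not_integrable_integral_eq)
    next
      case True
      have "\<bar>LINT p|lebesgue. X' p\<bar> \<le> (LINT p|lebesgue. \<bar>X' p\<bar>)"
        using integral_norm_bound[of lebesgue X'] by simp
      also have "\<dots> \<le> (LINT p|lebesgue. indicator square2 p)"
      proof (rule integral_mono[OF _ sq])
        show "integrable lebesgue (\<lambda>p. \<bar>X' p\<bar>)" using True by simp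
        fix p
        have "p \<in> S \<times> T \<Longrightarrow> p \<in> square2" using ST by auto
        then show "\<bar>X' p\<bar> \<le> indicator square2 p" using X1[of p] by (cases "p \<in> S \<times> T") (simp_all add: X'_def)
      qed
      finally show ?thesis by (simp add: e')
    qed
  qed
  then have "bdd_above ?S" by (rule bdd_aboveI)
  moreover have "0 \<in> ?S" by (auto simp: set_lebesgue_integral_def intro!: exI[of _ "{}"])
  ultimately show ?thesis unfolding cut_norm_def by (rule cSup_upper[rotated])
qed

lemma shift_nonneg:
  assumes "f \<in> square_automorphisms"
  shows "0 \<le> shift f"
proof -
  have f: "f u \<in> unit_square" if "u \<in> unit_square" for u
    using assms that bij_betwE unfolding square_automorphisms_def by blast
  have b: "\<bar>fst u - fst (f u)\<bar> \<le> 1" if "u \<in> unit_square" for u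
    using that f[OF that] by (auto simp: unit_square_def mem_Times_iff abs_le_iff)
  have us: "(0, 0) \<in> unit_square" by (simp add: unit_square_def)
  have "0 \<le> \<bar>fst (0 :: real, 0 :: real) - fst (f (0, 0))\<bar>" by (rule abs_ge_zero)
  also have "\<dots> \<le> shift f"
    unfolding shift_def by (rule cSUP_upper[OF us]) (use b in \<open>auto intro!: bdd_aboveI2\<close>)
  finally show ?thesis .
qed

lemma d_triangle_bounds:
  assumes W: "\<And>u v. u \<in> unit_square \<Longrightarrow> v \<in> unit_square \<Longrightarrow> 0 \<le> W (u, v) \<and> W (u, v) \<le> 1"
    and V: "\<And>u v. u \<in> unit_square \<Longrightarrow> v \<in> unit_square \<Longrightarrow> 0 \<le> V (u, v) \<and> V (u, v) \<le> 1"
    and f: "f \<in> square_automorphisms"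
  shows "0 \<le> d_triangle W V" "d_triangle W V \<le> shift f + cut_norm (\<lambda>(u, v). W (u, v) - V (f u, f v))"
proof -
  have nn: "0 \<le> shift h + cut_norm (\<lambda>(u, v). W (u, v) - V (h u, h v))" if h: "h \<in> square_automorphisms" for h
  proof -
    have hs: "h u \<in> unit_square" if "u \<in> unit_square" for u
      using h that bij_betwE unfolding square_automorphisms_def by blast
    have "0 \<le> cut_norm (\<lambda>(u, v). W (u, v) - V (h u, h v))"
    proof (rule cut_norm_nonneg)
      fix p assume p: "p \<in> square2"
      obtain u v where uv: "p = (u, v)" by (cases p)
      have u: "u \<in> unit_square" "v \<in> unit_square" using p by (simp_all add: uv)
      show "\<bar>case p of (u, v) \<Rightarrow> W (u, v) - V (h u, h v)\<bar> \<le> 1"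
        using W[OF u] V[OF hs[OF u(1)] hs[OF u(2)]] by (simp only: uv prod.case abs_le_iff) linarith
    qed
    then show ?thesis using shift_nonneg[OF h] by simp
  qed
  show "0 \<le> d_triangle W V"
    unfolding d_triangle_def by (rule cINF_greatest) (use f nn in auto)
  show "d_triangle W V \<le> shift f + cut_norm (\<lambda>(u, v). W (u, v) - V (f u, f v))"
    unfolding d_triangle_def by (rule cINF_lower[OF _ f]) (use nn in \<open>auto intro!: bdd_belowI2\<close>)
qed

text \<open>
  The slice of a vertex is carried into a single strip and a single layer, and two different columns
  do not overlap, so their order decides which of the points has the smaller abscissa.
\<close>
lemma layered_interleave:
  assumes nl: "0 < n" "0 < l" and u: "u \<in> half_open_square" and v: "v \<in> half_open_square"
  defines "N \<equiv> (l * n) * l"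
  defines "p \<equiv> vertex_of N u" and "q \<equiv> vertex_of N v"
  assumes pq: "p div l \<noteq> q div l"
  shows "layered l A c (interleave (l * n) l u, interleave (l * n) l v) =
    (if p div l div n \<noteq> q div l div n then A (p div l div n) (p mod l) (q div l div n) (q mod l)
     else if p < q then c (p div l div n) (p mod l) (q mod l) else c (p div l div n) (q mod l) (p mod l))"
proof -
  have kl: "0 < l * n" "0 < l" using nl by simp_all
  have N: "0 < N" using nl by (simp add: N_def)
  have cells: "cell_of l (fst (interleave (l * n) l w)) = vertex_of N w div l div n"
      "cell_of l (snd (interleave (l * n) l w)) = vertex_of N w mod l"
      "nat \<lfloor>real (l * n) * fst (interleave (l * n) l w)\<rfloor> = vertex_of N w div l"
    if w: "w \<in> half_open_square" for w
  proof -
    define r where "r = vertex_of N w"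
    have r_eq: "nat \<lfloor>real (l * n * l) * fst w\<rfloor> = r" by (simp add: r_def vertex_of_def N_def)
    note co = interleave_coords[OF kl w, unfolded r_eq]
    have w1: "0 \<le> fst w" "fst w < 1" using w by (auto simp: half_open_iff)
    note r = nat_floor_scaled[OF N w1, folded vertex_of_def r_def]
    have bk: "r div l < l * n" using r(1) unfolding N_def by (simp add: less_mult_imp_div_less)
    then have jl: "r div l div n < l" by (simp add: less_mult_imp_div_less)
    show "nat \<lfloor>real (l * n) * fst (interleave (l * n) l w)\<rfloor> = vertex_of N w div l"
      using co(4) by (simp add: r_def)
    have "real (r div l) = real n * real (r div l div n) + real (r div l mod n)"
      by (simp flip: of_nat_mult of_nat_add)
    moreover have "real (r div l mod n) + 1 \<le> real n" using mod_less_divisor[OF nl(1), of "r div l"] by linarith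
    moreover have "real n * (real l * fst (interleave (l * n) l w)) = real (r div l) + (real (l * n * l) * fst w - real r)"
      using co(1) by (simp add: mult_ac)
    ultimately have "real n * real (r div l div n) \<le> real n * (real l * fst (interleave (l * n) l w))"
        "real n * (real l * fst (interleave (l * n) l w)) < real n * (real (r div l div n) + 1)"
      using r(2,3) unfolding N_def distrib_left by linarith+
    then have "nat \<lfloor>real l * fst (interleave (l * n) l w)\<rfloor> = r div l div n"
      using nl by (intro nat_floorI) simp_all
    then show "cell_of l (fst (interleave (l * n) l w)) = vertex_of N w div l div n"
      using jl by (simp add: cell_of_def r_def[symmetric])
    have "r mod l < l" using nl by simp
    then show "cell_of l (snd (interleave (l * n) l w)) = vertex_of N w mod l"
      using co(5) by (simp add: cell_of_def r_def[symmetric])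
  qed
  have lt: "fst (interleave (l * n) l u') < fst (interleave (l * n) l v')"
    if "vertex_of N u' div l < vertex_of N v' div l" "u' \<in> half_open_square" "v' \<in> half_open_square" for u' v'
  proof (rule ccontr)
    assume "\<not> ?thesis"
    then have "real (l * n) * fst (interleave (l * n) l v') \<le> real (l * n) * fst (interleave (l * n) l u')"
      by (intro mult_left_mono) simp_all
    then have "nat \<lfloor>real (l * n) * fst (interleave (l * n) l v')\<rfloor> \<le> nat \<lfloor>real (l * n) * fst (interleave (l * n) l u')\<rfloor>"
      by (intro nat_mono floor_mono)
    then show False using that(1) unfolding cells(3)[OF that(2)] cells(3)[OF that(3)] by simp
  qed
  have eq: "layered l A c (s, t) = (if cell_of l (fst s) \<noteq> cell_of l (fst t) then A (cell_of l (fst s)) (cell_of l (snd s)) (cell_of l (fst t)) (cell_of l (snd t))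
     else if fst s < fst t then c (cell_of l (fst s)) (cell_of l (snd s)) (cell_of l (snd t))
     else if fst t < fst s then c (cell_of l (fst s)) (cell_of l (snd t)) (cell_of l (snd s)) else 0)" for s t
    by (cases s; cases t) (simp add: layered_def)
  note cu = cells(1,2)[OF u, folded p_def] and cv = cells(1,2)[OF v, folded q_def]
  show ?thesis
  proof (cases "p < q")
    case True
    then have "p div l < q div l" using pq by (simp add: div_le_mono le_neq_trans)
    from lt[OF this[unfolded p_def q_def] u v] show ?thesis
      unfolding eq cu cv using True by simp
  next
    case False
    then have "q div l < p div l" using pq by (metis div_le_mono le_neq_trans not_less)
    from lt[OF this[unfolded p_def q_def] v u] show ?thesis
      unfolding eq cu cv using False by simp
  qed
qed

lemma cell_index_vertex:
  assumes N: "0 < N" and x: "0 \<le> fst u" "fst u \<le> 1" and off: "\<forall>k\<in>{..N}. fst u \<noteq> real k / real N"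
  shows "cell_index N (fst u) = Suc (vertex_of N u)" "vertex_of N u < N" "fst u < 1"
proof -
  have ne: "fst u \<noteq> 0" "fst u \<noteq> 1"
    using off[rule_format, of 0] off[rule_format, of N] N by auto
  then show x1: "fst u < 1" using x by simp
  note v = nat_floor_scaled[OF N x(1) x1, folded vertex_of_def]
  show vN: "vertex_of N u < N" by (rule v)
  have "fst u \<noteq> real (vertex_of N u) / real N" using off vN by simp
  then have "real (vertex_of N u) \<noteq> real N * fst u" using N by (simp add: field_simps)
  then have "real (vertex_of N u) < real N * fst u" using v(2) by simp
  then have "\<lceil>real N * fst u\<rceil> = int (Suc (vertex_of N u))"
    using v(3) by (intro ceiling_unique) simp_all
  then show "cell_index N (fst u) = Suc (vertex_of N u)"
    using ne unfolding cell_index_def by (simp only: if_False nat_int)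
qed

text \<open>
  The values of \<open>g\<close> at a homogeneous configuration are the weights of a complete graph, and
  rounding them gives a graph of positive density. Interleave its slices. The distance to the
  layered function is at most the sum of the shift \<open>1 / (l * n)\<close>, the rounding error
  \<open>8 / sqrt N\<close>, the errors \<open>1 / n\<close> and \<open>\<theta>\<close> of the constants, and twice \<open>1 / (l * n)\<close> for the
  pairs inside a block: once as vertices of the graph, and once as points of the square.
\<close>
lemma graph_near_layered:
  fixes g :: "point \<times> point \<Rightarrow> real" and A c :: "_ \<Rightarrow> _"
  assumes g: "borel_orderon g" and n: "1 \<le> n" and l: "1 \<le> l" and \<theta>: "0 \<le> \<theta>"
    and hom: "homogeneous g l A n Q c"
    and close: "\<forall>j<l. \<forall>i<l. \<forall>i'<l. \<bar>c j i i' - c' j i i'\<bar> \<le> \<theta>"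
    and A01: "\<And>j i j' i'. 0 \<le> A j i j' i' \<and> A j i j' i' \<le> 1" and symA: "\<And>j i j' i'. A j i j' i' = A j' i' j i"
    and c01: "\<And>j i i'. j < l \<Longrightarrow> i < l \<Longrightarrow> i' < l \<Longrightarrow> 0 \<le> c' j i i' \<and> c' j i i' \<le> 1"
  shows "\<exists>G \<in> positive_density_property g. fst G = l * (n * l) \<and>
    d_triangle (graph_orderon G) (layered l A c') \<le> 8 / sqrt (real n) + 4 / real n + \<theta>"
proof -
  define N where "N = l * (n * l)"
  have inside: "\<forall>p < N. Q p \<in> box (0, 0) (1, 1)"
    and pairs: "\<forall>p q. p < q \<longrightarrow> q < N \<longrightarrow> fst (Q p) < fst (Q q) \<and> density_point g (Q p, Q q) \<and>
       (p div l \<noteq> q div l \<longrightarrow>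
         \<bar>g (Q p, Q q) - (if p div (n * l) = q div (n * l) then c (p div (n * l)) (p mod l) (q mod l)
           else A (p div (n * l)) (p mod l) (q div (n * l)) (q mod l))\<bar> \<le> 1 / real n)"
    by (rule conjunct1[OF hom[unfolded homogeneous_def], folded N_def],
        rule conjunct2[OF conjunct2[OF hom[unfolded homogeneous_def]], folded N_def])
  have l0: "0 < l" and n0: "0 < n" using l n by auto
  have N0: "0 < N" using l0 n0 by (simp add: N_def)
  have Nkl: "N = (l * n) * l" by (simp add: N_def)
  have Nn: "n \<le> N" using l0 by (simp add: N_def)
  have g01: "0 \<le> g p" "g p \<le> 1" for p using g unfolding borel_orderon_def by blast+
  define w where "w = (\<lambda>p q. if p < q then g (Q p, Q q) else g (Q q, Q p))"
  have wsym: "w p q = w q p" for p q by (cases p q rule: linorder_cases) (simp_all add: w_def)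
  have w01: "0 \<le> w p q" "w p q \<le> 1" for p q by (simp_all add: w_def g01)
  have N1: "1 \<le> N" using N0 by simp
  have wr: "0 \<le> w p q \<and> w p q \<le> 1" for p q using w01[of p q] by simp
  obtain X where X: "X \<subseteq> {(p, q). p < q \<and> q < N}"
    and X0: "\<forall>(p, q)\<in>X. w p q \<noteq> 0" and X1: "\<forall>p q. p < q \<longrightarrow> q < N \<longrightarrow> (p, q) \<notin> X \<longrightarrow> w p q \<noteq> 1"
    and Xcut: "\<forall>S T. S \<subseteq> {..<N} \<longrightarrow> T \<subseteq> {..<N} \<longrightarrow>
       \<bar>\<Sum>p\<in>S. \<Sum>q\<in>T. if p = q then 0 else of_bool ((p, q) \<in> X \<or> (q, p) \<in> X) - w p q\<bar> \<le> 8 * real N * sqrt N"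
    using graph_rounding[where w = w, OF N1 wr wsym] by (elim exE conjE)
  define E where "E = (\<lambda>(p, q). {Suc p, Suc q}) ` X"
  have inE: "{Suc p, Suc q} \<in> E \<longleftrightarrow> (p, q) \<in> X \<or> (q, p) \<in> X" for p q
    by (force simp: E_def doubleton_eq_iff image_iff)
  define G where "G = (N, E)"
  have "is_ordered_graph G"
    unfolding is_ordered_graph_def G_def fst_conv snd_conv
  proof
    fix e assume "e \<in> E"
    then obtain p q where "(p, q) \<in> X" "e = {Suc p, Suc q}" by (auto simp: E_def)
    moreover from this have "p < q" "q < N" using X by auto
    ultimately show "e \<in> {{i, j} |i j. i \<in> {1..N} \<and> j \<in> {1..N} \<and> i \<noteq> j}"
      by (intro CollectI exI[of _ "Suc p"] exI[of _ "Suc q"]) simp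
  qed
  moreover have "ordered_density G g > 0"
    unfolding G_def
  proof (rule ordered_density_pos[OF g, where P = "\<lambda>i. Q (i - 1)"])
    fix i assume "i \<in> {1..N}"
    then show "Q (i - 1) \<in> box (0, 0) (1, 1)" using inside by auto
  next
    fix i j assume ij: "(i, j) \<in> pairs_below N"
    then have lt: "i - 1 < j - 1" "j - 1 < N" and S: "i = Suc (i - 1)" "j = Suc (j - 1)" by (auto simp: pairs_below_def)
    show "fst (Q (i - 1)) < fst (Q (j - 1))" "density_point g (Q (i - 1), Q (j - 1))" using pairs[rule_format, OF lt] by simp_all
    have e: "{i, j} \<in> E \<longleftrightarrow> (i - 1, j - 1) \<in> X"
      using inE[of "i - 1" "j - 1"] X lt S by auto
    have we: "w (i - 1) (j - 1) = g (Q (i - 1), Q (j - 1))" using lt by (simp add: w_def)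
    show "g (Q (i - 1), Q (j - 1)) \<noteq> 0" if "{i, j} \<in> E" using X0 that e we by auto
    show "g (Q (i - 1), Q (j - 1)) \<noteq> 1" if "{i, j} \<notin> E" using X1[rule_format, OF lt] that e we by auto
  qed
  ultimately have GP: "G \<in> positive_density_property g" by (simp add: positive_density_property_def)
  define f where "f = interleave (l * n) l"
  have kl: "0 < l * n" "0 < l" using l0 n0 by simp_all
  have f: "f \<in> square_automorphisms" unfolding f_def by (rule interleave_automorphism[OF kl])
  define L where "L = layered l A c'"
  have L01: "0 \<le> L (u, v) \<and> L (u, v) \<le> 1" for u v
    using A01 c01[OF cell_of_less[OF l0] cell_of_less[OF l0] cell_of_less[OF l0]]
    unfolding L_def by (cases u; cases v) (simp add: layered_def)
  have G01: "0 \<le> graph_orderon G (u, v) \<and> graph_orderon G (u, v) \<le> 1" for u v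
    by (cases u; cases v) (simp add: graph_orderon_def)
  define D where "D = (\<lambda>p q. if p div l div n \<noteq> q div l div n then A (p div l div n) (p mod l) (q div l div n) (q mod l)
     else if p < q then c' (p div l div n) (p mod l) (q mod l) else c' (p div l div n) (q mod l) (p mod l))"
  have divn: "p div (n * l) = p div l div n" for p by (metis div_mult2_eq mult.commute)
  have wD: "\<bar>w p q - D p q\<bar> \<le> 1 / real n + \<theta>" if pq: "p < N" "q < N" "p div l \<noteq> q div l" for p q
  proof -
    have *: "\<bar>g (Q p, Q q) - D p q\<bar> \<le> 1 / real n + \<theta>" if pq: "p < q" "q < N" "p div l \<noteq> q div l" for p q
    proof (cases "p div l div n = q div l div n")
      case True
      have "p div l div n < l" using pq by (simp add: N_def divn[symmetric] less_mult_imp_div_less)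
      then have "\<bar>c (p div l div n) (p mod l) (q mod l) - c' (p div l div n) (p mod l) (q mod l)\<bar> \<le> \<theta>"
        using close[rule_format, of "p div l div n" "p mod l" "q mod l"] l0 by simp
      moreover have "\<bar>g (Q p, Q q) - c (p div l div n) (p mod l) (q mod l)\<bar> \<le> 1 / real n"
        using conjunct2[OF conjunct2[OF pairs[rule_format, OF pq(1,2)]]] pq(3) True by (simp add: divn)
      moreover have "D p q = c' (p div l div n) (p mod l) (q mod l)" using True pq by (simp add: D_def)
      ultimately show ?thesis by linarith
    next
      case False
      have "\<bar>g (Q p, Q q) - A (p div l div n) (p mod l) (q div l div n) (q mod l)\<bar> \<le> 1 / real n"
        using conjunct2[OF conjunct2[OF pairs[rule_format, OF pq(1,2)]]] pq(3) False by (simp add: divn)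
      moreover have "D p q = A (p div l div n) (p mod l) (q div l div n) (q mod l)" using False by (simp add: D_def)
      ultimately show ?thesis using \<theta> by linarith
    qed
    have Dsym: "D p q = D q p" if "p \<noteq> q" for p q
      using that symA by (auto simp: D_def)
    have ne: "p \<noteq> q" using pq by auto
    then consider "p < q" | "q < p" by linarith
    then show ?thesis
    proof cases
      case 1
      then show ?thesis using *[OF 1 pq(2,3)] by (simp add: w_def)
    next
      case 2
      then show ?thesis using *[OF 2 pq(1) pq(3)[symmetric]] Dsym[OF ne] by (simp add: w_def)
    qed
  qed
  define Y where "Y = (\<lambda>p q. of_bool ((p, q) \<in> X \<or> (q, p) \<in> X) - D p q)"
  define B where "B = 8 * real N * sqrt N + real N * real l + real N ^ 2 * (1 / real n + \<theta>)"
  have "cut_norm (\<lambda>(u, v). graph_orderon G (u, v) - L (f u, f v)) \<le> B / real N ^ 2 + 1 / real (l * n)"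
  proof (rule cut_norm_step_le[OF kl, folded Nkl, where Y = Y])
    show "AE p in lborel. p \<in> square2 \<longrightarrow> vertex_of N (fst p) div l \<noteq> vertex_of N (snd p) div l \<longrightarrow>
       (case p of (u, v) \<Rightarrow> graph_orderon G (u, v) - L (f u, f v)) = Y (vertex_of N (fst p)) (vertex_of N (snd p))"
    proof -
      have "AE p in lborel. ((0, 1), (0, 0)) \<bullet> (p :: point \<times> point) \<noteq> 1" "AE p in lborel. ((0, 0), (0, 1)) \<bullet> (p :: point \<times> point) \<noteq> 1"
        by (rule AE_hyperplane, simp add: zero_prod_def)+
      then show ?thesis using AE_off_grid[of N]
      proof eventually_elim
        case (elim p)
        show ?case
        proof (intro impI)
          assume sq: "p \<in> square2" and ne: "vertex_of N (fst p) div l \<noteq> vertex_of N (snd p) div l"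
          obtain u v where p: "p = (u, v)" by (cases p)
          have uv: "u \<in> unit_square" "v \<in> unit_square" using sq by (simp_all add: p)
          have x: "0 \<le> fst u" "fst u \<le> 1" "0 \<le> fst v" "fst v \<le> 1" "0 \<le> snd u" "snd u \<le> 1" "0 \<le> snd v" "snd v \<le> 1"
            using uv by (auto simp: unit_square_cbox mem_cbox_point)
          have s: "snd u \<noteq> 1" "snd v \<noteq> 1" using elim(1,2) by (cases u; cases v; simp add: p)+
          have off: "\<forall>k\<in>{..N}. fst u \<noteq> real k / real N" "\<forall>k\<in>{..N}. fst v \<noteq> real k / real N"
            using off_gridD(1,3)[of N "fst u" "snd u" "fst v" "snd v"] elim(3) by (simp_all add: p)
          note cu = cell_index_vertex[OF N0 x(1,2) off(1)] and cv = cell_index_vertex[OF N0 x(3,4) off(2)]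
          have h: "u \<in> half_open_square" "v \<in> half_open_square" using x s cu(3) cv(3) by (auto simp: half_open_iff)
          have "L (f u, f v) = D (vertex_of N u) (vertex_of N v)"
            unfolding L_def f_def D_def using ne
            by (subst layered_interleave[OF n0 l0 h, folded Nkl]) (simp_all add: p)
          moreover have "graph_orderon G (u, v) = of_bool ({cell_index N (fst u), cell_index N (fst v)} \<in> E)"
            by (cases u; cases v) (simp add: graph_orderon_def G_def)
          ultimately show "(case p of (u, v) \<Rightarrow> graph_orderon G (u, v) - L (f u, f v)) = Y (vertex_of N (fst p)) (vertex_of N (snd p))"
            by (simp add: p Y_def cu(1) cv(1) inE)
        qed
      qed
    qed
    fix p :: "point \<times> point" assume "p \<in> square2"
    show "\<bar>case p of (u, v) \<Rightarrow> graph_orderon G (u, v) - L (f u, f v)\<bar> \<le> 1"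
    proof -
      obtain u v where Pair: "p = (u, v)" by (cases p)
      show ?thesis using G01[of u v] L01[of "f u" "f v"] unfolding Pair prod.case abs_le_iff by linarith
    qed
  next
    fix S T assume ST: "S \<subseteq> {..<N}" "T \<subseteq> {..<N}"
    have fin: "finite S" "finite T" using ST finite_subset by blast+
    have cST: "card S \<le> N" "card T \<le> N" using ST card_mono[of "{..<N}"] by auto
    define Z where "Z = (\<lambda>p q. if p = q then 0 else of_bool ((p, q) \<in> X \<or> (q, p) \<in> X) - w p q)"
    define R where "R = (\<lambda>p q. if p div l = q div l then - Z p q else w p q - D p q)"
    have YZ: "(if p div l = q div l then 0 else Y p q) = Z p q + R p q" for p q
      by (auto simp: Y_def Z_def R_def)
    define bnd where "bnd = (\<lambda>p q. of_bool (p div l = q div l) + (1 / real n + \<theta>))"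
    have Rb: "\<bar>R p q\<bar> \<le> bnd p q" if "p < N" "q < N" for p q
    proof (cases "p div l = q div l")
      case True
      have "\<bar>Z p q\<bar> \<le> 1" using w01[of p q] by (auto simp: Z_def abs_le_iff)
      then have "\<bar>R p q\<bar> \<le> 1" using True by (simp add: R_def)
      moreover have "0 \<le> 1 / real n + \<theta>" using \<theta> by simp
      ultimately show ?thesis using True unfolding bnd_def by simp
    next
      case False
      then show ?thesis using wD[OF that False] by (simp add: R_def bnd_def)
    qed
    have row: "(\<Sum>q\<in>T. of_bool (p div l = q div l)) \<le> real l" for p
    proof -
      have "(\<Sum>q\<in>T. of_bool (p div l = q div l)) = real (card {q \<in> T. p div l = q div l})"
        using fin by (simp add: of_bool_def sum.If_cases Int_def)
      also have "{q \<in> T. p div l = q div l} \<subseteq> {(p div l) * l ..< (p div l) * l + l}"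
      proof
        fix q assume "q \<in> {q \<in> T. p div l = q div l}"
        then have "q = (p div l) * l + q mod l" by (metis (mono_tags, lifting) div_mult_mod_eq mem_Collect_eq)
        moreover have "q mod l < l" using l0 by simp
        ultimately show "q \<in> {(p div l) * l ..< (p div l) * l + l}" by simp
      qed
      then have "card {q \<in> T. p div l = q div l} \<le> card {(p div l) * l ..< (p div l) * l + l}"
        by (intro card_mono) simp_all
      then have "real (card {q \<in> T. p div l = q div l}) \<le> real l" by simp
      finally show ?thesis by simp
    qed
    have "\<bar>\<Sum>p\<in>S. \<Sum>q\<in>T. R p q\<bar> \<le> (\<Sum>p\<in>S. \<Sum>q\<in>T. bnd p q)"
      using ST by (intro order_trans[OF sum_abs] sum_mono order_trans[OF sum_abs] Rb) auto
    also have "\<dots> \<le> (\<Sum>p\<in>S. real l + real N * (1 / real n + \<theta>))"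
    proof (rule sum_mono)
      fix p
      have "(\<Sum>q\<in>T. bnd p q) = (\<Sum>q\<in>T. of_bool (p div l = q div l)) + real (card T) * (1 / real n + \<theta>)"
        by (simp add: bnd_def sum.distrib)
      also have "\<dots> \<le> real l + real N * (1 / real n + \<theta>)"
        using cST \<theta> by (intro add_mono row mult_right_mono) auto
      finally show "(\<Sum>q\<in>T. bnd p q) \<le> real l + real N * (1 / real n + \<theta>)" .
    qed
    also have "\<dots> \<le> real N * (real l + real N * (1 / real n + \<theta>))"
      using cST \<theta> by (simp add: mult_right_mono)
    finally have R: "\<bar>\<Sum>p\<in>S. \<Sum>q\<in>T. R p q\<bar> \<le> real N * real l + real N ^ 2 * (1 / real n + \<theta>)"
      by (simp add: power2_eq_square algebra_simps)
    have Z: "\<bar>\<Sum>p\<in>S. \<Sum>q\<in>T. Z p q\<bar> \<le> 8 * real N * sqrt N"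
      using Xcut ST unfolding Z_def by blast
    have "(\<Sum>p\<in>S. \<Sum>q\<in>T. if p div l = q div l then 0 else Y p q) = (\<Sum>p\<in>S. \<Sum>q\<in>T. Z p q) + (\<Sum>p\<in>S. \<Sum>q\<in>T. R p q)"
      unfolding YZ by (simp add: sum.distrib)
    then show "\<bar>\<Sum>p\<in>S. \<Sum>q\<in>T. if p div l = q div l then 0 else Y p q\<bar> \<le> B"
      using R Z unfolding B_def by linarith
  qed
  also have "B / real N ^ 2 = 8 / sqrt (real N) + real l / real N + (1 / real n + \<theta>)"
  proof -
    have "real N = sqrt N * sqrt N" by simp
    then have "8 * real N * sqrt N / real N ^ 2 = 8 / sqrt N"
      using N0 by (simp add: power2_eq_square divide_simps)
    then show ?thesis using N0 by (simp add: B_def add_divide_distrib power2_eq_square)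
  qed
  finally have cn: "cut_norm (\<lambda>(u, v). graph_orderon G (u, v) - L (f u, f v)) \<le> 8 / sqrt (real N) + real l / real N + (1 / real n + \<theta>) + 1 / real (l * n)" .
  have b1: "8 / sqrt (real N) \<le> 8 / sqrt (real n)" using Nn n0 by (intro divide_left_mono) auto
  have b2: "real l / real N = 1 / real (l * n)" using l0 by (simp add: N_def)
  have b3: "1 / real (l * n) \<le> 1 / real n" using l0 n0 by (intro divide_left_mono) auto
  have "shift f \<le> 1 / real (l * n)" unfolding f_def by (rule shift_interleave_le[OF kl])
  moreover have "d_triangle (graph_orderon G) L \<le> shift f + cut_norm (\<lambda>(u, v). graph_orderon G (u, v) - L (f u, f v))"
    by (rule d_triangle_bounds(2)[OF _ _ f]) (use G01 L01 in auto)
  ultimately have "d_triangle (graph_orderon G) L \<le> 8 / sqrt (real n) + 4 / real n + \<theta>"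
    using cn b1 b2 b3 by simp
  then show ?thesis using GP by (intro bexI[of _ G]) (simp_all add: G_def L_def N_def)
qed

section \<open>Layered orderons in the closure\<close>

lemma finite_family_convergent_subsequence:
  fixes c :: "nat \<Rightarrow> 'k \<Rightarrow> real"
  assumes "finite K" "\<And>n k. k \<in> K \<Longrightarrow> \<bar>c n k\<bar> \<le> B"
  shows "\<exists>r. strict_mono r \<and> (\<forall>k\<in>K. convergent (\<lambda>n. c (r n) k))"
  using assms
proof (induction K rule: finite_induct)
  case empty
  then show ?case by (intro exI[of _ id]) (simp add: strict_mono_def)
next
  case (insert k K)
  then obtain r where r: "strict_mono r" "\<forall>k\<in>K. convergent (\<lambda>n. c (r n) k)" by auto
  have "bounded (range (\<lambda>n. c (r n) k))"
    using insert.prems by (intro boundedI[of _ B]) auto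
  then obtain L s where s: "strict_mono s" "((\<lambda>n. c (r n) k) \<circ> s) \<longlonglongrightarrow> L"
    using bounded_imp_convergent_subsequence by blast
  have "convergent (\<lambda>n. c (r (s n)) k')" if "k' \<in> insert k K" for k'
  proof (cases "k' = k")
    case True
    then show ?thesis using s(2) by (auto simp: convergent_def o_def)
  next
    case False
    then have "convergent ((\<lambda>n. c (r n) k') \<circ> s)"
      using r(2) that s(1) by (intro convergent_subseq_convergent) auto
    then show ?thesis by (simp add: o_def)
  qed
  then show ?case
    using strict_mono_o[OF r(1) s(1)] by (intro exI[of _ "r \<circ> s"]) (simp add: o_def)
qed

lemma positive_density_property_cong:
  assumes "borel_orderon g" "AE p in lborel. p \<in> square2 \<longrightarrow> U p = g p"
  shows "positive_density_property U = positive_density_property g"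
  unfolding positive_density_property_def ordered_density_cong[OF assms] ..

lemma d1_cong:
  assumes g: "g \<in> borel_measurable borel" and W: "W \<in> borel_measurable borel"
    and ae: "AE p in lborel. p \<in> square2 \<longrightarrow> U p = g p"
  shows "d1 U W = d1 g W"
proof -
  let ?f = "\<lambda>V p. indicator square2 p *\<^sub>R \<bar>V p - W p\<bar> :: real"
  have m: "?f g \<in> borel_measurable lebesgue"
    using g W square2_borel by (intro measurable_completion) simp
  have "AE p in lborel. ?f U p = ?f g p"
    using ae by (rule eventually_mono) (simp add: indicator_def)
  then have a: "AE p in lebesgue. ?f U p = ?f g p" by (rule AE_completion)
  have "?f U \<in> borel_measurable lebesgue"
    by (rule completion_measurable_AE[OF m a]) simp
  from integral_cong_AE[OF this m a] show ?thesis
    by (simp add: d1_def set_lebesgue_integral_def)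
qed

text \<open>
  For each \<open>n\<close> there is a homogeneous configuration with \<open>n\<close> blocks per strip, but its constants
  inside the strips depend on \<open>n\<close>. These are finitely many numbers in the unit interval, so
  they converge along a subsequence; the limits are the constants wanted, and the graphs that
  belong to the subsequence converge to the layered orderon.
\<close>
lemma layered_in_closure:
  fixes x :: "nat \<Rightarrow> real" and a :: "nat \<Rightarrow> nat \<Rightarrow> real"
  assumes g: "borel_orderon g" and l: "0 < l"
    and sp: "strip_points g l x a"
  shows "\<exists>c. (\<forall>j<l. \<forall>i<l. \<forall>i'<l. 0 \<le> c j i i' \<and> c j i i' \<le> 1) \<and>
     layered l (sampled g x a) c \<in> property_closure (positive_density_property g)"
proof -
  have g01: "0 \<le> g p" "g p \<le> 1" for p using g unfolding borel_orderon_def by blast+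
  have gsym: "g (u, v) = g (v, u)" for u v using g unfolding borel_orderon_def by blast
  define A where "A = (sampled g x a)"
  have A01: "0 \<le> A j i j' i' \<and> A j i j' i' \<le> 1" for j i j' i' by (simp add: A_def g01)
  have symA: "A j i j' i' = A j' i' j i" for j i j' i' unfolding A_def by (rule gsym)
  have l1: "1 \<le> l" using l by simp
  have "\<exists>Q c. homogeneous g l A (Suc n) Q c" for n
    unfolding A_def by (rule homogeneous_points[OF g l1 _ sp]) simp
  then obtain Q c where Qc: "\<And>n. homogeneous g l A (Suc n) (Q n) (c n)" by metis
  define K where "K = {..<l} \<times> {..<l} \<times> {..<l}"
  define ck where "ck = (\<lambda>n (j, i, i'). c n j i i')"
  have c01: "0 \<le> c n j i i' \<and> c n j i i' \<le> 1" if "j < l" "i < l" "i' < l" for n j i i'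
    using Qc[of n] that unfolding homogeneous_def by blast
  have "\<bar>ck n k\<bar> \<le> 1" if "k \<in> K" for n k
    using that c01 by (auto simp: K_def ck_def abs_le_iff intro: order_trans[of _ 0])
  from finite_family_convergent_subsequence[of K ck 1, OF _ this]
  obtain r where r: "strict_mono r" and rc: "\<forall>k\<in>K. convergent (\<lambda>n. ck (r n) k)" by (auto simp: K_def)
  define c' where "c' = (\<lambda>j i i'. lim (\<lambda>n. ck (r n) (j, i, i')))"
  have lim: "(\<lambda>n. c (r n) j i i') \<longlonglongrightarrow> c' j i i'" if "j < l" "i < l" "i' < l" for j i i'
    using rc that unfolding c'_def by (auto simp: K_def ck_def convergent_LIMSEQ_iff)
  have c'01: "0 \<le> c' j i i' \<and> c' j i i' \<le> 1" if "j < l" "i < l" "i' < l" for j i i'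
    using LIMSEQ_le_const[OF lim[OF that]] LIMSEQ_le_const2[OF lim[OF that]] c01[OF that] by blast
  define \<theta> where "\<theta> = (\<lambda>n. \<Sum>(j, i, i')\<in>K. \<bar>c (r n) j i i' - c' j i i'\<bar>)"
  have th0: "0 \<le> \<theta> n" for n unfolding \<theta>_def by (intro sum_nonneg) auto
  have close: "\<bar>c (r n) j i i' - c' j i i'\<bar> \<le> \<theta> n" if "j < l" "i < l" "i' < l" for n j i i'
    using member_le_sum[of "(j, i, i')" K "\<lambda>(j, i, i'). \<bar>c (r n) j i i' - c' j i i'\<bar>"] that
    by (auto simp: K_def \<theta>_def)
  have thlim: "\<theta> \<longlonglongrightarrow> 0"
  proof -
    have "(\<lambda>n. \<Sum>k\<in>K. case k of (j, i, i') \<Rightarrow> \<bar>c (r n) j i i' - c' j i i'\<bar>) \<longlonglongrightarrow> (\<Sum>k\<in>K. 0)"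
    proof (rule tendsto_sum)
      fix k assume "k \<in> K"
      then obtain j i i' where k: "k = (j, i, i')" "j < l" "i < l" "i' < l" by (auto simp: K_def)
      have "(\<lambda>n. \<bar>c (r n) j i i' - c' j i i'\<bar>) \<longlonglongrightarrow> \<bar>c' j i i' - c' j i i'\<bar>"
        by (intro tendsto_intros lim k)
      then show "(\<lambda>n. case k of (j, i, i') \<Rightarrow> \<bar>c (r n) j i i' - c' j i i'\<bar>) \<longlonglongrightarrow> 0" by (simp add: k)
    qed
    then show ?thesis by (simp add: \<theta>_def)
  qed
  let ?m = "\<lambda>n. Suc (r n)"
  have "\<exists>G \<in> positive_density_property g. fst G = l * (?m n * l) \<and>
      d_triangle (graph_orderon G) (layered l A c') \<le> 8 / sqrt (real (?m n)) + 4 / real (?m n) + \<theta> n" for n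
    by (rule graph_near_layered[OF g _ l1 th0 Qc _ A01 symA c'01]) (auto intro: close)
  then obtain G where G: "\<And>n. G n \<in> positive_density_property g" "\<And>n. fst (G n) = l * (?m n * l)"
      "\<And>n. d_triangle (graph_orderon (G n)) (layered l A c') \<le> 8 / sqrt (real (?m n)) + 4 / real (?m n) + \<theta> n"
    by metis
  have ord: "orderon (layered l A c')" by (rule layered_orderon[OF l A01 symA c'01])
  have nr: "n \<le> r n" for n using r by (rule seq_suble)
  have big: "n \<le> fst (G n)" for n
  proof -
    have "n \<le> ?m n * 1" using nr[of n] by simp
    also have "\<dots> \<le> ?m n * l" using l1 by (intro mult_le_mono2)
    also have "\<dots> \<le> l * (?m n * l)" using l1 by simp
    finally show ?thesis by (simp add: G(2))
  qed
  have "filterlim (\<lambda>n. fst (G n)) at_top sequentially"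
    by (rule filterlim_at_top_mono[OF filterlim_ident]) (simp add: big)
  moreover have "(\<lambda>n. d_triangle (graph_orderon (G n)) (layered l A c')) \<longlonglongrightarrow> 0"
  proof (rule tendsto_sandwich[OF _ _ tendsto_const])
    show "\<forall>\<^sub>F n in sequentially. 0 \<le> d_triangle (graph_orderon (G n)) (layered l A c')"
    proof (intro always_eventually allI d_triangle_bounds(1))
      show "interleave 1 1 \<in> square_automorphisms" by (rule interleave_automorphism) simp_all
      show "0 \<le> graph_orderon (G n) (u, v) \<and> graph_orderon (G n) (u, v) \<le> 1" for n u v
        by (cases u; cases v) (simp add: graph_orderon_def)
      show "0 \<le> layered l A c' (u, v) \<and> layered l A c' (u, v) \<le> 1" if "u \<in> unit_square" "v \<in> unit_square" for u v
        using ord that unfolding orderon_def by blast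
    qed
    show "\<forall>\<^sub>F n in sequentially. d_triangle (graph_orderon (G n)) (layered l A c') \<le> 8 / sqrt (real (?m n)) + 4 / real (?m n) + \<theta> n"
      by (intro always_eventually allI G(3))
    have m: "filterlim (\<lambda>n. real (?m n)) at_top sequentially"
    proof (rule filterlim_at_top_mono[OF filterlim_real_sequentially])
      show "\<forall>\<^sub>F n in sequentially. real n \<le> real (?m n)" using nr by (intro always_eventually allI) (simp only: of_nat_le_iff le_SucI)
    qed
    have "(\<lambda>n. 8 / sqrt (real (?m n)) + 4 / real (?m n) + \<theta> n) \<longlonglongrightarrow> 0 + 0 + 0"
      by (intro tendsto_add thlim tendsto_divide_0[OF tendsto_const]
          filterlim_at_top_imp_at_infinity m filterlim_compose[OF sqrt_at_top m])
    then show "(\<lambda>n. 8 / sqrt (real (?m n)) + 4 / real (?m n) + \<theta> n) \<longlonglongrightarrow> 0" by simp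
  qed
  ultimately have "layered l A c' \<in> property_closure (positive_density_property g)"
    unfolding property_closure_def using ord G(1) by blast
  then show ?thesis using c'01 unfolding A_def by (intro exI[of _ c'] conjI) simp_all
qed

theorem lemma9p10:
  fixes U :: "point \<times> point \<Rightarrow> real" and \<epsilon> :: real
  assumes "orderon U" and "\<epsilon> > 0"
  shows "\<exists>(l::nat) U'. strip_layered l l U' \<and>
           U' \<in> property_closure (positive_density_property U) \<and>
           d1 U U' \<le> \<epsilon>"
proof -
  obtain g where g: "borel_orderon g" and ae: "AE p in lborel. p \<in> square2 \<longrightarrow> U p = g p"
    using borel_orderon_version[OF assms(1)] by blast
  have gm: "g \<in> borel_measurable borel" using g by (simp add: borel_orderon_def)
  have g01: "0 \<le> g p" "g p \<le> 1" for p using g unfolding borel_orderon_def by blast+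
  have gsym: "g (u, v) = g (v, u)" for u v using g unfolding borel_orderon_def by blast
  obtain l x a where l: "0 < l" and sp: "strip_points g l x a"
    and near: "\<forall>c. (\<forall>j<l. \<forall>i<l. \<forall>i'<l. 0 \<le> c j i i' \<and> c j i i' \<le> 1) \<longrightarrow>
        d1 g (layered l (sampled g x a) c) \<le> \<epsilon>"
    using exists_layered_approx[OF g assms(2)] by (elim exE conjE)
  obtain c where c01: "\<forall>j<l. \<forall>i<l. \<forall>i'<l. 0 \<le> c j i i' \<and> c j i i' \<le> 1"
    and cl: "layered l (sampled g x a) c \<in> property_closure (positive_density_property g)"
    using layered_in_closure[OF g l sp] by (elim exE conjE)
  let ?W = "layered l (sampled g x a) c"
  have "strip_layered l l ?W"
    by (rule layered_strip_layered[OF l]) (use g01 gsym c01 in blast)+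
  moreover have "?W \<in> property_closure (positive_density_property U)"
    using cl by (simp only: positive_density_property_cong[OF g ae])
  moreover have "d1 U ?W \<le> \<epsilon>"
    using near c01 by (simp only: d1_cong[OF gm layered_borel ae])
  ultimately show ?thesis by (intro exI conjI)
qed

end
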